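(* Assume that the following conditions hold. (1) $\mu\mapsto q_{ij}(\mu)$ is continuous on $\mathcal P(U)$ for every $i,j\in\mathcal S$, and $M:=\sup_{i\in\mathcal S}\sup_{\mu\in\mathcal P(U)}q_i(\mu)<\infty$. (2) There exist a compact function $\Phi:\mathcal S\to[1,\infty)$ (i.e. $\{i\in\mathcal S:\Phi(i)\le c\}$ is compact for every $c\in\mathbb R$), a compact set $B_0\subset\mathcal S$, and constants $\lambda_0>0$, $\kappa_0\ge 0$ such that for all $i\in\mathcal S$, $\mu\in\mathcal P(U)$, $\sum_{j\ne i}q_{ij}(\mu)(\Phi(j)-\Phi(i))\le\lambda_0\Phi(i)+\kappa_0\mathbf 1_{B_0}(i)$. (3) There exists $K\in\mathbb N$ such that for every $i\in\mathcal S$ and $\mu\in\mathcal P(U)$, $q_{ij}(\mu)=0$ whenever $|j-i|>K$. (4) $f$ and $g$ are bounded, and there is a constant $C_0$ such that $|f(t,i,\mu)-f(s,i,\mu)|\le C_0|t-s|$ for all $s,t\in[0,T]$, $i\in\mathcal S$, $\mu\in\mathcal P(U)$. Then the value function $V(t,i)$ is the unique viscosity solution to the HJB equation $$-\frac{\partial v}{\partial t}(t,i)-\inf_{\mu\in\mathcal P(U)}\Big\{\sum_{j\ne i}q_{ij}(\mu)\big(v(t,j)-v(t,i)\big)+f(t,i,\mu)\Big\}=0,\qquad v(T,i)=g(i).$$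
   Context: Fix $T>0$. Let $(\Omega,\mathcal F,(\mathcal F_t)_{t\ge0},\mathbb P)$ be a filtered probability space satisfying the usual conditions. $\mathcal S=\{1,2,\dots\}$ is the state space with the discrete topology; $U\subset\mathbb R^k$ is a compact action space; $\mathcal P(U)$ is the space of probability measures on $U$ with the $L_1$-Wasserstein distance $W_1$ (equivalently, the weak topology). For each $\mu\in\mathcal P(U)$, $(q_{ij}(\mu))_{i,j\in\mathcal S}$ is a conservative transition rate matrix: $\sum_{j\ne i}q_{ij}(\mu)=q_i(\mu)=-q_{ii}(\mu)$ for all $i$. Delay-dependent controls. Fix $m\in\mathbb Z_+$ and $r_0\in(0,T)$. For a right-continuous path with left limits $\lambda:[0,T]\to\mathcal S$, $s\in[0,T]$ and $k\in\mathbb Z_+$, put $(\theta^k_{s,r_0}\lambda)(t)=\lambda((t-kr_0)\vee s)$. Given $s\in[0,T)$ and $i\in\mathcal S$, a (randomized) delay-dependent control is a term $\alpha=(\Lambda_t,\mu_t,s,i)$ such that: (i) $(\Lambda_t)$ is an $\mathcal F_t$-adapted jump process on $\mathcal S$ with $\Lambda_s=i$ and, for $\delta>0$, $\mathbb P(\Lambda_{t+\delta}=j\mid\Lambda_t=l,\mu_t=\mu)=q_{lj}(\mu)\delta+o(\delta)$ if $j\neq l$ and $=1+q_{ll}(\mu)\delta+o(\delta)$ if $j=l$; (ii) there is a measurable map $h:[0,T]\times\mathcal S^{m+1}\to\mathcal P(U)$ such that $\mu_t=h(t,\theta^0_{s,r_0}\Lambda(t),\dots,\theta^m_{s,r_0}\Lambda(t))$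 for almost all $t\in[s,T]$. The set of all delay-dependent controls with initial condition $(s,i)$ is $\Pi_{s,i}$. Cost and value. $f:[0,T]\times\mathcal S\times\mathcal P(U)\to[0,\infty)$ and $g:\mathcal S\to[0,\infty)$ are lower semi-continuous. For $\alpha\in\Pi_{s,i}$, $J(s,i,\alpha)=\mathbb E\big[\int_s^Tf(t,\Lambda_t,\mu_t)\,dt+g(\Lambda_T)\big]$, $V(s,i)=\inf_{\alpha\in\Pi_{s,i}}J(s,i,\alpha)$ for $s<T$, and $V(T,i)=g(i)$. Viscosity solutions. Let $v:[0,T]\times\mathcal S\to\mathbb R$ be continuous. $v$ is a viscosity supersolution (resp. subsolution) of the HJB equation if $v(T,i)=g(i)$ for all $i\in\mathcal S$ and $$-\frac{\partial\phi}{\partial t}(t_0,i_0)-\inf_{\mu\in\mathcal P(U)}\Big\{\sum_{j\ne i_0}q_{i_0j}(\mu)\big(\phi(t_0,j)-\phi(t_0,i_0)\big)+f(t_0,i_0,\mu)\Big\}\ge0\quad(\text{resp. }\le0)$$ for all $(t_0,i_0)\in[0,T)\times\mathcal S$ and all $\phi\in C^1([0,T)\times\mathcal S)$ (i.e. $\phi(\cdot,i)\in C^1([0,T))$ for each $i$) such that $(t_0,i_0)$ is a minimum (resp. maximum) point of $v-\phi$ over $[0,T)\times\mathcal S$. $v$ is a viscosity solution if it is both a viscosity subsolution and a viscosity supersolution.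
   Formalization: Uniqueness is among solutions with v(t,i)=o(Φ(i)) uniformly in t (it fails otherwise); the filtered space is assumed to carry adapted Poisson processes of every intensity with iid uniform marks; the o(δ) remainder in (i) is also bounded by Cδ uniformly in t, l, j, μ. *)

theory Defs
  imports "HOL-Probability.Probability" "HOL-Library.Landau_Symbols"
begin

text \<open>The state space. Functions of a state are functions on \<^typ>\<open>nat\<close> whose value at \<open>0\<close> is
  irrelevant; the topology of \<^typ>\<open>nat\<close> is the discrete one.\<close>

abbreviation states :: "nat set" where
  "states \<equiv> {1..}"

subsection \<open>Probability measures on the action space\<close>

definition prob_measures :: "'u::topological_space set \<Rightarrow> 'u measure set" where
  "prob_measures U = space (prob_algebra (restrict_space borel U))"

text \<open>For compact \<open>U\<close> every continuous function on \<open>U\<close> is bounded, and this topology is the one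
  metrised by the \<open>L\<^sub>1\<close>-Wasserstein distance.\<close>

definition weak_topology :: "'u::topological_space set \<Rightarrow> 'u measure topology" where
  "weak_topology U = topology_generated_by
     {{\<mu> \<in> prob_measures U. integral\<^sup>L \<mu> \<phi> \<in> V} | (\<phi> :: 'u \<Rightarrow> real) V.
        continuous_on U \<phi> \<and> open V}"

definition borel_prob :: "'u::topological_space set \<Rightarrow> 'u measure measure" where
  "borel_prob U = sigma (prob_measures U) {A. openin (weak_topology U) A}"

definition lower_semicontinuous_map :: "'a topology \<Rightarrow> ('a \<Rightarrow> real) \<Rightarrow> bool" where
  "lower_semicontinuous_map X f \<longleftrightarrow> (\<forall>c. openin X {x \<in> topspace X. c < f x})"

subsection \<open>Controlled transition rates\<close>

definition conservative_rates ::
    "'u::topological_space set \<Rightarrow> (nat \<Rightarrow> nat \<Rightarrow> 'u measure \<Rightarrow> real) \<Rightarrow> bool" where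
  "conservative_rates U q \<longleftrightarrow>
     (\<forall>\<mu>\<in>prob_measures U. \<forall>i\<in>states.
        (\<forall>j\<in>states - {i}. 0 \<le> q i j \<mu>) \<and>
        ((\<lambda>j. q i j \<mu>) has_sum (- q i i \<mu>)) (states - {i}))"

definition generator ::
    "(nat \<Rightarrow> nat \<Rightarrow> 'u measure \<Rightarrow> real) \<Rightarrow> 'u measure \<Rightarrow> (nat \<Rightarrow> real) \<Rightarrow> nat \<Rightarrow> real" where
  "generator q \<mu> w i = (\<Sum>\<^sub>\<infinity>j\<in>states - {i}. q i j \<mu> * (w j - w i))"

subsection \<open>Filtered probability spaces\<close>

definition usual_conditions :: "'w measure \<Rightarrow> (real \<Rightarrow> 'w measure) \<Rightarrow> bool" where
  "usual_conditions M F \<longleftrightarrow>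
     prob_space M \<and>
     (\<forall>t\<ge>0. subalgebra M (F t)) \<and>
     (\<forall>s\<ge>0. \<forall>t\<ge>s. sets (F s) \<subseteq> sets (F t)) \<and>
     (\<forall>t\<ge>0. sets (F t) = (\<Inter>u\<in>{t<..}. sets (F u))) \<and>
     (\<forall>N\<in>null_sets M. \<forall>A\<subseteq>N. A \<in> sets (F 0))"

text \<open>The space carries, for every intensity \<open>a\<close>, an adapted homogeneous Poisson process with
  interarrival times \<open>\<sigma> n\<close> and independent uniform marks \<open>\<xi> n\<close>; the last condition says that the
  pairs (arrival time, mark) up to time \<open>t\<close> are known at time \<open>t\<close>. This is the noise needed to
  realise controlled jump processes on a given space (without it there may be none, for
  instance on a one-point space). An adapted Poisson random measure on the quarter plane
  with Lebesgue intensity is sufficient.\<close>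

definition carries_marked_poisson :: "'w measure \<Rightarrow> (real \<Rightarrow> 'w measure) \<Rightarrow> bool" where
  "carries_marked_poisson M F \<longleftrightarrow>
     (\<forall>a>0. \<exists>(\<sigma> :: nat \<Rightarrow> 'w \<Rightarrow> real) (\<xi> :: nat \<Rightarrow> 'w \<Rightarrow> real).
        prob_space.indep_vars M (\<lambda>_. borel) (\<lambda>k. case k of Inl n \<Rightarrow> \<sigma> n | Inr n \<Rightarrow> \<xi> n) UNIV \<and>
        (\<forall>n. distributed M lborel (\<sigma> n) (exponential_density a)) \<and>
        (\<forall>n. distr M lborel (\<xi> n) = uniform_measure lborel {0..1}) \<and>
        (\<forall>n. \<forall>t\<ge>0. \<forall>x. {\<omega> \<in> space M. (\<Sum>k\<le>n. \<sigma> k \<omega>) \<le> t \<and> \<xi> n \<omega> \<le> x} \<in> sets (F t)))"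

subsection \<open>Delay-dependent controls\<close>

text \<open>The path \<open>\<theta>\<^sup>k\<close> of a path \<open>x\<close>, delayed by \<open>k * r0\<close> and stopped at the initial time \<open>s\<close>.\<close>

definition delay_path :: "real \<Rightarrow> real \<Rightarrow> nat \<Rightarrow> (real \<Rightarrow> nat) \<Rightarrow> real \<Rightarrow> nat" where
  "delay_path s r0 k x t = x (max (t - real k * r0) s)"

definition cadlag_on :: "real \<Rightarrow> real \<Rightarrow> (real \<Rightarrow> nat) \<Rightarrow> bool" where
  "cadlag_on s T x \<longleftrightarrow>
     (\<forall>t\<in>{s..<T}. (x \<longlongrightarrow> x t) (at_right t)) \<and>
     (\<forall>t\<in>{s<..T}. \<exists>l. (x \<longlongrightarrow> l) (at_left t))"

definition current_info ::
    "'w measure \<Rightarrow> 'u::topological_space set \<Rightarrow> ('w \<Rightarrow> nat) \<Rightarrow> ('w \<Rightarrow> 'u measure) \<Rightarrow> 'w measure" where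
  "current_info M U X \<nu> =
     vimage_algebra (space M) (\<lambda>\<omega>. (X \<omega>, \<nu> \<omega>)) (count_space states \<Otimes>\<^sub>M borel_prob U)"

text \<open>The number \<open>p t \<delta> l j \<nu>\<close> is a version of the conditional probability that the process is in
  \<open>j\<close> at time \<open>t + \<delta>\<close>, given that at time \<open>t\<close> the state is \<open>l\<close> and the action is \<open>\<nu>\<close>. The
  remainder in its expansion is \<open>o(\<delta>)\<close> for all \<open>t\<close>, \<open>l\<close>, \<open>j\<close>, \<open>\<nu>\<close>, and it is \<open>O(\<delta>)\<close> uniformly in these
  arguments. The uniform bound cannot be dropped: a jump at a deterministic time \<open>t0\<close> is
  invisible to the expansions at each fixed \<open>t < t0\<close> as \<open>\<delta>\<close> tends to \<open>0\<close>.\<close>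

definition has_controlled_rates ::
    "'w measure \<Rightarrow> real \<Rightarrow> 'u::topological_space set \<Rightarrow> (nat \<Rightarrow> nat \<Rightarrow> 'u measure \<Rightarrow> real) \<Rightarrow>
     real \<Rightarrow> (real \<Rightarrow> 'w \<Rightarrow> nat) \<Rightarrow> (real \<Rightarrow> 'w \<Rightarrow> 'u measure) \<Rightarrow> bool" where
  "has_controlled_rates M T U q s \<Lambda> \<mu> \<longleftrightarrow>
     (\<exists>(p :: real \<Rightarrow> real \<Rightarrow> nat \<Rightarrow> nat \<Rightarrow> 'u measure \<Rightarrow> real) C.
        \<forall>t\<in>{s..<T}. \<forall>j\<in>states.
          (\<forall>\<delta>\<in>{0<..T - t}. AE \<omega> in M.
             real_cond_exp M (current_info M U (\<Lambda> t) (\<mu> t))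
               (indicator {\<omega> \<in> space M. \<Lambda> (t + \<delta>) \<omega> = j}) \<omega>
             = p t \<delta> (\<Lambda> t \<omega>) j (\<mu> t \<omega>)) \<and>
          (\<forall>l\<in>states. \<forall>\<nu>\<in>prob_measures U.
             (\<lambda>\<delta>. p t \<delta> l j \<nu> - (of_bool (j = l) + q l j \<nu> * \<delta>)) \<in> o[at_right 0](\<lambda>\<delta>. \<delta>) \<and>
             (\<forall>\<delta>\<in>{0<..T - t}. \<bar>p t \<delta> l j \<nu> - (of_bool (j = l) + q l j \<nu> * \<delta>)\<bar> \<le> C * \<delta>)))"

definition delay_controls ::
    "'w measure \<Rightarrow> (real \<Rightarrow> 'w measure) \<Rightarrow> real \<Rightarrow> 'u::topological_space set \<Rightarrow>
     (nat \<Rightarrow> nat \<Rightarrow> 'u measure \<Rightarrow> real) \<Rightarrow> nat \<Rightarrow> real \<Rightarrow> real \<Rightarrow> nat \<Rightarrow>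
     ((real \<Rightarrow> 'w \<Rightarrow> nat) \<times> (real \<Rightarrow> 'w \<Rightarrow> 'u measure)) set" where
  "delay_controls M F T U q m r0 s i = {(\<Lambda>, \<mu>).
     (\<forall>t\<in>{s..T}. \<Lambda> t \<in> F t \<rightarrow>\<^sub>M count_space states) \<and>
     (\<forall>\<omega>\<in>space M. cadlag_on s T (\<lambda>t. \<Lambda> t \<omega>)) \<and>
     (AE \<omega> in M. \<Lambda> s \<omega> = i) \<and>
     (\<lambda>(t, \<omega>). \<mu> t \<omega>) \<in> restrict_space borel {s..T} \<Otimes>\<^sub>M M \<rightarrow>\<^sub>M borel_prob U \<and>
     has_controlled_rates M T U q s \<Lambda> \<mu> \<and>
     (\<exists>h \<in> restrict_space borel {0..T} \<Otimes>\<^sub>M (\<Pi>\<^sub>M k\<in>{..m}. count_space states) \<rightarrow>\<^sub>M borel_prob U.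
        AE t in lborel. t \<in> {s..T} \<longrightarrow>
          (AE \<omega> in M. \<mu> t \<omega> = h (t, \<lambda>k\<in>{..m}. delay_path s r0 k (\<lambda>u. \<Lambda> u \<omega>) t)))}"

subsection \<open>Cost and value\<close>

definition cost ::
    "'w measure \<Rightarrow> real \<Rightarrow> (real \<Rightarrow> nat \<Rightarrow> 'u measure \<Rightarrow> real) \<Rightarrow> (nat \<Rightarrow> real) \<Rightarrow> real \<Rightarrow>
     (real \<Rightarrow> 'w \<Rightarrow> nat) \<times> (real \<Rightarrow> 'w \<Rightarrow> 'u measure) \<Rightarrow> ennreal" where
  "cost M T f g s \<alpha> = (case \<alpha> of (\<Lambda>, \<mu>) \<Rightarrow>
     \<integral>\<^sup>+\<omega>. ((\<integral>\<^sup>+t\<in>{s..T}. ennreal (f t (\<Lambda> t \<omega>) (\<mu> t \<omega>)) \<partial>lborel) + ennreal (g (\<Lambda> T \<omega>))) \<partial>M)"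

definition value_fun ::
    "'w measure \<Rightarrow> (real \<Rightarrow> 'w measure) \<Rightarrow> real \<Rightarrow> 'u::topological_space set \<Rightarrow>
     (nat \<Rightarrow> nat \<Rightarrow> 'u measure \<Rightarrow> real) \<Rightarrow> nat \<Rightarrow> real \<Rightarrow>
     (real \<Rightarrow> nat \<Rightarrow> 'u measure \<Rightarrow> real) \<Rightarrow> (nat \<Rightarrow> real) \<Rightarrow> real \<Rightarrow> nat \<Rightarrow> ennreal" where
  "value_fun M F T U q m r0 f g s i =
     (if s < T then (INF \<alpha>\<in>delay_controls M F T U q m r0 s i. cost M T f g s \<alpha>)
      else ennreal (g i))"

subsection \<open>Viscosity solutions\<close>

text \<open>\<open>\<phi>'\<close> is the time derivative of the test function \<open>\<phi>\<close>, one-sided at time \<open>0\<close>.\<close>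

definition C1_test_function :: "real \<Rightarrow> (real \<Rightarrow> nat \<Rightarrow> real) \<Rightarrow> (real \<Rightarrow> nat \<Rightarrow> real) \<Rightarrow> bool" where
  "C1_test_function T \<phi> \<phi>' \<longleftrightarrow>
     (\<forall>i\<in>states.
        (\<forall>t\<in>{0..<T}. ((\<lambda>t. \<phi> t i) has_real_derivative \<phi>' t i) (at t within {0..<T})) \<and>
        continuous_on {0..<T} (\<lambda>t. \<phi>' t i))"

definition hamiltonian ::
    "'u::topological_space set \<Rightarrow> (nat \<Rightarrow> nat \<Rightarrow> 'u measure \<Rightarrow> real) \<Rightarrow>
     (real \<Rightarrow> nat \<Rightarrow> 'u measure \<Rightarrow> real) \<Rightarrow> real \<Rightarrow> nat \<Rightarrow> (nat \<Rightarrow> real) \<Rightarrow> real" where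
  "hamiltonian U q f t i w = (INF \<mu>\<in>prob_measures U. generator q \<mu> w i + f t i \<mu>)"

definition viscosity_supersolution ::
    "real \<Rightarrow> 'u::topological_space set \<Rightarrow> (nat \<Rightarrow> nat \<Rightarrow> 'u measure \<Rightarrow> real) \<Rightarrow>
     (real \<Rightarrow> nat \<Rightarrow> 'u measure \<Rightarrow> real) \<Rightarrow> (nat \<Rightarrow> real) \<Rightarrow> (real \<Rightarrow> nat \<Rightarrow> real) \<Rightarrow> bool" where
  "viscosity_supersolution T U q f g v \<longleftrightarrow>
     continuous_on ({0..T} \<times> states) (\<lambda>(t, i). v t i) \<and>
     (\<forall>i\<in>states. v T i = g i) \<and>
     (\<forall>\<phi> \<phi>'. C1_test_function T \<phi> \<phi>' \<longrightarrow>
        (\<forall>t0\<in>{0..<T}. \<forall>i0\<in>states.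
           (\<forall>t\<in>{0..<T}. \<forall>i\<in>states. v t0 i0 - \<phi> t0 i0 \<le> v t i - \<phi> t i) \<longrightarrow>
           - \<phi>' t0 i0 - hamiltonian U q f t0 i0 (\<phi> t0) \<ge> 0))"

definition viscosity_subsolution ::
    "real \<Rightarrow> 'u::topological_space set \<Rightarrow> (nat \<Rightarrow> nat \<Rightarrow> 'u measure \<Rightarrow> real) \<Rightarrow>
     (real \<Rightarrow> nat \<Rightarrow> 'u measure \<Rightarrow> real) \<Rightarrow> (nat \<Rightarrow> real) \<Rightarrow> (real \<Rightarrow> nat \<Rightarrow> real) \<Rightarrow> bool" where
  "viscosity_subsolution T U q f g v \<longleftrightarrow>
     continuous_on ({0..T} \<times> states) (\<lambda>(t, i). v t i) \<and>
     (\<forall>i\<in>states. v T i = g i) \<and>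
     (\<forall>\<phi> \<phi>'. C1_test_function T \<phi> \<phi>' \<longrightarrow>
        (\<forall>t0\<in>{0..<T}. \<forall>i0\<in>states.
           (\<forall>t\<in>{0..<T}. \<forall>i\<in>states. v t i - \<phi> t i \<le> v t0 i0 - \<phi> t0 i0) \<longrightarrow>
           - \<phi>' t0 i0 - hamiltonian U q f t0 i0 (\<phi> t0) \<le> 0))"

definition viscosity_solution ::
    "real \<Rightarrow> 'u::topological_space set \<Rightarrow> (nat \<Rightarrow> nat \<Rightarrow> 'u measure \<Rightarrow> real) \<Rightarrow>
     (real \<Rightarrow> nat \<Rightarrow> 'u measure \<Rightarrow> real) \<Rightarrow> (nat \<Rightarrow> real) \<Rightarrow> (real \<Rightarrow> nat \<Rightarrow> real) \<Rightarrow> bool" where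
  "viscosity_solution T U q f g v \<longleftrightarrow>
     viscosity_subsolution T U q f g v \<and> viscosity_supersolution T U q f g v"

text \<open>The class of functions in which solutions are compared: \<open>v t i = o(\<Phi> i)\<close> as \<open>i\<close> tends to
  infinity, uniformly in \<open>t\<close>. If \<open>\<Phi>\<close> has finite sublevel sets, it contains all bounded functions.
  Uniqueness fails without a growth restriction: for the pure birth chain of rate one with
  \<open>f = 0\<close> and \<open>g = 0\<close>, take \<open>v 1 t = exp (- 1 / (T - t))\<close> (with the value \<open>0\<close> at \<open>T\<close>) and let
  \<open>v (i + 1) = v i - \<partial>\<^sub>t (v i)\<close>.\<close>

definition dominated_growth :: "real \<Rightarrow> (nat \<Rightarrow> real) \<Rightarrow> (real \<Rightarrow> nat \<Rightarrow> real) \<Rightarrow> bool" where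
  "dominated_growth T \<Phi> v \<longleftrightarrow>
     (\<forall>\<epsilon>>0. \<forall>\<^sub>F i in sequentially. \<forall>t\<in>{0..T}. \<bar>v t i\<bar> \<le> \<epsilon> * \<Phi> i)"

end

theory Submission
  imports Defs
begin

text \<open>Since the rates are bounded and \<open>f\<close> is Lipschitz in time, the HJB equation is an ordinary
  differential equation with a Lipschitz right-hand side on bounded functions of the state, so it
  has a bounded solution \<open>w\<close> that is differentiable in time. Such a \<open>w\<close> is a viscosity solution,
  and \<open>w \<plusminus> \<epsilon> exp (a (T - t)) \<Phi>\<close> is itself a test function, so that every viscosity solution of
  growth \<open>o(\<Phi>)\<close> is compared with \<open>w\<close> directly, without doubling variables.

  For the identity \<open>V = w\<close>, only the one-time marginals of a control matter: the expansion of the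
  transition probabilities gives the right derivative of \<open>t \<mapsto> E w(t, \<Lambda>\<^sub>t)\<close>, which is Lipschitz, so
  Dynkin's formula holds for every control and \<open>w\<close> is a lower bound of the cost. Conversely, a
  Markov feedback that is constant in time on short intervals is almost optimal; it is realised by
  thinning a marked Poisson process, and its transition probabilities have the required
  right-hand expansions at every time because the feedback is right-continuous.\<close>

section \<open>The HJB equation as an ordinary differential equation\<close>

text \<open>A control is tied to the rates only through conditional probabilities given the present
  state and action, so neither a Markov property nor a martingale is at hand; what can be
  differentiated is the expectation of \<open>w t\<close> at the present state. Two obstacles
  follow. The expansions are o(\<delta>) for each target state separately, while an expectation sums
  over infinitely many starts and targets: targets are handled by conservation of mass in the band,
  starts by domination through the uniform O(\<delta>) bound, which carries the probability of the
  start as a factor. And the almost sure identity for the conditional probability has its own null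
  set for each \<delta>, so limits run along sequences.

  In the other direction the kernel of a control is quantified over all states and actions,
  including those that never occur; there it is prescribed as the affine expansion itself. The
  near-optimal feedback reads the present state alone and hence is admissible for every number and
  length of delays.\<close>

lemma continuous_on_Times_discrete:
  fixes v :: "'a::metric_space \<Rightarrow> 'b::{first_countable_topology, t2_space} \<Rightarrow> real"
  assumes open_singleton: "\<And>x :: 'b. open {x}"
  shows "continuous_on (A \<times> B) (\<lambda>(t, i). v t i) \<longleftrightarrow> (\<forall>i\<in>B. continuous_on A (\<lambda>t. v t i))"
proof
  assume L: "continuous_on (A \<times> B) (\<lambda>(t, i). v t i)"
  show "\<forall>i\<in>B. continuous_on A (\<lambda>t. v t i)"
  proof
    fix i assume "i \<in> B"
    have "continuous_on A ((\<lambda>(t, i). v t i) \<circ> (\<lambda>t. (t, i)))"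
      by (rule continuous_on_compose[OF _ continuous_on_subset[OF L]])
        (use \<open>i \<in> B\<close> in \<open>auto intro!: continuous_intros\<close>)
    then show "continuous_on A (\<lambda>t. v t i)" by (simp add: o_def)
  qed
next
  assume R: "\<forall>i\<in>B. continuous_on A (\<lambda>t. v t i)"
  show "continuous_on (A \<times> B) (\<lambda>(t, i). v t i)"
    unfolding continuous_on_sequentially
  proof (intro ballI allI impI, elim conjE)
    fix x and a :: "'a \<times> 'b"
    assume x: "\<forall>n. x n \<in> A \<times> B" and a: "a \<in> A \<times> B" and lim: "x \<longlonglongrightarrow> a"
    obtain t i where ti: "a = (t, i)" by (cases a)
    have 1: "(\<lambda>n. fst (x n)) \<longlonglongrightarrow> t" and 2: "(\<lambda>n. snd (x n)) \<longlonglongrightarrow> i"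
      using tendsto_fst[OF lim] tendsto_snd[OF lim] ti by auto
    have ev: "\<forall>\<^sub>F n in sequentially. snd (x n) = i"
      using topological_tendstoD[OF 2 open_singleton, of i] by simp
    have "continuous_on A (\<lambda>t. v t i)" using R a ti by auto
    then have "(\<lambda>n. v (fst (x n)) i) \<longlonglongrightarrow> v t i"
      unfolding continuous_on_sequentially using 1 x a ti
      by (auto simp: mem_Times_iff o_def)
    then have "(\<lambda>n. v (fst (x n)) (snd (x n))) \<longlonglongrightarrow> v t i"
      by (rule Lim_transform_eventually) (use ev in \<open>auto elim: eventually_mono\<close>)
    then show "((\<lambda>(t, i). v t i) \<circ> x) \<longlonglongrightarrow> (\<lambda>(t, i). v t i) a"
      by (simp add: o_def split_beta ti)
  qed
qed

section \<open>Finite-range generators and the Hamiltonian\<close>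

definition nbrs :: "nat \<Rightarrow> nat \<Rightarrow> nat set" where
  "nbrs K i = {j. 1 \<le> j \<and> j \<le> i + K \<and> i \<le> j + K \<and> j \<noteq> i}"

lemma finite_nbrs [simp]: "finite (nbrs K i)"
  by (rule finite_subset[of _ "{..i + K}"]) (auto simp: nbrs_def)

lemma nbrs_states: "nbrs K i \<subseteq> states - {i}"
  by (auto simp: nbrs_def)

lemma mem_nbrsD: "j \<in> nbrs K i \<Longrightarrow> j \<in> states" "j \<in> nbrs K i \<Longrightarrow> j \<noteq> i"
  by (auto simp: nbrs_def)

text \<open>The Hamiltonian is an infimum that need not be attained, so every estimate on it below
  compares the two sides action by action.\<close>

locale hjb_data =
  fixes U :: "'u::topological_space set"
    and q :: "nat \<Rightarrow> nat \<Rightarrow> 'u measure \<Rightarrow> real"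
    and f :: "real \<Rightarrow> nat \<Rightarrow> 'u measure \<Rightarrow> real"
    and g :: "nat \<Rightarrow> real"
    and T Mq C0 Cf Cg :: real and K :: nat
  assumes T_pos: "0 < T"
    and prob_measures_nonempty: "prob_measures U \<noteq> {}"
    and rates: "conservative_rates U q"
    and banded: "\<And>i j \<mu>. i \<in> states \<Longrightarrow> j \<in> states \<Longrightarrow> \<mu> \<in> prob_measures U \<Longrightarrow>
        \<bar>int j - int i\<bar> > int K \<Longrightarrow> q i j \<mu> = 0"
    and rate_le: "\<And>i \<mu>. i \<in> states \<Longrightarrow> \<mu> \<in> prob_measures U \<Longrightarrow> - q i i \<mu> \<le> Mq"
    and f_le: "\<And>t i \<mu>. t \<in> {0..T} \<Longrightarrow> i \<in> states \<Longrightarrow> \<mu> \<in> prob_measures U \<Longrightarrow> \<bar>f t i \<mu>\<bar> \<le> Cf"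
    and g_le: "\<And>i. i \<in> states \<Longrightarrow> \<bar>g i\<bar> \<le> Cg"
    and f_lip: "\<And>s t i \<mu>. s \<in> {0..T} \<Longrightarrow> t \<in> {0..T} \<Longrightarrow> i \<in> states \<Longrightarrow>
        \<mu> \<in> prob_measures U \<Longrightarrow> \<bar>f t i \<mu> - f s i \<mu>\<bar> \<le> C0 * \<bar>t - s\<bar>"
begin

abbreviation "H \<equiv> hamiltonian U q f"

lemma rate_nonneg:
  "i \<in> states \<Longrightarrow> j \<in> states \<Longrightarrow> j \<noteq> i \<Longrightarrow> \<mu> \<in> prob_measures U \<Longrightarrow> 0 \<le> q i j \<mu>"
  using rates by (auto simp: conservative_rates_def)

lemma rate_outside_nbrs:
  assumes "i \<in> states" "j \<in> states - {i}" "j \<notin> nbrs K i" "\<mu> \<in> prob_measures U"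
  shows "q i j \<mu> = 0"
  using assms by (intro banded) (auto simp: nbrs_def)

text \<open>The band makes the sum finite, so limits, measurability and expectations pass through it
  without summability conditions.\<close>

lemma generator_eq_sum:
  assumes "i \<in> states" "\<mu> \<in> prob_measures U"
  shows "generator q \<mu> w i = (\<Sum>j\<in>nbrs K i. q i j \<mu> * (w j - w i))"
proof -
  have "generator q \<mu> w i = (\<Sum>\<^sub>\<infinity>j\<in>nbrs K i. q i j \<mu> * (w j - w i))"
    unfolding generator_def
    by (rule infsum_cong_neutral)
      (use nbrs_states[of K i] rate_outside_nbrs[OF assms(1) _ _ assms(2)] in auto)
  then show ?thesis by simp
qed

lemma sum_rates:
  assumes "i \<in> states" "\<mu> \<in> prob_measures U"
  shows "(\<Sum>j\<in>nbrs K i. q i j \<mu>) = - q i i \<mu>"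
proof -
  have 1: "((\<lambda>j. q i j \<mu>) has_sum (- q i i \<mu>)) (states - {i})"
    using rates assms by (auto simp: conservative_rates_def)
  have "((\<lambda>j. q i j \<mu>) has_sum (- q i i \<mu>)) (nbrs K i)"
    by (rule has_sum_cong_neutral[THEN iffD1, OF _ _ _ 1])
      (use nbrs_states[of K i] rate_outside_nbrs[OF assms(1) _ _ assms(2)] in auto)
  then show ?thesis by (simp add: has_sum_finite_iff)
qed

lemma rate_le_bound:
  assumes "i \<in> states" "j \<in> nbrs K i" "\<mu> \<in> prob_measures U"
  shows "0 \<le> q i j \<mu>" "q i j \<mu> \<le> Mq"
proof -
  have nn: "\<And>j. j \<in> nbrs K i \<Longrightarrow> 0 \<le> q i j \<mu>"
    using mem_nbrsD assms by (intro rate_nonneg)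
  then show "0 \<le> q i j \<mu>" using assms by auto
  have "q i j \<mu> \<le> (\<Sum>j\<in>nbrs K i. q i j \<mu>)"
    by (rule member_le_sum) (use assms nn in auto)
  also have "\<dots> \<le> Mq" using sum_rates[OF assms(1,3)] rate_le[OF assms(1,3)] by simp
  finally show "q i j \<mu> \<le> Mq" .
qed

lemma diag_rate_nonpos: "i \<in> states \<Longrightarrow> \<mu> \<in> prob_measures U \<Longrightarrow> 0 \<le> - q i i \<mu>"
  using sum_rates[of i \<mu>] rate_le_bound(1)[of i _ \<mu>] by (metis sum_nonneg)

lemma Mq_nonneg: "0 \<le> Mq"
proof -
  obtain \<mu> where "\<mu> \<in> prob_measures U" using prob_measures_nonempty by auto
  then show ?thesis using diag_rate_nonpos[of 1 \<mu>] rate_le[of 1 \<mu>] by simp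
qed

lemma Cf_nonneg: "0 \<le> Cf"
proof -
  obtain \<mu> where "\<mu> \<in> prob_measures U" using prob_measures_nonempty by auto
  then show ?thesis using f_le[of 0 1 \<mu>] T_pos by simp
qed

lemma Cg_nonneg: "0 \<le> Cg"
  using g_le[of 1] by simp

lemma C0_nonneg: "0 \<le> C0"
proof -
  obtain \<mu> where "\<mu> \<in> prob_measures U" using prob_measures_nonempty by auto
  then have "0 \<le> C0 * \<bar>T - 0\<bar>" using f_lip[of 0 T 1 \<mu>] T_pos by simp
  then show ?thesis using T_pos by (simp add: zero_le_mult_iff)
qed

text \<open>Each term sees two values of \<open>w1 - w2\<close>, at \<open>j\<close> and at
  \<open>i\<close>, and the total exit rate is at most \<open>Mq\<close>. The resulting
  \<open>2 * Mq\<close> is the Lipschitz constant that fixes the weight of the Picard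
  operator.\<close>

lemma generator_diff_le:
  assumes i: "i \<in> states" and \<mu>: "\<mu> \<in> prob_measures U"
    and D: "\<And>j. j \<in> insert i (nbrs K i) \<Longrightarrow> \<bar>w1 j - w2 j\<bar> \<le> D"
  shows "\<bar>generator q \<mu> w1 i - generator q \<mu> w2 i\<bar> \<le> 2 * Mq * D"
proof -
  have D0: "0 \<le> D" using D[of i] by auto
  have "\<bar>generator q \<mu> w1 i - generator q \<mu> w2 i\<bar>
      = \<bar>\<Sum>j\<in>nbrs K i. q i j \<mu> * ((w1 j - w2 j) - (w1 i - w2 i))\<bar>"
    by (simp add: generator_eq_sum[OF i \<mu>] flip: sum_subtractf) (simp add: algebra_simps)
  also have "\<dots> \<le> (\<Sum>j\<in>nbrs K i. q i j \<mu> * (2 * D))"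
  proof (rule order_trans[OF sum_abs], rule sum_mono)
    fix j assume j: "j \<in> nbrs K i"
    have "\<bar>(w1 j - w2 j) - (w1 i - w2 i)\<bar> \<le> 2 * D" using D[of j] D[of i] j by auto
    then show "\<bar>q i j \<mu> * ((w1 j - w2 j) - (w1 i - w2 i))\<bar> \<le> q i j \<mu> * (2 * D)"
      using rate_le_bound(1)[OF i j \<mu>] by (simp add: abs_mult mult_left_mono)
  qed
  also have "\<dots> = - q i i \<mu> * (2 * D)"
    using sum_rates[OF i \<mu>] by (simp flip: sum_distrib_right)
  also have "\<dots> \<le> Mq * (2 * D)"
    using rate_le[OF i \<mu>] D0 by (intro mult_right_mono) auto
  finally show ?thesis by simp
qed

lemma generator_abs_le:
  assumes i: "i \<in> states" and \<mu>: "\<mu> \<in> prob_measures U"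
    and D: "\<And>j. j \<in> insert i (nbrs K i) \<Longrightarrow> \<bar>w j\<bar> \<le> D"
  shows "\<bar>generator q \<mu> w i\<bar> \<le> 2 * Mq * D"
  using generator_diff_le[OF i \<mu>, of w "\<lambda>_. 0" D] D generator_eq_sum[OF i \<mu>, of "\<lambda>_. 0"] by simp

text \<open>The hypothesis compares increments from \<open>i\<close> rather than values, which is
  what an extremum of a difference of two functions provides.\<close>

lemma generator_mono:
  assumes i: "i \<in> states" and \<mu>: "\<mu> \<in> prob_measures U"
    and le: "\<And>j. j \<in> states \<Longrightarrow> w1 j - w1 i \<le> w2 j - w2 i"
  shows "generator q \<mu> w1 i \<le> generator q \<mu> w2 i"
  unfolding generator_eq_sum[OF i \<mu>]
  by (rule sum_mono, rule mult_left_mono)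
    (use nbrs_states[of K i] le rate_le_bound(1)[OF i _ \<mu>] in auto)

lemma generator_add:
  assumes i: "i \<in> states" and \<mu>: "\<mu> \<in> prob_measures U"
  shows "generator q \<mu> (\<lambda>j. w1 j + c * w2 j) i = generator q \<mu> w1 i + c * generator q \<mu> w2 i"
  unfolding generator_eq_sum[OF i \<mu>]
  by (simp add: sum.distrib algebra_simps sum_distrib_left sum_subtractf)

text \<open>\<open>INF\<close> on the reals is meaningful only for sets bounded below. Since
  \<open>w\<close> may be an unbounded test function, the bound comes from the finitely many values
  in the band.\<close>

lemma hamiltonian_bdd:
  assumes i: "i \<in> states" and t: "t \<in> {0..T}"
  shows "bdd_below ((\<lambda>\<mu>. generator q \<mu> w i + f t i \<mu>) ` prob_measures U)"
proof -
  define D where "D = (\<Sum>j\<in>insert i (nbrs K i). \<bar>w j\<bar>)"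
  have D: "\<bar>w j\<bar> \<le> D" if "j \<in> insert i (nbrs K i)" for j
    unfolding D_def by (rule member_le_sum) (use that in auto)
  have "- (2 * Mq * D) - Cf \<le> generator q \<mu> w i + f t i \<mu>" if \<mu>: "\<mu> \<in> prob_measures U" for \<mu>
    using generator_abs_le[OF i \<mu>, of w D, OF D] f_le[OF t i \<mu>] by linarith
  then show ?thesis by (rule bdd_belowI2)
qed

lemma hamiltonian_lower:
  assumes "i \<in> states" "t \<in> {0..T}" "\<mu> \<in> prob_measures U"
  shows "H t i w \<le> generator q \<mu> w i + f t i \<mu>"
  unfolding hamiltonian_def by (rule cINF_lower[OF hamiltonian_bdd[OF assms(1,2)] assms(3)])

lemma hamiltonian_greatest:
  assumes "\<And>\<mu>. \<mu> \<in> prob_measures U \<Longrightarrow> c \<le> generator q \<mu> w i + f t i \<mu>"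
  shows "c \<le> H t i w"
  unfolding hamiltonian_def by (rule cINF_greatest[OF prob_measures_nonempty assms])

text \<open>No minimiser is involved: \<open>H t1 i w1 - E\<close> is a lower bound of the second
  family, hence of its infimum.\<close>

lemma hamiltonian_le_add:
  assumes i: "i \<in> states" "t1 \<in> {0..T}"
    and le: "\<And>\<mu>. \<mu> \<in> prob_measures U \<Longrightarrow>
      generator q \<mu> w1 i + f t1 i \<mu> \<le> generator q \<mu> w2 i + f t2 i \<mu> + E"
  shows "H t1 i w1 \<le> H t2 i w2 + E"
proof -
  have "H t1 i w1 - E \<le> H t2 i w2"
  proof (rule hamiltonian_greatest)
    fix \<mu> assume "\<mu> \<in> prob_measures U"
    then show "H t1 i w1 - E \<le> generator q \<mu> w2 i + f t2 i \<mu>"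
      using hamiltonian_lower[OF i, of \<mu> w1] le[of \<mu>] by linarith
  qed
  then show ?thesis by simp
qed

lemma hamiltonian_diff_le:
  assumes i: "i \<in> states" and t: "t1 \<in> {0..T}" "t2 \<in> {0..T}"
    and D: "\<And>j. j \<in> insert i (nbrs K i) \<Longrightarrow> \<bar>w1 j - w2 j\<bar> \<le> D"
  shows "\<bar>H t1 i w1 - H t2 i w2\<bar> \<le> 2 * Mq * D + C0 * \<bar>t1 - t2\<bar>"
proof -
  have b: "\<bar>(generator q \<mu> w1 i + f t1 i \<mu>) - (generator q \<mu> w2 i + f t2 i \<mu>)\<bar>
      \<le> 2 * Mq * D + C0 * \<bar>t1 - t2\<bar>" if \<mu>: "\<mu> \<in> prob_measures U" for \<mu>
    using generator_diff_le[OF i \<mu>, of w1 w2 D, OF D] f_lip[OF t(2,1) i \<mu>] by linarith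
  have "H t1 i w1 \<le> H t2 i w2 + (2 * Mq * D + C0 * \<bar>t1 - t2\<bar>)"
    by (rule hamiltonian_le_add[OF i t(1)], drule b) linarith
  moreover have "H t2 i w2 \<le> H t1 i w1 + (2 * Mq * D + C0 * \<bar>t1 - t2\<bar>)"
    by (rule hamiltonian_le_add[OF i t(2)], drule b) linarith
  ultimately show ?thesis by linarith
qed

lemma hamiltonian_abs_le:
  assumes i: "i \<in> states" and t: "t \<in> {0..T}"
    and D: "\<And>j. j \<in> insert i (nbrs K i) \<Longrightarrow> \<bar>w j\<bar> \<le> D"
  shows "\<bar>H t i w\<bar> \<le> 2 * Mq * D + Cf"
proof -
  have b: "\<bar>generator q \<mu> w i + f t i \<mu>\<bar> \<le> 2 * Mq * D + Cf" if \<mu>: "\<mu> \<in> prob_measures U" for \<mu>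
    using generator_abs_le[OF i \<mu>, of w D, OF D] f_le[OF t i \<mu>] by linarith
  obtain \<mu> where \<mu>: "\<mu> \<in> prob_measures U" using prob_measures_nonempty by auto
  have "- (2 * Mq * D + Cf) \<le> H t i w"
    by (rule hamiltonian_greatest, drule b) linarith
  moreover have "H t i w \<le> 2 * Mq * D + Cf"
    using hamiltonian_lower[OF i t \<mu>, of w] b[OF \<mu>] by linarith
  ultimately show ?thesis by linarith
qed

text \<open>Continuity of \<open>u\<close> in each state separately suffices because
  \<open>H\<close> at \<open>i\<close> sees finitely many states; the estimate is uniform in the
  action, so the infimum inherits it.\<close>

lemma hamiltonian_continuous:
  assumes i: "i \<in> states"
    and u: "\<And>j. j \<in> states \<Longrightarrow> continuous_on {0..T} (\<lambda>r. u r j)"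
  shows "continuous_on {0..T} (\<lambda>r. H r i (u r))"
  unfolding continuous_on_def
proof
  fix x assume x: "x \<in> {0..T}"
  let ?D = "\<lambda>r. \<Sum>j\<in>insert i (nbrs K i). \<bar>u r j - u x j\<bar>"
  have bnd: "\<forall>\<^sub>F r in at x within {0..T}. norm (H r i (u r) - H x i (u x))
      \<le> 2 * Mq * ?D r + C0 * \<bar>r - x\<bar>"
    unfolding eventually_at_filter
  proof (intro always_eventually allI impI)
    fix r assume r: "r \<in> {0..T}"
    have "\<bar>u r j - u x j\<bar> \<le> ?D r" if "j \<in> insert i (nbrs K i)" for j
      by (rule member_le_sum) (use that in auto)
    from hamiltonian_diff_le[OF i r x, of "u r" "u x", OF this]
    show "norm (H r i (u r) - H x i (u x)) \<le> 2 * Mq * ?D r + C0 * \<bar>r - x\<bar>"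
      by simp
  qed
  have "((\<lambda>r. 2 * Mq * ?D r + C0 * \<bar>r - x\<bar>) \<longlongrightarrow> 2 * Mq * ?D x + C0 * \<bar>x - x\<bar>)
      (at x within {0..T})"
  proof (intro tendsto_intros)
    fix j assume "j \<in> insert i (nbrs K i)"
    then have "j \<in> states" using i mem_nbrsD(1) by blast
    then show "((\<lambda>r. u r j) \<longlongrightarrow> u x j) (at x within {0..T})"
      using u x by (auto simp: continuous_on_def)
  qed
  then have lim: "((\<lambda>r. 2 * Mq * ?D r + C0 * \<bar>r - x\<bar>) \<longlongrightarrow> 0) (at x within {0..T})"
    by simp
  have "((\<lambda>r. H r i (u r) - H x i (u x)) \<longlongrightarrow> 0) (at x within {0..T})"
    by (rule Lim_null_comparison[OF bnd lim])
  then show "((\<lambda>r. H r i (u r)) \<longlongrightarrow> H x i (u x)) (at x within {0..T})"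
    by (simp add: LIM_zero_iff)
qed

text \<open>The Picard operator of the backward equation, conjugated with the weight
  \<open>wt\<close>, which makes it a contraction of the bounded continuous functions.\<close>

definition wt :: "real \<Rightarrow> real" where
  "wt t = exp ((2 * Mq + 1) * (T - t))"

text \<open>The fixed point lives in a type of functions on all of the real line, so times outside
  [0, T] are projected onto it.\<close>

definition clamp_time :: "real \<Rightarrow> real" where
  "clamp_time t = max 0 (min T t)"

definition weighted :: "((real \<times> nat discrete) \<Rightarrow>\<^sub>C real) \<Rightarrow> real \<Rightarrow> nat \<Rightarrow> real" where
  "weighted z r j = wt r * apply_bcontfun z (r, discrete j)"

text \<open>At the index 0, which is no state, the data are unconstrained; the value 0 keeps the
  function bounded and continuous there.\<close>

definition picard_fun :: "((real \<times> nat discrete) \<Rightarrow>\<^sub>C real) \<Rightarrow> real \<times> nat discrete \<Rightarrow> real" where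
  "picard_fun z = (\<lambda>(t, j). let i = of_discrete j in if i \<in> states
     then (g i + integral {clamp_time t..T} (\<lambda>r. H r i (weighted z r))) / wt (clamp_time t) else 0)"

lemma clamp_time_mem: "clamp_time t \<in> {0..T}"
  using T_pos by (auto simp: clamp_time_def)

lemma wt_pos: "0 < wt t"
  by (simp add: wt_def)

lemma wt_ge_1: "t \<le> T \<Longrightarrow> 1 \<le> wt t"
  using Mq_nonneg by (simp add: wt_def)

lemma weighted_continuous: "continuous_on A (\<lambda>r. weighted z r j)"
proof -
  have "continuous_on A (\<lambda>r. (r, discrete j))"
    by (intro continuous_intros)
  then have "continuous_on A (\<lambda>r. apply_bcontfun z (r, discrete j))"
    using continuous_on_compose[OF _ continuous_on_apply_bcontfun, of A "\<lambda>r. (r, discrete j)" z]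
    by (simp add: o_def)
  moreover have "continuous_on A wt"
    unfolding wt_def by (intro continuous_intros)
  ultimately show ?thesis
    unfolding weighted_def by (intro continuous_on_mult)
qed

lemma H_weighted_continuous: "i \<in> states \<Longrightarrow> continuous_on {0..T} (\<lambda>r. H r i (weighted z r))"
  by (rule hamiltonian_continuous) (auto intro: weighted_continuous)

lemma H_weighted_integrable:
  assumes "i \<in> states" "t \<in> {0..T}"
  shows "(\<lambda>r. H r i (weighted z r)) integrable_on {t..T}"
  by (rule integrable_continuous_interval, rule continuous_on_subset[OF H_weighted_continuous])
    (use assms in auto)

lemma wt_integral:
  assumes "t \<le> T"
  shows "(wt has_integral (wt t - 1) / (2 * Mq + 1)) {t..T}"
proof -
  have L: "2 * Mq + 1 > 0" using Mq_nonneg by simp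
  have "(wt has_integral (- wt T / (2 * Mq + 1) - - wt t / (2 * Mq + 1))) {t..T}"
  proof (rule fundamental_theorem_of_calculus[OF assms])
    fix x
    have "(wt has_real_derivative wt x * - (2 * Mq + 1)) (at x within {t..T})"
      unfolding wt_def by (auto intro!: derivative_eq_intros)
    then have "((\<lambda>x. - wt x / (2 * Mq + 1)) has_real_derivative - (wt x * - (2 * Mq + 1)) / (2 * Mq + 1))
        (at x within {t..T})"
      by (intro DERIV_cdivide DERIV_minus)
    moreover have "- (wt x * - (2 * Mq + 1)) / (2 * Mq + 1) = wt x"
      using L by (simp add: field_simps)
    ultimately show "((\<lambda>x. - wt x / (2 * Mq + 1)) has_vector_derivative wt x) (at x within {t..T})"
      unfolding has_real_derivative_iff_has_vector_derivative[symmetric] by metis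
  qed
  moreover have "- wt T / (2 * Mq + 1) - - wt t / (2 * Mq + 1) = (wt t - 1) / (2 * Mq + 1)"
    by (simp add: wt_def diff_divide_distrib)
  ultimately show ?thesis by metis
qed

lemma picard_fun_bcontfun: "picard_fun z \<in> bcontfun"
proof -
  define D where "D = wt 0 * dist z 0"
  have z: "\<bar>apply_bcontfun z p\<bar> \<le> dist z 0" for p
    using dist_bounded[of z p 0] by (simp add: dist_norm)
  have wt_le: "wt r \<le> wt 0" if "r \<in> {0..T}" for r
    unfolding wt_def using that Mq_nonneg by (simp add: mult_left_mono)
  have D: "\<bar>weighted z r j\<bar> \<le> D" if "r \<in> {0..T}" for r j
    unfolding weighted_def D_def abs_mult
    using wt_pos[of r] wt_le[OF that] z by (intro mult_mono) auto
  have 1: "\<bar>picard_fun z (t, discrete i)\<bar> \<le> Cg + T * (2 * Mq * D + Cf)" for t i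
  proof (cases "i \<in> states")
    case i: True
    define c where "c = clamp_time t"
    have c: "c \<in> {0..T}" unfolding c_def by (rule clamp_time_mem)
    have D0: "0 \<le> D" using D[of 0 1] T_pos by auto
    have "norm (integral {c..T} (\<lambda>r. H r i (weighted z r))) \<le> (2 * Mq * D + Cf) * (T - c)"
      by (rule integral_bound)
        (use c i hamiltonian_abs_le[OF i _ D] in
          \<open>auto intro!: continuous_on_subset[OF H_weighted_continuous[OF i]]\<close>)
    also have "\<dots> \<le> (2 * Mq * D + Cf) * T"
      using c Mq_nonneg Cf_nonneg D0 by (intro mult_left_mono) auto
    finally have A: "\<bar>g i + integral {c..T} (\<lambda>r. H r i (weighted z r))\<bar> \<le> Cg + T * (2 * Mq * D + Cf)"
      using g_le[OF i] by (simp add: mult.commute)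
    have "\<bar>picard_fun z (t, discrete i)\<bar> = \<bar>g i + integral {c..T} (\<lambda>r. H r i (weighted z r))\<bar> / wt c"
      using i wt_pos[of c] by (simp add: picard_fun_def discrete_inverse c_def)
    also have "\<dots> \<le> \<bar>g i + integral {c..T} (\<lambda>r. H r i (weighted z r))\<bar> / 1"
      by (rule divide_left_mono) (use wt_ge_1[of c] c wt_pos[of c] in auto)
    finally show ?thesis using A by simp
  next
    case False
    then show ?thesis
      using Mq_nonneg Cf_nonneg Cg_nonneg T_pos D[of 0 1] by (simp add: picard_fun_def discrete_inverse)
  qed
  have 2: "continuous_on UNIV (\<lambda>t. picard_fun z (t, discrete i))" for i
  proof (cases "i \<in> states")
    case i: True
    have cl: "continuous_on UNIV clamp_time"
      unfolding clamp_time_def by (intro continuous_intros)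
    have "continuous_on {0..T} (\<lambda>t. integral {t..T} (\<lambda>r. H r i (weighted z r)))"
      by (rule indefinite_integral_continuous_1') (rule H_weighted_integrable[OF i], use T_pos in auto)
    then have ic: "continuous_on UNIV (\<lambda>t. integral {clamp_time t..T} (\<lambda>r. H r i (weighted z r)))"
      by (rule continuous_on_compose2[OF _ cl]) (use clamp_time_mem in blast)
    have wc: "continuous_on UNIV (\<lambda>t. wt (clamp_time t))"
      unfolding wt_def by (intro continuous_intros cl)
    have wnz: "\<forall>t\<in>UNIV. wt (clamp_time t) \<noteq> 0"
      by (simp add: wt_def)
    have "(\<lambda>t. picard_fun z (t, discrete i)) = (\<lambda>t. (g i +
        integral {clamp_time t..T} (\<lambda>r. H r i (weighted z r))) / wt (clamp_time t))"
      using i by (simp add: picard_fun_def discrete_inverse)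
    then show ?thesis
      using continuous_on_divide[OF continuous_on_add[OF continuous_on_const[of UNIV "g i"] ic] wc wnz]
      by metis
  qed (simp add: picard_fun_def discrete_inverse)
  have "continuous_on (UNIV \<times> UNIV) (\<lambda>(t, i). picard_fun z (t, i))"
    using 2[of "of_discrete _"]
    by (subst continuous_on_Times_discrete[OF open_discrete]) (simp add: of_discrete_inverse)
  then have "continuous_on UNIV (picard_fun z)" by simp
  moreover have "bounded (range (picard_fun z))"
    unfolding bounded_iff using 1[of _ "of_discrete _"]
    by (intro exI[of _ "Cg + T * (2 * Mq * D + Cf)"]) (auto simp: of_discrete_inverse)
  ultimately show ?thesis by (simp add: bcontfun_def)
qed

text \<open>\<open>H\<close> is \<open>2 * Mq\<close>-Lipschitz, and integrating the weight with
  exponent \<open>2 * Mq + 1\<close> over [c, T] costs at most \<open>wt c / (2 * Mq + 1)\<close>.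
  The \<open>+ 1\<close> leaves a factor below 1 and a positive denominator even when
  \<open>Mq = 0\<close>.\<close>

lemma picard_fun_contraction:
  "\<bar>picard_fun z1 p - picard_fun z2 p\<bar> \<le> 2 * Mq / (2 * Mq + 1) * dist z1 z2"
proof -
  obtain t i where p: "p = (t, discrete i)" by (metis of_discrete_inverse surj_pair)
  show ?thesis
  proof (cases "i \<in> states")
    case i: True
    define c where "c = clamp_time t"
    define d where "d = dist z1 z2"
    have c: "c \<in> {0..T}" unfolding c_def by (rule clamp_time_mem)
    let ?I = "\<lambda>z. integral {c..T} (\<lambda>r. H r i (weighted z r))"
    have d: "\<bar>apply_bcontfun z1 p - apply_bcontfun z2 p\<bar> \<le> d" for p
      using dist_bounded[of z1 p z2] by (simp add: dist_real_def d_def)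
    have w: "\<bar>weighted z1 r j - weighted z2 r j\<bar> \<le> wt r * d" for r j
      using d[of "(r, discrete j)"] wt_pos[of r]
      by (simp add: weighted_def abs_mult mult_left_mono flip: right_diff_distrib)
    have "\<bar>?I z1 - ?I z2\<bar> = norm (integral {c..T} (\<lambda>r. H r i (weighted z1 r) - H r i (weighted z2 r)))"
      using H_weighted_integrable[OF i c] by (simp add: Henstock_Kurzweil_Integration.integral_diff)
    also have "\<dots> \<le> integral {c..T} (\<lambda>r. 2 * Mq * d * wt r)"
    proof (rule integral_norm_bound_integral)
      show "(\<lambda>r. H r i (weighted z1 r) - H r i (weighted z2 r)) integrable_on {c..T}"
        using H_weighted_integrable[OF i c] by (rule integrable_diff) (rule H_weighted_integrable[OF i c])
      show "(\<lambda>r. 2 * Mq * d * wt r) integrable_on {c..T}"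
        using wt_integral[of c] c by (intro integrable_on_mult_right) (auto simp: integrable_on_def)
      fix r assume "r \<in> {c..T}"
      then have r: "r \<in> {0..T}" using c by auto
      from hamiltonian_diff_le[OF i r r, of "weighted z1 r" "weighted z2 r", OF w]
      show "norm (H r i (weighted z1 r) - H r i (weighted z2 r)) \<le> 2 * Mq * d * wt r"
        by (simp add: algebra_simps)
    qed
    also have "\<dots> = 2 * Mq * d * ((wt c - 1) / (2 * Mq + 1))"
      using has_integral_mult_right[OF wt_integral[of c], of "2 * Mq * d"] c
      by (intro integral_unique) auto
    also have "\<dots> \<le> 2 * Mq * d * (wt c / (2 * Mq + 1))"
      using Mq_nonneg by (intro mult_left_mono divide_right_mono) (auto simp: d_def)
    finally have B: "\<bar>?I z1 - ?I z2\<bar> \<le> 2 * Mq / (2 * Mq + 1) * d * wt c"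
      by (simp add: field_simps)
    have "\<bar>picard_fun z1 p - picard_fun z2 p\<bar> = \<bar>?I z1 - ?I z2\<bar> / wt c"
      using i wt_pos[of c] by (simp add: p picard_fun_def discrete_inverse c_def flip: diff_divide_distrib)
    also have "\<dots> \<le> 2 * Mq / (2 * Mq + 1) * d"
      using B wt_pos[of c] by (simp add: pos_divide_le_eq)
    finally show ?thesis by (simp add: d_def)
  next
    case False
    then show ?thesis using Mq_nonneg by (simp add: p picard_fun_def discrete_inverse)
  qed
qed

text \<open>The weight makes Banach's theorem apply on the whole horizon at once, in place of a
  splitting into short intervals. The fixed point is the weighted unknown; multiplying it back by
  \<open>wt\<close> gives the solution.\<close>

lemma integral_equation_solution:
  obtains w B where
    "\<And>t i. t \<in> {0..T} \<Longrightarrow> i \<in> states \<Longrightarrow> \<bar>w t i\<bar> \<le> B"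
    "\<And>i. i \<in> states \<Longrightarrow> continuous_on {0..T} (\<lambda>t. w t i)"
    "\<And>t i. t \<in> {0..T} \<Longrightarrow> i \<in> states \<Longrightarrow> w t i = g i + integral {t..T} (\<lambda>r. H r i (w r))"
proof -
  define P where "P z = Bcontfun (picard_fun z)" for z
  have P: "apply_bcontfun (P z) = picard_fun z" for z
    unfolding P_def by (rule Bcontfun_inverse[OF picard_fun_bcontfun])
  have "\<exists>!z. P z = z"
  proof (rule banach_fix_type[where f = P])
    show "0 \<le> 2 * Mq / (2 * Mq + 1)" "2 * Mq / (2 * Mq + 1) < 1"
      using Mq_nonneg by (auto simp: field_simps)
    show "\<forall>x y. dist (P x) (P y) \<le> 2 * Mq / (2 * Mq + 1) * dist x y"
      by (intro allI dist_bound) (use picard_fun_contraction in \<open>simp add: P dist_real_def\<close>)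
  qed
  then obtain z where "P z = z" by auto
  then have z: "picard_fun z = apply_bcontfun z" using P by metis
  show ?thesis
  proof (rule that[of "weighted z" "wt 0 * dist z 0"])
    fix t i assume t: "t \<in> {0..T}" and i: "i \<in> states"
    have "\<bar>apply_bcontfun z p\<bar> \<le> dist z 0" for p
      using dist_bounded[of z p 0] by (simp add: dist_norm)
    moreover have "wt t \<le> wt 0" unfolding wt_def using t Mq_nonneg by (simp add: mult_left_mono)
    ultimately show "\<bar>weighted z t i\<bar> \<le> wt 0 * dist z 0"
      unfolding weighted_def abs_mult using wt_pos[of t] by (intro mult_mono) auto
    have "clamp_time t = t" using t by (auto simp: clamp_time_def)
    then have "weighted z t i = wt t * picard_fun z (t, discrete i)" by (simp add: weighted_def z)
    also have "\<dots> = g i + integral {t..T} (\<lambda>r. H r i (weighted z r))"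
      using i wt_pos[of t] \<open>clamp_time t = t\<close> by (simp add: picard_fun_def discrete_inverse)
    finally show "weighted z t i = g i + integral {t..T} (\<lambda>r. H r i (weighted z r))" .
  qed (rule weighted_continuous)
qed

end

text \<open>All later arguments access \<open>w\<close> through these three properties and not
  through its construction. The derivative is taken within [0, T], so it is one-sided at both
  ends.\<close>

locale classical_solution = hjb_data +
  fixes w :: "real \<Rightarrow> nat \<Rightarrow> real" and B :: real
  assumes w_bound: "\<And>t i. t \<in> {0..T} \<Longrightarrow> i \<in> states \<Longrightarrow> \<bar>w t i\<bar> \<le> B"
    and w_deriv: "\<And>t i. t \<in> {0..T} \<Longrightarrow> i \<in> states \<Longrightarrow>
      ((\<lambda>t. w t i) has_real_derivative - H t i (w t)) (at t within {0..T})"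
    and w_T: "\<And>i. i \<in> states \<Longrightarrow> w T i = g i"

context hjb_data
begin

lemma classical_solution_exists:
  obtains w B where "classical_solution U q f g T Mq C0 Cf Cg K w B"
proof -
  obtain w B where b: "\<And>t i. t \<in> {0..T} \<Longrightarrow> i \<in> states \<Longrightarrow> \<bar>w t i\<bar> \<le> B"
    and c: "\<And>i. i \<in> states \<Longrightarrow> continuous_on {0..T} (\<lambda>t. w t i)"
    and e: "\<And>t i. t \<in> {0..T} \<Longrightarrow> i \<in> states \<Longrightarrow> w t i = g i + integral {t..T} (\<lambda>r. H r i (w r))"
    by (rule integral_equation_solution) blast
  have "classical_solution U q f g T Mq C0 Cf Cg K w B"
  proof unfold_locales
    fix t i assume t: "t \<in> {0..T}" and i: "i \<in> states"
    show "\<bar>w t i\<bar> \<le> B" using b[OF t i] .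
    let ?h = "\<lambda>r. H r i (w r)"
    have ch: "continuous_on {0..T} ?h" by (rule hamiltonian_continuous[OF i c])
    have "((\<lambda>u. integral {0..u} ?h) has_real_derivative ?h t) (at t within {0..T})"
      by (rule integral_has_real_derivative[OF ch t])
    \<comment> \<open>The integral from \<open>u\<close> to \<open>T\<close> is rewritten with
      variable upper limit, the form in which the fundamental theorem applies.\<close>
    then have 1: "((\<lambda>u. g i + integral {0..T} ?h - integral {0..u} ?h) has_real_derivative - ?h t)
        (at t within {0..T})"
      by (auto intro!: derivative_eq_intros)
    show "((\<lambda>t. w t i) has_real_derivative - ?h t) (at t within {0..T})"
    proof (rule has_field_derivative_transform_within[OF 1, of 1])
      fix u assume u: "u \<in> {0..T}"
      have "integral {0..u} ?h + integral {u..T} ?h = integral {0..T} ?h"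
        by (rule Henstock_Kurzweil_Integration.integral_combine)
          (use u in \<open>auto intro: integrable_continuous_interval ch\<close>)
      then show "g i + integral {0..T} ?h - integral {0..u} ?h = w u i"
        using e[OF u i] by simp
    qed (use t in auto)
  next
    fix i assume i: "i \<in> states"
    show "w T i = g i" using e[OF _ i, of T] T_pos by simp
  qed
  then show ?thesis by (rule that)
qed

end

section \<open>Viscosity solutions\<close>

lemma continuous_on_Times_nat:
  fixes v :: "real \<Rightarrow> nat \<Rightarrow> real"
  shows "continuous_on (A \<times> N) (\<lambda>(t, i). v t i) \<longleftrightarrow> (\<forall>i\<in>N. continuous_on A (\<lambda>t. v t i))"
  by (rule continuous_on_Times_discrete) (rule discrete_topology_class.open_discrete)

text \<open>A nonnegative value somewhere forces the supremum into the finite set \<open>N\<close>,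
  where compactness gives a maximiser, and away from time \<open>T\<close>, where \<open>D\<close>
  is negative.\<close>

lemma attains_max_before_horizon:
  fixes D :: "real \<Rightarrow> nat \<Rightarrow> real"
  assumes T: "0 \<le> T" and cont: "\<And>i. i \<in> states \<Longrightarrow> continuous_on {0..T} (\<lambda>t. D t i)"
    and N: "finite N" "\<And>t i. t \<in> {0..T} \<Longrightarrow> i \<in> states - N \<Longrightarrow> D t i < 0"
    and D_T: "\<And>i. i \<in> states \<Longrightarrow> D T i < 0"
    and nonneg: "t \<in> {0..T}" "i \<in> states" "0 \<le> D t i"
  obtains t0 i0 where "t0 \<in> {0..<T}" "i0 \<in> states"
    "\<And>t i. t \<in> {0..T} \<Longrightarrow> i \<in> states \<Longrightarrow> D t i \<le> D t0 i0"
proof -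
  let ?A = "{0..T} \<times> (N \<inter> states)"
  have iN: "i \<in> N" using N(2)[OF nonneg(1), of i] nonneg by auto
  have "continuous_on ?A (\<lambda>(t, i). D t i)"
    using cont by (simp add: continuous_on_Times_nat)
  moreover have "compact ?A" using N(1) by (intro compact_Times compact_Icc finite_imp_compact) simp
  moreover have "(t, i) \<in> ?A" using nonneg iN by auto
  ultimately obtain p where p: "p \<in> ?A" "\<forall>x\<in>?A. (\<lambda>(t, i). D t i) x \<le> (\<lambda>(t, i). D t i) p"
    using continuous_attains_sup[of ?A "\<lambda>(t, i). D t i"] by blast
  obtain t0 i0 where ti: "p = (t0, i0)" by (cases p)
  have t0: "t0 \<in> {0..T}" "i0 \<in> states" using p ti by auto
  have le: "D t' i' \<le> D t0 i0" if "t' \<in> {0..T}" "i' \<in> states" "i' \<in> N" for t' i'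
    using p(2)[rule_format, of "(t', i')"] that ti by auto
  have nn: "0 \<le> D t0 i0" using le[OF nonneg(1,2) iN] nonneg(3) by simp
  show ?thesis
  proof (rule that)
    have "t0 \<noteq> T" using nn D_T[OF t0(2)] by auto
    then show "t0 \<in> {0..<T}" using t0 by auto
    fix t' i' assume "t' \<in> {0..T}" "i' \<in> states"
    then show "D t' i' \<le> D t0 i0"
      using le[of t' i'] N(2)[of t' i'] nn by (cases "i' \<in> N") auto
  qed (rule t0)
qed

context hjb_data
begin

lemma hamiltonian_mono:
  assumes "i \<in> states" "t \<in> {0..T}" "\<And>j. j \<in> states \<Longrightarrow> w1 j - w1 i \<le> w2 j - w2 i"
  shows "H t i w1 \<le> H t i w2"
proof -
  have "H t i w1 \<le> H t i w2 + 0"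
    using generator_mono[OF assms(1), of _ w1 w2] assms(3)
    by (intro hamiltonian_le_add[OF assms(1,2)]) simp
  then show ?thesis by simp
qed

end

context classical_solution
begin

lemma w_continuous: "i \<in> states \<Longrightarrow> continuous_on {0..T} (\<lambda>t. w t i)"
  by (rule DERIV_continuous_on) (rule w_deriv)

lemma H_w_continuous: "i \<in> states \<Longrightarrow> continuous_on {0..T} (\<lambda>t. H t i (w t))"
  by (rule hamiltonian_continuous[OF _ w_continuous])

lemma w_deriv_right_open:
  "t \<in> {0..<T} \<Longrightarrow> i \<in> states \<Longrightarrow>
    ((\<lambda>t. w t i) has_real_derivative - H t i (w t)) (at t within {0..<T})"
  by (rule DERIV_subset[OF w_deriv]) auto

text \<open>At a maximum point at time \<open>0\<close> only the derivative to the right is controlled; this is the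
  inequality that is needed, so the boundary time is not special.\<close>

lemma viscosity_subsolution_w: "viscosity_subsolution T U q f g w"
  unfolding viscosity_subsolution_def
proof (intro conjI allI impI ballI)
  show "continuous_on ({0..T} \<times> states) (\<lambda>(t, i). w t i)"
    using w_continuous by (simp add: continuous_on_Times_nat)
  show "w T i = g i" if "i \<in> states" for i using w_T[OF that] .
  fix \<phi> \<phi>' t0 i0
  assume C1: "C1_test_function T \<phi> \<phi>'" and t0: "t0 \<in> {0..<T}" and i0: "i0 \<in> states"
    and max: "\<forall>t\<in>{0..<T}. \<forall>i\<in>states. w t i - \<phi> t i \<le> w t0 i0 - \<phi> t0 i0"
  have t0': "t0 \<in> {0..T}" using t0 by auto
  have d: "((\<lambda>t. w t i0 - \<phi> t i0) has_real_derivative - H t0 i0 (w t0) - \<phi>' t0 i0) (at t0 within {0..<T})"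
    using C1 t0 i0 by (intro DERIV_diff w_deriv_right_open) (auto simp: C1_test_function_def)
  have "- H t0 i0 (w t0) - \<phi>' t0 i0 \<le> 0"
  proof (rule ccontr)
    assume "\<not> ?thesis"
    then obtain e where e: "e > 0"
      "\<And>h. h > 0 \<Longrightarrow> t0 + h \<in> {0..<T} \<Longrightarrow> h < e \<Longrightarrow> w t0 i0 - \<phi> t0 i0 < w (t0 + h) i0 - \<phi> (t0 + h) i0"
      using has_real_derivative_pos_inc_right[OF d] by auto
    define h where "h = min e (T - t0) / 2"
    have "h > 0" "t0 + h \<in> {0..<T}" "h < e" using e(1) t0 by (auto simp: h_def min_def field_simps)
    then show False using e(2)[of h] max[rule_format, of "t0 + h" i0] i0 by linarith
  qed
  moreover have "H t0 i0 (w t0) \<le> H t0 i0 (\<phi> t0)"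
    proof (rule hamiltonian_mono[OF i0 t0'])
    fix j assume "j \<in> states"
    then show "w t0 j - w t0 i0 \<le> \<phi> t0 j - \<phi> t0 i0"
      using max[rule_format, OF t0, of j] by linarith
  qed
  ultimately show "- \<phi>' t0 i0 - H t0 i0 (\<phi> t0) \<le> 0" by linarith
qed

lemma viscosity_supersolution_w: "viscosity_supersolution T U q f g w"
  unfolding viscosity_supersolution_def
proof (intro conjI allI impI ballI)
  show "continuous_on ({0..T} \<times> states) (\<lambda>(t, i). w t i)"
    using w_continuous by (simp add: continuous_on_Times_nat)
  show "w T i = g i" if "i \<in> states" for i using w_T[OF that] .
  fix \<phi> \<phi>' t0 i0
  assume C1: "C1_test_function T \<phi> \<phi>'" and t0: "t0 \<in> {0..<T}" and i0: "i0 \<in> states"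
    and min: "\<forall>t\<in>{0..<T}. \<forall>i\<in>states. w t0 i0 - \<phi> t0 i0 \<le> w t i - \<phi> t i"
  have t0': "t0 \<in> {0..T}" using t0 by auto
  have d: "((\<lambda>t. w t i0 - \<phi> t i0) has_real_derivative - H t0 i0 (w t0) - \<phi>' t0 i0) (at t0 within {0..<T})"
    using C1 t0 i0 by (intro DERIV_diff w_deriv_right_open) (auto simp: C1_test_function_def)
  have "- H t0 i0 (w t0) - \<phi>' t0 i0 \<ge> 0"
  proof (rule ccontr)
    assume "\<not> ?thesis"
    then obtain e where e: "e > 0"
      "\<And>h. h > 0 \<Longrightarrow> t0 + h \<in> {0..<T} \<Longrightarrow> h < e \<Longrightarrow> w t0 i0 - \<phi> t0 i0 > w (t0 + h) i0 - \<phi> (t0 + h) i0"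
      using has_real_derivative_neg_dec_right[OF d] by auto
    define h where "h = Orderings.min e (T - t0) / 2"
    have "h > 0" "t0 + h \<in> {0..<T}" "h < e" using e(1) t0 by (auto simp: h_def min_def field_simps)
    then show False using e(2)[of h] min[rule_format, of "t0 + h" i0] i0 by linarith
  qed
  moreover have "H t0 i0 (\<phi> t0) \<le> H t0 i0 (w t0)"
    proof (rule hamiltonian_mono[OF i0 t0'])
    fix j assume "j \<in> states"
    then show "\<phi> t0 j - \<phi> t0 i0 \<le> w t0 j - w t0 i0"
      using min[rule_format, OF t0, of j] by linarith
  qed
  ultimately show "0 \<le> - \<phi>' t0 i0 - H t0 i0 (\<phi> t0)" by linarith
qed

lemma viscosity_solution_w: "viscosity_solution T U q f g w"
  unfolding viscosity_solution_def using viscosity_subsolution_w viscosity_supersolution_w by blast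

text \<open>The constant \<open>c\<close> takes both signs, one for each direction of the
  comparison. Differentiating the exponential supplies the term with factor \<open>a\<close> that
  has to beat the Lyapunov rate.\<close>

lemma C1_perturbed:
  "C1_test_function T (\<lambda>t i. w t i + c * exp (a * (T - t)) * \<Phi> i)
     (\<lambda>t i. - H t i (w t) - a * (c * exp (a * (T - t)) * \<Phi> i))"
  unfolding C1_test_function_def
proof (intro ballI conjI)
  fix i t assume i: "i \<in> states" and t: "t \<in> {0..<T}"
  have "((\<lambda>t. c * exp (a * (T - t)) * \<Phi> i) has_real_derivative - (a * (c * exp (a * (T - t)) * \<Phi> i)))
      (at t within {0..<T})"
    by (auto intro!: derivative_eq_intros)
  from DERIV_add[OF w_deriv_right_open[OF t i] this]
  show "((\<lambda>t. w t i + c * exp (a * (T - t)) * \<Phi> i) has_real_derivative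
      - H t i (w t) - a * (c * exp (a * (T - t)) * \<Phi> i)) (at t within {0..<T})"
    by simp
next
  fix i assume i: "i \<in> states"
  have "continuous_on {0..<T} (\<lambda>t. H t i (w t))"
    by (rule continuous_on_subset[OF H_w_continuous[OF i]]) auto
  then show "continuous_on {0..<T} (\<lambda>t. - H t i (w t) - a * (c * exp (a * (T - t)) * \<Phi> i))"
    by (intro continuous_intros)
qed

text \<open>If \<open>v - w\<close> reached the positive function \<open>?\<psi>\<close>, then
  \<open>w + ?\<psi>\<close> would touch \<open>v\<close> at a maximum of the difference. The
  equation for \<open>w\<close> cancels and leaves
  \<open>(lam + 1) * ?\<psi> \<le> lam * ?\<psi>\<close>, which is absurd. The growth condition
  makes the maximum attained.\<close>

lemma viscosity_solution_unique:
  assumes v: "viscosity_solution T U q f g v" and growth: "dominated_growth T \<Phi> v"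
    and \<Phi>: "\<And>i. i \<in> states \<Longrightarrow> 1 \<le> \<Phi> i" "\<And>c. finite {i \<in> states. \<Phi> i \<le> c}"
    and lyap: "\<And>i \<mu>. i \<in> states \<Longrightarrow> \<mu> \<in> prob_measures U \<Longrightarrow> generator q \<mu> \<Phi> i \<le> lam * \<Phi> i"
    and lam: "0 \<le> lam" and t: "t \<in> {0..T}" and i: "i \<in> states"
  shows "v t i = w t i"
proof -
  \<comment> \<open>Any exponent larger than \<open>lam\<close> gives the strict inequality.\<close>
  let ?a = "lam + 1"
  let ?\<psi> = "\<lambda>\<epsilon> t i. \<epsilon> * exp (?a * (T - t)) * \<Phi> i"
  have v_cont: "continuous_on {0..T} (\<lambda>t. v t i)" if "i \<in> states" for i
    using v that unfolding viscosity_solution_def viscosity_subsolution_def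
    by (simp add: continuous_on_Times_nat)
  have v_T: "v T i = w T i" if "i \<in> states" for i
    using v that w_T unfolding viscosity_solution_def viscosity_subsolution_def by auto
  have \<psi>_pos: "0 < ?\<psi> \<epsilon> t i" if "\<epsilon> > 0" "i \<in> states" for \<epsilon> t i
    using \<Phi>(1)[OF that(2)] that by simp
  have generator_\<psi>: "\<epsilon> * exp (?a * (T - t)) * generator q \<mu> \<Phi> i \<le> lam * ?\<psi> \<epsilon> t i"
    if "\<epsilon> > 0" "i \<in> states" "\<mu> \<in> prob_measures U" for \<epsilon> t i \<mu>
    using mult_left_mono[OF lyap[OF that(2,3)], of "\<epsilon> * exp (?a * (T - t))"] that
    by (simp add: algebra_simps)
  have far: "\<exists>N. finite N \<and> (\<forall>t\<in>{0..T}. \<forall>i\<in>states - N. \<bar>v t i - w t i\<bar> < ?\<psi> \<epsilon> t i)"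
    if \<epsilon>: "\<epsilon> > 0" for \<epsilon>
  proof -
    have "\<forall>\<^sub>F i in sequentially. \<forall>t\<in>{0..T}. \<bar>v t i\<bar> \<le> \<epsilon> / 2 * \<Phi> i"
      using growth \<epsilon> half_gt_zero unfolding dominated_growth_def by blast
    then obtain n where n: "\<And>i t. i \<ge> n \<Longrightarrow> t \<in> {0..T} \<Longrightarrow> \<bar>v t i\<bar> \<le> \<epsilon> / 2 * \<Phi> i"
      unfolding eventually_sequentially by blast
    \<comment> \<open>Half of \<epsilon> is spent on \<open>v\<close>, by its growth beyond
      \<open>n\<close>, and half on \<open>w\<close>, by its bound \<open>B\<close> outside the
      sublevel set.\<close>
    let ?N = "{..<n} \<union> {i \<in> states. \<Phi> i \<le> 2 * B / \<epsilon>}"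
    have "\<bar>v t i - w t i\<bar> < ?\<psi> \<epsilon> t i" if t: "t \<in> {0..T}" and i: "i \<in> states - ?N" for t i
    proof -
      have "B < \<epsilon> / 2 * \<Phi> i" using i \<epsilon> by (auto simp: field_simps)
      then have "\<bar>v t i - w t i\<bar> < \<epsilon> / 2 * \<Phi> i + \<epsilon> / 2 * \<Phi> i"
        using w_bound[OF t, of i] n[of i t] i t by auto
      also have "\<dots> = \<epsilon> * 1 * \<Phi> i" by simp
      also have "\<dots> \<le> ?\<psi> \<epsilon> t i"
        using \<Phi>(1)[of i] i \<epsilon> t lam by (intro mult_right_mono mult_left_mono) auto
      finally show ?thesis .
    qed
    then show ?thesis using \<Phi>(2) by (intro exI[of _ ?N]) auto
  qed
  have upper: "v t i - w t i < ?\<psi> \<epsilon> t i" if \<epsilon>: "\<epsilon> > 0" for \<epsilon>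
  proof (rule ccontr)
    assume neg: "\<not> ?thesis"
    let ?D = "\<lambda>t i. v t i - (w t i + ?\<psi> \<epsilon> t i)"
    obtain N where N: "finite N" "\<And>t i. t \<in> {0..T} \<Longrightarrow> i \<in> states - N \<Longrightarrow> \<bar>v t i - w t i\<bar> < ?\<psi> \<epsilon> t i"
      using far[OF \<epsilon>] by blast
    have Dneg: "?D t i < 0" if "t \<in> {0..T}" "i \<in> states - N" for t i using N(2)[OF that] by auto
    have Dcont: "continuous_on {0..T} (\<lambda>t. ?D t i)" if "i \<in> states" for i
      by (intro continuous_intros v_cont w_continuous that)
    have DT: "?D T i < 0" if "i \<in> states" for i using v_T[OF that] \<psi>_pos[OF \<epsilon> that, of T] by simp
    have D0: "0 \<le> ?D t i" using neg by simp
    obtain t0 i0 where t0: "t0 \<in> {0..<T}" and i0: "i0 \<in> states"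
      and max: "\<And>t i. t \<in> {0..T} \<Longrightarrow> i \<in> states \<Longrightarrow> ?D t i \<le> ?D t0 i0"
      using attains_max_before_horizon[of T ?D N t i, OF _ Dcont N(1) Dneg DT t i D0] T_pos by auto
    have t0': "t0 \<in> {0..T}" using t0 by auto
    have max': "\<forall>t\<in>{0..<T}. \<forall>i\<in>states. ?D t i \<le> ?D t0 i0"
      using max by simp
    have "viscosity_subsolution T U q f g v" using v by (simp add: viscosity_solution_def)
    then have "- (- H t0 i0 (w t0) - ?a * ?\<psi> \<epsilon> t0 i0) - H t0 i0 (\<lambda>i. w t0 i + ?\<psi> \<epsilon> t0 i) \<le> 0"
      unfolding viscosity_subsolution_def
      using C1_perturbed[of \<epsilon> ?a \<Phi>] t0 i0 max' by blast
    moreover have "H t0 i0 (\<lambda>i. w t0 i + ?\<psi> \<epsilon> t0 i) \<le> H t0 i0 (w t0) + lam * ?\<psi> \<epsilon> t0 i0"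
      using generator_\<psi>[OF \<epsilon> i0, of _ t0]
      by (intro hamiltonian_le_add i0 t0') (auto simp: generator_add[OF i0, of _ "w t0"])
    ultimately have "?a * ?\<psi> \<epsilon> t0 i0 \<le> lam * ?\<psi> \<epsilon> t0 i0" by linarith
    then show False using \<psi>_pos[OF \<epsilon> i0, of t0] by (simp add: mult_le_cancel_right)
  qed
  have lower: "w t i - v t i < ?\<psi> \<epsilon> t i" if \<epsilon>: "\<epsilon> > 0" for \<epsilon>
  proof (rule ccontr)
    assume neg: "\<not> ?thesis"
    let ?D = "\<lambda>t i. (w t i - ?\<psi> \<epsilon> t i) - v t i"
    obtain N where N: "finite N" "\<And>t i. t \<in> {0..T} \<Longrightarrow> i \<in> states - N \<Longrightarrow> \<bar>v t i - w t i\<bar> < ?\<psi> \<epsilon> t i"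
      using far[OF \<epsilon>] by blast
    have Dneg: "?D t i < 0" if "t \<in> {0..T}" "i \<in> states - N" for t i using N(2)[OF that] by auto
    have Dcont: "continuous_on {0..T} (\<lambda>t. ?D t i)" if "i \<in> states" for i
      by (intro continuous_intros v_cont w_continuous that)
    have DT: "?D T i < 0" if "i \<in> states" for i using v_T[OF that] \<psi>_pos[OF \<epsilon> that, of T] by simp
    have D0: "0 \<le> ?D t i" using neg by simp
    obtain t0 i0 where t0: "t0 \<in> {0..<T}" and i0: "i0 \<in> states"
      and max: "\<And>t i. t \<in> {0..T} \<Longrightarrow> i \<in> states \<Longrightarrow> ?D t i \<le> ?D t0 i0"
      using attains_max_before_horizon[of T ?D N t i, OF _ Dcont N(1) Dneg DT t i D0] T_pos by auto
    have t0': "t0 \<in> {0..T}" using t0 by auto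
    \<comment> \<open>The subtraction is written as a perturbation with \<open>- \<epsilon>\<close>,
      so that \<open>C1_perturbed\<close> applies unchanged.\<close>
    have min: "\<forall>t\<in>{0..<T}. \<forall>i\<in>states.
        v t0 i0 - (w t0 i0 + ?\<psi> (- \<epsilon>) t0 i0) \<le> v t i - (w t i + ?\<psi> (- \<epsilon>) t i)"
    proof (intro ballI)
      fix t i assume "t \<in> {0..<T}" "i \<in> states"
      then show "v t0 i0 - (w t0 i0 + ?\<psi> (- \<epsilon>) t0 i0) \<le> v t i - (w t i + ?\<psi> (- \<epsilon>) t i)"
        using max[of t i] by simp
    qed
    have "viscosity_supersolution T U q f g v" using v by (simp add: viscosity_solution_def)
    then have "0 \<le> - (- H t0 i0 (w t0) - ?a * ?\<psi> (- \<epsilon>) t0 i0) - H t0 i0 (\<lambda>i. w t0 i + ?\<psi> (- \<epsilon>) t0 i)"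
      unfolding viscosity_supersolution_def
      using C1_perturbed[of "- \<epsilon>" ?a \<Phi>] t0 i0 min by blast
    moreover have "H t0 i0 (w t0) \<le> H t0 i0 (\<lambda>i. w t0 i + ?\<psi> (- \<epsilon>) t0 i) + lam * ?\<psi> \<epsilon> t0 i0"
    proof (rule hamiltonian_le_add[OF i0 t0'])
      fix \<mu> assume \<mu>: "\<mu> \<in> prob_measures U"
      have "generator q \<mu> (\<lambda>i. w t0 i + ?\<psi> (- \<epsilon>) t0 i) i0
          = generator q \<mu> (w t0) i0 - \<epsilon> * exp (?a * (T - t0)) * generator q \<mu> \<Phi> i0"
        using generator_add[OF i0 \<mu>, of "w t0" "- \<epsilon> * exp (?a * (T - t0))" \<Phi>] by simp
      then show "generator q \<mu> (w t0) i0 + f t0 i0 \<mu>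
          \<le> generator q \<mu> (\<lambda>i. w t0 i + ?\<psi> (- \<epsilon>) t0 i) i0 + f t0 i0 \<mu> + lam * ?\<psi> \<epsilon> t0 i0"
        using generator_\<psi>[OF \<epsilon> i0 \<mu>, of t0] by linarith
    qed
    ultimately have "?a * ?\<psi> \<epsilon> t0 i0 \<le> lam * ?\<psi> \<epsilon> t0 i0" by simp
    then show False using \<psi>_pos[OF \<epsilon> i0, of t0] by (simp add: mult_le_cancel_right)
  qed
  let ?c = "exp (?a * (T - t)) * \<Phi> i"
  have c: "0 < ?c" using \<Phi>(1)[OF i] by simp
  have "\<bar>v t i - w t i\<bar> \<le> 0 + e" if "e > 0" for e
  proof -
    \<comment> \<open>With this choice of \<epsilon> the perturbation at the given point is exactly
      \<open>e\<close>.\<close>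
    have "e / ?c * exp (?a * (T - t)) * \<Phi> i = e"
      using \<Phi>(1)[OF i] by simp
    then show ?thesis using upper[of "e / ?c"] lower[of "e / ?c"] c that by (simp add: abs_if)
  qed
  then have "\<bar>v t i - w t i\<bar> \<le> 0" by (rule field_le_epsilon)
  then show ?thesis by simp
qed

lemma dominated_growth_w:
  assumes \<Phi>: "\<And>c. finite {i \<in> states. \<Phi> i \<le> c}"
  shows "dominated_growth T \<Phi> w"
  unfolding dominated_growth_def
proof (intro allI impI)
  fix \<epsilon> :: real assume \<epsilon>: "\<epsilon> > 0"
  obtain n where n: "\<And>i. i \<in> {i \<in> states. \<Phi> i \<le> B / \<epsilon>} \<Longrightarrow> i \<le> n"
    using \<Phi>[of "B / \<epsilon>"] unfolding finite_nat_set_iff_bounded_le by blast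
  show "\<forall>\<^sub>F i in sequentially. \<forall>t\<in>{0..T}. \<bar>w t i\<bar> \<le> \<epsilon> * \<Phi> i"
  proof (rule eventually_sequentiallyI[of "Suc n"], rule ballI)
    fix i t assume i: "Suc n \<le> i" and t: "t \<in> {0..T}"
    have "B / \<epsilon> < \<Phi> i" using n[of i] i by force
    then have "B \<le> \<epsilon> * \<Phi> i" using \<epsilon> by (simp add: field_simps)
    then show "\<bar>w t i\<bar> \<le> \<epsilon> * \<Phi> i" using w_bound[OF t, of i] i by simp
  qed
qed

end

section \<open>Dynkin's formula for controls\<close>

lemma prob_measures_eq_topspace: "topspace (weak_topology U) = prob_measures U"
proof -
  have "prob_measures U \<in> {{\<mu> \<in> prob_measures U. integral\<^sup>L \<mu> \<phi> \<in> V} | (\<phi> :: 'a \<Rightarrow> real) V.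
        continuous_on U \<phi> \<and> open V}"
    \<comment> \<open>The zero function with \<open>V = UNIV\<close> exhibits the whole set as one
      of the generating sets.\<close>
    by (rule CollectI, rule exI[of _ "\<lambda>_. 0"], rule exI[of _ UNIV]) auto
  then show ?thesis
    unfolding weak_topology_def topology_generated_by_topspace by auto
qed

lemma space_borel_prob: "space (borel_prob U) = prob_measures U"
  unfolding borel_prob_def by (simp add: space_measure_of_conv)

lemma openin_weak_sets: "openin (weak_topology U) A \<Longrightarrow> A \<in> sets (borel_prob U)"
  unfolding borel_prob_def
  by (subst sets_measure_of)
    (auto dest: openin_subset simp: prob_measures_eq_topspace[symmetric] intro: sigma_sets.Basic)

lemma continuous_map_weak_measurable:
  assumes "continuous_map (weak_topology U) euclideanreal h"
  shows "h \<in> borel_measurable (borel_prob U)"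
proof (rule borel_measurableI)
  fix S :: "real set" assume "open S"
  then have "openin (weak_topology U) {x \<in> topspace (weak_topology U). h x \<in> S}"
    using assms by (auto simp: continuous_map_def)
  moreover have "h -` S \<inter> space (borel_prob U) = {x \<in> topspace (weak_topology U). h x \<in> S}"
    by (auto simp: space_borel_prob prob_measures_eq_topspace)
  ultimately show "h -` S \<inter> space (borel_prob U) \<in> sets (borel_prob U)"
    by (simp add: openin_weak_sets)
qed

text \<open>Sample the path at the next grid point strictly to the right of the time. The sampled
  path depends on time through an integer index only, hence is jointly measurable, and
  right-continuity makes it converge.\<close>

lemma cadlag_jointly_measurable:
  fixes \<Lambda> :: "real \<Rightarrow> 'w \<Rightarrow> nat"
  assumes meas: "\<And>t. t \<in> {s..T} \<Longrightarrow> \<Lambda> t \<in> M \<rightarrow>\<^sub>M count_space states"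
    and cadlag: "\<And>\<omega>. \<omega> \<in> space M \<Longrightarrow> cadlag_on s T (\<lambda>t. \<Lambda> t \<omega>)"
    and sT: "s < T"
  shows "(\<lambda>(t, \<omega>). \<Lambda> t \<omega>) \<in> restrict_space borel {s..T} \<Otimes>\<^sub>M M \<rightarrow>\<^sub>M count_space states"
proof -
  let ?P = "restrict_space borel {s..T} \<Otimes>\<^sub>M M"
  have sp: "space ?P = {s..T} \<times> space M" by (simp add: space_pair_measure space_restrict_space)
  \<comment> \<open>The \<open>min\<close> makes the sampling exact at time \<open>T\<close>; the
    \<open>max\<close> keeps every integer index admissible, including the negative ones that no
    time in [s, T] produces.\<close>
  define \<tau> where "\<tau> n k = min T (s + (max 0 (real_of_int k) + 1) / real (Suc n))" for n :: nat and k :: int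
  have \<tau>_mem: "\<tau> n k \<in> {s..T}" for n k using sT by (auto simp: \<tau>_def)
  define L where "L n = (\<lambda>(t, \<omega>). real (\<Lambda> (\<tau> n \<lfloor>real (Suc n) * (t - s)\<rfloor>) \<omega>))" for n
  have L_meas: "L n \<in> borel_measurable ?P" for n
  proof -
    have 1: "(\<lambda>p. real (\<Lambda> (\<tau> n k) (snd p))) \<in> borel_measurable ?P" for k
    proof -
      have "\<Lambda> (\<tau> n k) \<in> M \<rightarrow>\<^sub>M count_space states" by (rule meas[OF \<tau>_mem])
      then have "(\<lambda>\<omega>. real (\<Lambda> (\<tau> n k) \<omega>)) \<in> borel_measurable M"
        by (rule measurable_compose) simp
      then show ?thesis by (rule measurable_compose[OF measurable_snd])
    qed
    have 2: "(\<lambda>p. \<lfloor>real (Suc n) * (fst p - s)\<rfloor>) \<in> ?P \<rightarrow>\<^sub>M count_space UNIV"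
    proof -
      have "(\<lambda>t. \<lfloor>real (Suc n) * (t - s)\<rfloor>) \<in> restrict_space borel {s..T} \<rightarrow>\<^sub>M count_space UNIV"
        by (rule measurable_restrict_space1) measurable
      then show ?thesis by (rule measurable_compose[OF measurable_fst])
    qed
    show ?thesis
      unfolding L_def split_beta by (rule measurable_compose_countable[OF 1 2])
  qed
  have lim: "(\<lambda>n. L n p) \<longlonglongrightarrow> (\<lambda>(t, \<omega>). real (\<Lambda> t \<omega>)) p" if "p \<in> space ?P" for p
  proof -
    obtain t \<omega> where p: "p = (t, \<omega>)" "t \<in> {s..T}" "\<omega> \<in> space M" using \<open>p \<in> space ?P\<close> sp by auto
    let ?\<tau> = "\<lambda>n. \<tau> n \<lfloor>real (Suc n) * (t - s)\<rfloor>"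
    have gt: "t < s + (max 0 (real_of_int \<lfloor>real (Suc n) * (t - s)\<rfloor>) + 1) / real (Suc n)"
      and le: "s + (max 0 (real_of_int \<lfloor>real (Suc n) * (t - s)\<rfloor>) + 1) / real (Suc n) \<le> t + 1 / real (Suc n)" for n
    proof -
      let ?N = "real (Suc n)"
      have N: "?N > 0" by simp
      have nn: "0 \<le> ?N * (t - s)" using p by simp
      then have m: "max 0 (real_of_int \<lfloor>?N * (t - s)\<rfloor>) = real_of_int \<lfloor>?N * (t - s)\<rfloor>" by simp
      have "?N * (t - s) < real_of_int \<lfloor>?N * (t - s)\<rfloor> + 1" by linarith
      then have "t - s < (real_of_int \<lfloor>?N * (t - s)\<rfloor> + 1) / ?N"
        using N by (simp add: pos_less_divide_eq mult.commute)
      then show "t < s + (max 0 (real_of_int \<lfloor>?N * (t - s)\<rfloor>) + 1) / ?N" unfolding m by linarith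
      have "real_of_int \<lfloor>?N * (t - s)\<rfloor> / ?N \<le> t - s"
        using N by (simp add: pos_divide_le_eq mult.commute)
      then show "s + (max 0 (real_of_int \<lfloor>?N * (t - s)\<rfloor>) + 1) / ?N \<le> t + 1 / ?N"
        unfolding m add_divide_distrib by linarith
    qed
    have "(\<lambda>n. \<Lambda> (?\<tau> n) \<omega>) \<longlonglongrightarrow> \<Lambda> t \<omega>"
    proof (cases "t = T")
      case True
      then have "?\<tau> n = t" for n using gt[of n] by (simp add: \<tau>_def)
      then show ?thesis by simp
    next
      case False
      then have t: "t \<in> {s..<T}" using p by auto
      have "filterlim ?\<tau> (at_right t) sequentially"
      proof (rule tendsto_imp_filterlim_at_right)
        have "(\<lambda>n. t + 1 / real (Suc n)) \<longlonglongrightarrow> t + 0"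
          by (intro tendsto_intros LIMSEQ_Suc lim_1_over_n)
        then have lim1: "(\<lambda>n. t + 1 / real (Suc n)) \<longlonglongrightarrow> t" by simp
        show "?\<tau> \<longlonglongrightarrow> t"
        proof (rule tendsto_sandwich[OF _ _ tendsto_const lim1])
          show "\<forall>\<^sub>F n in sequentially. t \<le> ?\<tau> n"
            by (rule always_eventually) (use gt t in \<open>auto simp: \<tau>_def less_imp_le\<close>)
          show "\<forall>\<^sub>F n in sequentially. ?\<tau> n \<le> t + 1 / real (Suc n)"
            by (rule always_eventually) (use le in \<open>auto simp: \<tau>_def min.coboundedI2\<close>)
        qed
        show "\<forall>\<^sub>F n in sequentially. t < ?\<tau> n"
          by (rule always_eventually) (use gt t in \<open>auto simp: \<tau>_def\<close>)
      qed
      moreover have "((\<lambda>t. \<Lambda> t \<omega>) \<longlongrightarrow> \<Lambda> t \<omega>) (at_right t)"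
        using cadlag[OF p(3)] t by (auto simp: cadlag_on_def)
      ultimately show ?thesis by (rule filterlim_compose[rotated])
    qed
    then have "\<forall>\<^sub>F n in sequentially. \<Lambda> (?\<tau> n) \<omega> = \<Lambda> t \<omega>" by (simp add: tendsto_discrete)
    then have "\<forall>\<^sub>F n in sequentially. L n p = real (\<Lambda> t \<omega>)"
      by eventually_elim (simp add: L_def p)
    then show ?thesis by (simp add: p tendsto_eventually)
  qed
  have real_meas: "(\<lambda>(t, \<omega>). real (\<Lambda> t \<omega>)) \<in> borel_measurable ?P"
    by (rule borel_measurable_LIMSEQ_real[OF lim L_meas])
  show ?thesis
  proof (rule measurable_count_space_eq_countable[THEN iffD2])
    show "(\<lambda>(t, \<omega>). \<Lambda> t \<omega>) \<in> space ?P \<rightarrow> states \<and>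
      (\<forall>a\<in>states. (\<lambda>(t, \<omega>). \<Lambda> t \<omega>) -` {a} \<inter> space ?P \<in> sets ?P)"
    proof (intro conjI ballI)
      show "(\<lambda>(t, \<omega>). \<Lambda> t \<omega>) \<in> space ?P \<rightarrow> states"
        using measurable_space[OF meas] unfolding sp by auto
      fix a :: nat
      have "(\<lambda>(t, \<omega>). \<Lambda> t \<omega>) -` {a} \<inter> space ?P = (\<lambda>(t, \<omega>). real (\<Lambda> t \<omega>)) -` {real a} \<inter> space ?P"
        by auto
      also have "\<dots> \<in> sets ?P" by (rule measurable_sets[OF real_meas]) simp
      finally show "(\<lambda>(t, \<omega>). \<Lambda> t \<omega>) -` {a} \<inter> space ?P \<in> sets ?P" .
    qed
  qed simp
qed

lemma (in hjb_data) rate_abs_le: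
  assumes "l \<in> states" "j \<in> states" "\<nu> \<in> prob_measures U"
  shows "\<bar>q l j \<nu>\<bar> \<le> Mq"
proof -
  consider "j = l" | "j \<in> nbrs K l" | "j \<noteq> l" "j \<notin> nbrs K l" by blast
  then show ?thesis
  proof cases
    case 1 then show ?thesis using rate_le[OF assms(1,3)] diag_rate_nonpos[OF assms(1,3)] by simp
  next
    case 2 then show ?thesis using rate_le_bound[OF assms(1) 2 assms(3)] by simp
  next
    case 3 then show ?thesis using rate_outside_nbrs[OF assms(1) _ 3(2) assms(3)] assms Mq_nonneg by simp
  qed
qed

text \<open>The near-optimal feedback control is an instance of this locale just as an arbitrary
  control is, so a single Dynkin formula yields both the lower and the upper bound of the
  cost.\<close>

locale controlled_process =
  classical_solution U q f g T Mq C0 Cf Cg K w B + prob_space M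
  for U :: "'u::topological_space set" and q f g T Mq C0 Cf Cg K w B
    and M :: "'w measure" +
  fixes s :: real and i :: nat and \<Lambda> :: "real \<Rightarrow> 'w \<Rightarrow> nat" and \<mu> :: "real \<Rightarrow> 'w \<Rightarrow> 'u measure"
  assumes q_cont: "\<And>i j. i \<in> states \<Longrightarrow> j \<in> states \<Longrightarrow>
        continuous_map (weak_topology U) euclideanreal (q i j)"
    and s_mem: "s \<in> {0..<T}"
    and initial_state: "i \<in> states"
    and \<Lambda>_meas: "\<And>t. t \<in> {s..T} \<Longrightarrow> \<Lambda> t \<in> M \<rightarrow>\<^sub>M count_space states"
    and \<Lambda>_cadlag: "\<And>\<omega>. \<omega> \<in> space M \<Longrightarrow> cadlag_on s T (\<lambda>t. \<Lambda> t \<omega>)"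
    and \<Lambda>_s: "AE \<omega> in M. \<Lambda> s \<omega> = i"
    and \<mu>_joint: "(\<lambda>(t, \<omega>). \<mu> t \<omega>) \<in> restrict_space borel {s..T} \<Otimes>\<^sub>M M \<rightarrow>\<^sub>M borel_prob U"
    and crates: "has_controlled_rates M T U q s \<Lambda> \<mu>"
begin

lemma \<Lambda>_states: "t \<in> {s..T} \<Longrightarrow> \<omega> \<in> space M \<Longrightarrow> \<Lambda> t \<omega> \<in> states"
  using measurable_space[OF \<Lambda>_meas] by auto

lemma \<Lambda>_measurable: "t \<in> {s..T} \<Longrightarrow> \<Lambda> t \<in> M \<rightarrow>\<^sub>M count_space UNIV"
  using measurable_compose[OF \<Lambda>_meas[of t], of "\<lambda>x. x" "count_space UNIV"] by simp

lemma \<mu>_meas: "t \<in> {s..T} \<Longrightarrow> \<mu> t \<in> M \<rightarrow>\<^sub>M borel_prob U"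
  using measurable_compose[OF measurable_Pair1' \<mu>_joint, of t] by (simp add: space_restrict_space)

lemma \<mu>_mem: "t \<in> {s..T} \<Longrightarrow> \<omega> \<in> space M \<Longrightarrow> \<mu> t \<omega> \<in> prob_measures U"
  using measurable_space[OF \<mu>_meas] by (simp add: space_borel_prob)

lemma q_meas: "l \<in> states \<Longrightarrow> j \<in> states \<Longrightarrow> q l j \<in> borel_measurable (borel_prob U)"
  by (rule continuous_map_weak_measurable[OF q_cont])

lemma q_\<mu>_meas: "t \<in> {s..T} \<Longrightarrow> l \<in> states \<Longrightarrow> j \<in> states \<Longrightarrow>
    (\<lambda>\<omega>. q l j (\<mu> t \<omega>)) \<in> borel_measurable M"
  by (rule measurable_compose[OF \<mu>_meas q_meas])

definition in_state :: "real \<Rightarrow> nat \<Rightarrow> 'w \<Rightarrow> real" where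
  "in_state t l = indicator {\<omega> \<in> space M. \<Lambda> t \<omega> = l}"

lemma in_state_set: "t \<in> {s..T} \<Longrightarrow> {\<omega> \<in> space M. \<Lambda> t \<omega> = l} \<in> sets M"
  using measurable_sets[OF \<Lambda>_measurable, of t "{l}"] by (simp add: vimage_def Int_def conj_commute)

lemma in_state_meas: "t \<in> {s..T} \<Longrightarrow> in_state t l \<in> borel_measurable M"
  unfolding in_state_def by (intro borel_measurable_indicator in_state_set)

lemma in_state_bounds: "0 \<le> in_state t l \<omega>" "in_state t l \<omega> \<le> 1"
  by (auto simp: in_state_def indicator_def)

text \<open>The error of the expansion after integration over the event that the process is in
  \<open>l\<close> at time \<open>t\<close>; in this form no conditional expectation is
  left.\<close>

definition remainder :: "real \<Rightarrow> real \<Rightarrow> nat \<Rightarrow> nat \<Rightarrow> real" where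
  "remainder t \<delta> l j = expectation (\<lambda>\<omega>. in_state t l \<omega> * in_state (t + \<delta>) j \<omega>)
     - expectation (\<lambda>\<omega>. in_state t l \<omega> * (of_bool (j = l) + q l j (\<mu> t \<omega>) * \<delta>))"

lemma bounded_integrable:
  assumes "h \<in> borel_measurable M" "\<And>\<omega>. \<omega> \<in> space M \<Longrightarrow> \<bar>h \<omega>\<bar> \<le> (c :: real)"
  shows "integrable M h"
  by (rule integrable_const_bound[of _ c]) (use assms in \<open>auto intro: AE_I2\<close>)

text \<open>The event of being in \<open>l\<close> at time \<open>t\<close> is measurable for the
  conditioning, so the indicator can be pulled in and the conditional probability replaced by
  \<open>p\<close>. The uniform O(\<delta>) bound keeps the probability of the event as a factor and
  also dominates the pointwise o(\<delta>) at the random action.\<close>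

lemma remainder_expansion:
  obtains C where "0 \<le> C"
    "\<And>t \<delta> l j. t \<in> {s..<T} \<Longrightarrow> \<delta> \<in> {0<..T - t} \<Longrightarrow> l \<in> states \<Longrightarrow> j \<in> states \<Longrightarrow>
        \<bar>remainder t \<delta> l j\<bar> \<le> C * \<delta> * expectation (in_state t l)"
    "\<And>t d l j. t \<in> {s..<T} \<Longrightarrow> (\<And>n. d n \<in> {0<..T - t}) \<Longrightarrow> d \<longlonglongrightarrow> 0 \<Longrightarrow> l \<in> states \<Longrightarrow> j \<in> states \<Longrightarrow>
        (\<lambda>n. remainder t (d n) l j / d n) \<longlonglongrightarrow> 0"
proof -
  obtain p C where pC: "\<And>t j. t \<in> {s..<T} \<Longrightarrow> j \<in> states \<Longrightarrow>
      (\<forall>\<delta>\<in>{0<..T - t}. AE \<omega> in M.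
             real_cond_exp M (current_info M U (\<Lambda> t) (\<mu> t))
               (indicator {\<omega> \<in> space M. \<Lambda> (t + \<delta>) \<omega> = j}) \<omega>
             = p t \<delta> (\<Lambda> t \<omega>) j (\<mu> t \<omega>)) \<and>
          (\<forall>l\<in>states. \<forall>\<nu>\<in>prob_measures U.
             (\<lambda>\<delta>. p t \<delta> l j \<nu> - (of_bool (j = l) + q l j \<nu> * \<delta>)) \<in> o[at_right 0](\<lambda>\<delta>. \<delta>) \<and>
             (\<forall>\<delta>\<in>{0<..T - t}. \<bar>p t \<delta> l j \<nu> - (of_bool (j = l) + q l j \<nu> * \<delta>)\<bar> \<le> C * \<delta>))"
    using crates unfolding has_controlled_rates_def by blast
  define e where "e t \<delta> j = real_cond_exp M (current_info M U (\<Lambda> t) (\<mu> t)) (in_state (t + \<delta>) j)" for t \<delta> j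
  define r where "r t \<delta> l j \<omega> = in_state t l \<omega> * (e t \<delta> j \<omega> - (of_bool (j = l) + q l j (\<mu> t \<omega>) * \<delta>))"
    for t \<delta> l j \<omega>
  \<comment> \<open>No sign of \<open>C\<close> is part of
    \<open>has_controlled_rates\<close>.\<close>
  define C' where "C' = max C 0"
  have e_meas: "e t \<delta> j \<in> borel_measurable M" for t \<delta> j
    unfolding e_def by simp
  have r_meas: "r t \<delta> l j \<in> borel_measurable M" if "t \<in> {s..<T}" "l \<in> states" "j \<in> states" for t \<delta> l j
  proof -
    have [measurable]: "in_state t l \<in> borel_measurable M" "(\<lambda>\<omega>. q l j (\<mu> t \<omega>)) \<in> borel_measurable M"
      using in_state_meas[of t l] q_\<mu>_meas[of t l j] that by auto
    note e_meas[measurable]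
    show ?thesis unfolding r_def by measurable
  qed
  have e_eq: "AE \<omega> in M. e t \<delta> j \<omega> = p t \<delta> (\<Lambda> t \<omega>) j (\<mu> t \<omega>)"
    if "t \<in> {s..<T}" "\<delta> \<in> {0<..T - t}" "j \<in> states" for t \<delta> j
    unfolding e_def in_state_def using pC[OF that(1,3)] that(2) by blast
  have r_bound: "AE \<omega> in M. \<bar>r t \<delta> l j \<omega>\<bar> \<le> in_state t l \<omega> * (C' * \<delta>)"
    if t: "t \<in> {s..<T}" "\<delta> \<in> {0<..T - t}" "l \<in> states" "j \<in> states" for t \<delta> l j
    using e_eq[OF t(1,2,4)] AE_space
  proof eventually_elim
    case (elim \<omega>)
    show ?case
    proof (cases "\<Lambda> t \<omega> = l")
      case True
      have "\<mu> t \<omega> \<in> prob_measures U" using \<mu>_mem[of t \<omega>] t elim by auto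
      then have "\<bar>p t \<delta> l j (\<mu> t \<omega>) - (of_bool (j = l) + q l j (\<mu> t \<omega>) * \<delta>)\<bar> \<le> C * \<delta>"
        using pC[OF t(1,4)] t by blast
      also have "\<dots> \<le> C' * \<delta>" using t by (intro mult_right_mono) (auto simp: C'_def)
      finally show ?thesis using True elim by (simp add: r_def in_state_def)
    qed (simp add: r_def in_state_def)
  qed
  have rem: "remainder t \<delta> l j = expectation (r t \<delta> l j)" and r_int: "integrable M (r t \<delta> l j)"
    if t: "t \<in> {s..<T}" "\<delta> \<in> {0<..T - t}" "l \<in> states" "j \<in> states" for t \<delta> l j
  proof -
    have t': "t \<in> {s..T}" "t + \<delta> \<in> {s..T}" using t by auto
    let ?A = "current_info M U (\<Lambda> t) (\<mu> t)"
    have pair: "(\<lambda>\<omega>. (\<Lambda> t \<omega>, \<mu> t \<omega>)) \<in> M \<rightarrow>\<^sub>M count_space states \<Otimes>\<^sub>M borel_prob U"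
      by (intro measurable_Pair \<Lambda>_meas \<mu>_meas t')
    have sub: "subalgebra M ?A"
      unfolding subalgebra_def current_info_def
    proof
      show "sets (vimage_algebra (space M) (\<lambda>\<omega>. (\<Lambda> t \<omega>, \<mu> t \<omega>)) (count_space states \<Otimes>\<^sub>M borel_prob U)) \<subseteq> sets M"
        using measurable_sets[OF pair] measurable_space[OF pair]
        by (subst sets_vimage_algebra2) blast+
    qed simp
    interpret sa: finite_measure_subalgebra M ?A by unfold_locales (rule sub)
    have "(\<lambda>\<omega>. (\<Lambda> t \<omega>, \<mu> t \<omega>)) \<in> ?A \<rightarrow>\<^sub>M count_space states \<Otimes>\<^sub>M borel_prob U"
      unfolding current_info_def using measurable_space[OF pair] by (intro measurable_vimage_algebra1) auto
    from measurable_compose[OF this measurable_fst]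
    have \<Lambda>A: "\<Lambda> t \<in> ?A \<rightarrow>\<^sub>M count_space states" by simp
    have spA: "space ?A = space M" using sub by (simp add: subalgebra_def)
    have "{\<omega> \<in> space M. \<Lambda> t \<omega> = l} = \<Lambda> t -` {l} \<inter> space ?A" using spA by auto
    also have "\<dots> \<in> sets ?A" by (rule measurable_sets[OF \<Lambda>A]) (use t in auto)
    finally have inA: "in_state t l \<in> borel_measurable ?A" unfolding in_state_def by simp
    have int1: "integrable M (\<lambda>\<omega>. in_state t l \<omega> * in_state (t + \<delta>) j \<omega>)"
      by (rule bounded_integrable[of _ 1], rule borel_measurable_times[OF in_state_meas[OF t'(1)] in_state_meas[OF t'(2)]])
        (auto simp: in_state_def indicator_def)
    note ce = sa.real_cond_exp_intg[OF int1 inA in_state_meas[OF t'(2)], folded e_def]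
    have int2: "integrable M (\<lambda>\<omega>. in_state t l \<omega> * (of_bool (j = l) + q l j (\<mu> t \<omega>) * \<delta>))"
    proof (rule bounded_integrable[of _ "1 * (1 + Mq * \<delta>)"])
      show "(\<lambda>\<omega>. in_state t l \<omega> * (of_bool (j = l) + q l j (\<mu> t \<omega>) * \<delta>)) \<in> borel_measurable M"
        by (intro borel_measurable_times borel_measurable_add borel_measurable_const
          in_state_meas q_\<mu>_meas t t')
      fix \<omega> assume \<omega>: "\<omega> \<in> space M"
      have "\<bar>q l j (\<mu> t \<omega>) * \<delta>\<bar> \<le> Mq * \<delta>"
        unfolding abs_mult using rate_abs_le[OF t(3,4) \<mu>_mem[OF t'(1) \<omega>]] t by (intro mult_mono) auto
      then have "\<bar>of_bool (j = l) + q l j (\<mu> t \<omega>) * \<delta>\<bar> \<le> 1 + Mq * \<delta>" by (auto simp: of_bool_def)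
      then show "\<bar>in_state t l \<omega> * (of_bool (j = l) + q l j (\<mu> t \<omega>) * \<delta>)\<bar> \<le> 1 * (1 + Mq * \<delta>)"
        unfolding abs_mult using in_state_bounds by (intro mult_mono) auto
    qed
    have eq: "r t \<delta> l j = (\<lambda>\<omega>. in_state t l \<omega> * e t \<delta> j \<omega>
        - in_state t l \<omega> * (of_bool (j = l) + q l j (\<mu> t \<omega>) * \<delta>))"
      by (auto simp: r_def algebra_simps)
    show "integrable M (r t \<delta> l j)" unfolding eq by (intro Bochner_Integration.integrable_diff ce(1) int2)
    show "remainder t \<delta> l j = expectation (r t \<delta> l j)"
      unfolding eq remainder_def by (simp add: Bochner_Integration.integral_diff[OF ce(1) int2] ce(2))
  qed
  show ?thesis
  proof (rule that[of C'])
    show "0 \<le> C'" by (simp add: C'_def)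
  next
    fix t \<delta> l j assume t: "t \<in> {s..<T}" "\<delta> \<in> {0<..T - t}" "l \<in> states" "j \<in> states"
    have int3: "integrable M (in_state t l)"
      by (rule bounded_integrable[of _ 1]) (use in_state_meas[of t] t in \<open>auto simp: in_state_def indicator_def\<close>)
    have "\<bar>remainder t \<delta> l j\<bar> \<le> expectation (\<lambda>\<omega>. \<bar>r t \<delta> l j \<omega>\<bar>)"
      unfolding rem[OF t] by (rule integral_abs_bound)
    also have "\<dots> \<le> expectation (\<lambda>\<omega>. in_state t l \<omega> * (C' * \<delta>))"
      by (rule integral_mono_AE) (use r_int[OF t] int3 r_bound[OF t] in auto)
    also have "\<dots> = C' * \<delta> * expectation (in_state t l)" by simp
    finally show "\<bar>remainder t \<delta> l j\<bar> \<le> C' * \<delta> * expectation (in_state t l)" .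
  next
    fix t l j and d :: "nat \<Rightarrow> real"
    assume t: "t \<in> {s..<T}" and d: "\<And>n. d n \<in> {0<..T - t}" "d \<longlonglongrightarrow> 0" and l: "l \<in> states" "j \<in> states"
    have d_at: "filterlim d (at_right 0) sequentially"
      by (rule tendsto_imp_filterlim_at_right[OF d(2)]) (use d(1) in auto)
    have "(\<lambda>n. expectation (\<lambda>\<omega>. r t (d n) l j \<omega> / d n)) \<longlonglongrightarrow> expectation (\<lambda>\<omega>. 0)"
    proof (rule integral_dominated_convergence[where w = "\<lambda>_. C'"])
      show "(\<lambda>\<omega>. r t (d n) l j \<omega> / d n) \<in> borel_measurable M" for n
        using r_meas[OF t l] by simp
      \<comment> \<open>The identity holds off a null set depending on \<delta>; a sequence leaves
        countably many null sets.\<close>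
      have "AE \<omega> in M. \<forall>n. e t (d n) j \<omega> = p t (d n) (\<Lambda> t \<omega>) j (\<mu> t \<omega>)"
        unfolding AE_all_countable using e_eq[OF t d(1) l(2)] by blast
      then show "AE \<omega> in M. (\<lambda>n. r t (d n) l j \<omega> / d n) \<longlonglongrightarrow> 0"
        using AE_space
      proof eventually_elim
        case (elim \<omega>)
        show ?case
        proof (cases "\<Lambda> t \<omega> = l")
          case True
          have "\<mu> t \<omega> \<in> prob_measures U" using \<mu>_mem[of t \<omega>] t elim by auto
          then have "(\<lambda>\<delta>. p t \<delta> l j (\<mu> t \<omega>) - (of_bool (j = l) + q l j (\<mu> t \<omega>) * \<delta>)) \<in> o[at_right 0](\<lambda>\<delta>. \<delta>)"
            using pC[OF t l(2)] l by blast
          then have "((\<lambda>\<delta>. (p t \<delta> l j (\<mu> t \<omega>) - (of_bool (j = l) + q l j (\<mu> t \<omega>) * \<delta>)) / \<delta>) \<longlongrightarrow> 0) (at_right 0)"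
            by (rule smalloD_tendsto)
          from filterlim_compose[OF this d_at] show ?thesis
            using True elim by (simp add: r_def in_state_def)
        qed (simp add: r_def in_state_def)
      qed
      show "AE \<omega> in M. norm (r t (d n) l j \<omega> / d n) \<le> C'" for n
        using r_bound[OF t d(1)[of n] l]
      proof eventually_elim
        case (elim \<omega>)
        have dn: "d n > 0" using d(1)[of n] by simp
        have "in_state t l \<omega> * (C' * d n) \<le> 1 * (C' * d n)"
          using in_state_bounds[of t l \<omega>] dn by (intro mult_right_mono) (auto simp: C'_def)
        with elim have "\<bar>r t (d n) l j \<omega>\<bar> \<le> C' * d n" by simp
        then show ?case using dn by (simp add: pos_divide_le_eq)
      qed
    qed auto
    then show "(\<lambda>n. remainder t (d n) l j / d n) \<longlonglongrightarrow> 0"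
      using rem[OF t d(1) l] by simp
  qed
qed

end

text \<open>The partial sums are the expectations of \<open>Z\<close> cut off to
  \<open>X < n\<close>, and the absolute value of \<open>Z\<close> dominates them.\<close>

lemma (in prob_space) expectation_partition_sums:
  fixes Z :: "'a \<Rightarrow> real" and X :: "'a \<Rightarrow> nat"
  assumes Z: "integrable M Z" and X: "X \<in> M \<rightarrow>\<^sub>M count_space UNIV"
  shows "(\<lambda>l. expectation (\<lambda>\<omega>. indicator {\<omega> \<in> space M. X \<omega> = l} \<omega> * Z \<omega>)) sums expectation Z"
proof -
  have [measurable]: "X \<in> M \<rightarrow>\<^sub>M count_space UNIV" "Z \<in> borel_measurable M"
    using X Z by auto
  have int: "integrable M (\<lambda>\<omega>. indicator {\<omega> \<in> space M. X \<omega> = l} \<omega> * Z \<omega>)" for l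
    by (rule integrable_real_mult_indicator[OF _ Z, unfolded mult.commute[of "Z _"]]) measurable
  have ind: "(\<Sum>l<n. indicator {\<omega> \<in> space M. X \<omega> = l} \<omega> * Z \<omega>) = (if X \<omega> < n then Z \<omega> else 0)"
    if "\<omega> \<in> space M" for n \<omega>
  proof -
    have "(\<Sum>l<n. indicator {\<omega> \<in> space M. X \<omega> = l} \<omega> * Z \<omega>) = (\<Sum>l<n. if l = X \<omega> then Z \<omega> else 0)"
      using that by (intro sum.cong) (auto simp: indicator_def)
    then show ?thesis by simp
  qed
  have "(\<lambda>n. expectation (\<lambda>\<omega>. if X \<omega> < n then Z \<omega> else 0)) \<longlonglongrightarrow> expectation Z"
  proof (rule integral_dominated_convergence[where w = "\<lambda>\<omega>. norm (Z \<omega>)"])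
    show "AE \<omega> in M. (\<lambda>n. if X \<omega> < n then Z \<omega> else 0) \<longlonglongrightarrow> Z \<omega>"
    proof (rule AE_I2)
      fix \<omega>
      have "\<forall>\<^sub>F n in sequentially. (if X \<omega> < n then Z \<omega> else 0) = Z \<omega>"
        using eventually_gt_at_top[of "X \<omega>"] by eventually_elim simp
      then show "(\<lambda>n. if X \<omega> < n then Z \<omega> else 0) \<longlonglongrightarrow> Z \<omega>" by (rule tendsto_eventually)
    qed
  qed (use Z in auto)
  moreover have "expectation (\<lambda>\<omega>. if X \<omega> < n then Z \<omega> else 0)
      = (\<Sum>l<n. expectation (\<lambda>\<omega>. indicator {\<omega> \<in> space M. X \<omega> = l} \<omega> * Z \<omega>))" for n
  proof -
    have "(\<Sum>l<n. expectation (\<lambda>\<omega>. indicator {\<omega> \<in> space M. X \<omega> = l} \<omega> * Z \<omega>))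
        = expectation (\<lambda>\<omega>. \<Sum>l<n. indicator {\<omega> \<in> space M. X \<omega> = l} \<omega> * Z \<omega>)"
      by (rule Bochner_Integration.integral_sum[symmetric]) (rule int)
    also have "\<dots> = expectation (\<lambda>\<omega>. if X \<omega> < n then Z \<omega> else 0)"
      by (rule Bochner_Integration.integral_cong[OF refl ind])
    finally show ?thesis by simp
  qed
  ultimately show ?thesis by (simp add: sums_def)
qed

text \<open>The integrals of the difference quotients equal differences of difference quotients of a
  primitive, which converge by continuity. The Lipschitz bound dominates the quotients, so their
  integrals also converge to the integral of the right derivative; integrability of \<open>b\<close>
  is part of the outcome.\<close>

lemma has_integral_right_derivative:
  fixes a b :: "real \<Rightarrow> real"
  assumes sT: "s < T"
    and lip: "\<And>t t'. t \<in> {s..T} \<Longrightarrow> t' \<in> {s..T} \<Longrightarrow> \<bar>a t - a t'\<bar> \<le> L * \<bar>t - t'\<bar>"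
    and der: "\<And>t. t \<in> {s..<T} \<Longrightarrow>
      (\<lambda>n. (a (min T (t + 1 / real (Suc n))) - a t) * real (Suc n)) \<longlonglongrightarrow> b t"
  shows "(b has_integral a T - a s) {s..T}"
proof -
  \<comment> \<open>The constant extension beyond the ends lets the argument be shifted past
    \<open>T\<close>.\<close>
  define c where "c t = a (max s (min T t))" for t
  have L0: "0 \<le> L"
  proof -
    have "0 \<le> L * \<bar>T - s\<bar>" using lip[of T s] sT by (meson abs_ge_zero atLeastAtMost_iff less_eq_real_def order_trans)
    then show ?thesis using sT by (simp add: zero_le_mult_iff)
  qed
  have c_lip: "\<bar>c t - c t'\<bar> \<le> L * \<bar>t - t'\<bar>" for t t'
  proof -
    have "\<bar>c t - c t'\<bar> \<le> L * \<bar>max s (min T t) - max s (min T t')\<bar>"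
      unfolding c_def by (rule lip) (use sT in auto)
    also have "\<dots> \<le> L * \<bar>t - t'\<bar>" by (intro mult_left_mono L0) (auto simp: max_def min_def)
    finally show ?thesis .
  qed
  have c_cont: "continuous_on A c" for A
  proof (rule continuous_on_subset[OF lipschitz_on_continuous_on])
    show "L-lipschitz_on UNIV c" using c_lip L0 by (auto simp: lipschitz_on_def dist_real_def)
  qed simp
  define h where "h n = 1 / real (Suc n)" for n
  have h: "0 < h n" "h n \<le> 1" for n by (auto simp: h_def)
  have h0: "h \<longlonglongrightarrow> 0" unfolding h_def by (intro LIMSEQ_Suc lim_1_over_n)
  \<comment> \<open>At \<open>T\<close> the extension is constant to the right, so the limit there
    is 0 whatever \<open>b T\<close> is; the one point is exchanged at the end.\<close>
  define g where "g t = (if t = T then 0 else b t)" for t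
  have int: "c integrable_on {u..v}" for u v
    by (rule integrable_continuous_interval[OF c_cont])
  have shift: "integral {s..T} (\<lambda>t. c (t + d)) = integral {s + d..T + d} c" for d
    using integral_shift_real_ivl[of "s + d" d "T + d" c] by simp
  have quot_int: "(\<lambda>t. (c (t + h n) - c t) / h n) integrable_on {s..T}" for n
    by (intro integrable_continuous_interval continuous_intros continuous_on_compose2[OF c_cont[of UNIV]])
      (use h(1)[of n] in auto)
  have quot_le: "norm ((c (t + h n) - c t) / h n) \<le> L" for n t
    using c_lip[of "t + h n" t] h(1)[of n] by (simp add: pos_divide_le_eq)
  have lim: "(\<lambda>n. (c (t + h n) - c t) / h n) \<longlonglongrightarrow> g t" if "t \<in> {s..T}" for t
  proof (cases "t = T")
    case True
    have "c (T + h n) = c T" for n using h(1)[of n] sT by (simp add: c_def)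
    then show ?thesis by (simp add: g_def True)
  next
    case False
    then have t: "t \<in> {s..<T}" using that by auto
    have "c (t + h n) = a (min T (t + 1 / real (Suc n)))" for n
    proof -
      have "max s (min T (t + h n)) = min T (t + h n)"
        using t h(1)[of n] by (auto simp: max_def min_def)
      then show ?thesis by (simp add: c_def h_def)
    qed
    moreover have "c t = a t" using t by (simp add: c_def)
    ultimately show ?thesis using der[OF t] False by (simp add: g_def h_def)
  qed
  note conv = dominated_convergence[OF quot_int integrable_const_ivl[of L] quot_le lim]
  define A where "A x = integral {s..x} c" for x
  have A_der: "(\<lambda>n. (A (x + h n) - A x) / h n) \<longlonglongrightarrow> c x" if "s \<le> x" for x
  proof -
    have "(A has_real_derivative c x) (at x within {s..x + 1})"
      unfolding A_def by (rule integral_has_real_derivative[OF c_cont]) (use that in auto)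
    then have "((\<lambda>y. (A y - A x) / (y - x)) \<longlongrightarrow> c x) (at x within {s..x + 1})"
      by (simp add: has_field_derivative_iff)
    moreover have "filterlim (\<lambda>n. x + h n) (at x within {s..x + 1}) sequentially"
      unfolding filterlim_at
    proof
      show "\<forall>\<^sub>F n in sequentially. x + h n \<in> {s..x + 1} \<and> x + h n \<noteq> x"
        using h that by (intro always_eventually) (simp add: add_increasing2 less_imp_le less_imp_neq[THEN not_sym])
      show "(\<lambda>n. x + h n) \<longlonglongrightarrow> x" using tendsto_add[OF tendsto_const h0, of x] by simp
    qed
    ultimately have "(\<lambda>n. (A (x + h n) - A x) / (x + h n - x)) \<longlonglongrightarrow> c x"
      by (rule filterlim_compose)
    then show ?thesis by simp
  qed
  \<comment> \<open>After the shift of variable the two integrals overlap; what remains are the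
    pieces next to \<open>T\<close> and next to \<open>s\<close>.\<close>
  have eq: "integral {s..T} (\<lambda>t. (c (t + h n) - c t) / h n) = (A (T + h n) - A T) / h n - (A (s + h n) - A s) / h n" for n
  proof -
    have i1: "(\<lambda>t. c (t + h n)) integrable_on {s..T}"
      by (intro integrable_continuous_interval continuous_on_compose2[OF c_cont[of UNIV]] continuous_intros) auto
    have sum1: "integral {s..s + h n} c + integral {s + h n..T + h n} c = integral {s..T + h n} c"
      by (rule Henstock_Kurzweil_Integration.integral_combine) (use h(1)[of n] sT int in auto)
    have "integral {s..T} (\<lambda>t. (c (t + h n) - c t) / h n)
        = (integral {s..T} (\<lambda>t. c (t + h n)) - integral {s..T} c) / h n"
      using i1 int by (simp add: Henstock_Kurzweil_Integration.integral_diff)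
    also have "\<dots> = ((A (T + h n) - A (s + h n)) - A T) / h n"
      using sum1 by (simp add: shift A_def)
    also have "\<dots> = (A (T + h n) - A T) / h n - (A (s + h n) - A s) / h n"
      by (simp add: A_def diff_divide_distrib)
    finally show ?thesis .
  qed
  have "(\<lambda>n. integral {s..T} (\<lambda>t. (c (t + h n) - c t) / h n)) \<longlonglongrightarrow> c T - c s"
    unfolding eq by (intro tendsto_diff A_der) (use sT in auto)
  then have "integral {s..T} g = c T - c s" using conv(2) LIMSEQ_unique by blast
  then have g: "(g has_integral a T - a s) {s..T}"
    using conv(1) sT by (simp add: has_integral_integral c_def)
  show ?thesis
    by (rule has_integral_spike_finite[OF _ _ g, of "{T}"]) (auto simp: g_def)
qed

text \<open>Only an inequality, because \<open>ennreal\<close> truncates negative values to 0 and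
  the right-hand side therefore integrates the positive part.\<close>

lemma ennreal_integral_le_nn_integral:
  assumes "integrable M (h :: 'a \<Rightarrow> real)"
  shows "ennreal (integral\<^sup>L M h) \<le> (\<integral>\<^sup>+x. ennreal (h x) \<partial>M)"
proof -
  have "ennreal (integral\<^sup>L M h) \<le> ennreal (integral\<^sup>L M (\<lambda>x. max 0 (h x)))"
    by (intro ennreal_leI integral_mono) (use assms in auto)
  also have "\<dots> = (\<integral>\<^sup>+x. ennreal (max 0 (h x)) \<partial>M)"
    by (rule nn_integral_eq_integral[symmetric]) (use assms in auto)
  also have "\<dots> = (\<integral>\<^sup>+x. ennreal (h x) \<partial>M)"
    by (intro nn_integral_cong) (simp add: max_def ennreal_neg)
  finally show ?thesis .
qed

lemma ennreal_add_le: "ennreal (a + b) \<le> ennreal a + ennreal b"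
proof (cases "0 \<le> a \<and> 0 \<le> b")
  case True then show ?thesis by (simp add: ennreal_plus)
next
  case False
  have "ennreal (a + b) \<le> max (ennreal a) (ennreal b)"
    using False by (cases "0 \<le> a") (auto intro!: ennreal_leI simp: le_max_iff_disj)
  also have "\<dots> \<le> ennreal a + ennreal b" by simp
  finally show ?thesis .
qed

section \<open>Time regularity of the classical solution\<close>

context classical_solution
begin

lemma B_nonneg: "0 \<le> B"
  using w_bound[of 0 1] T_pos by simp

text \<open>A bound for the Hamiltonian along \<open>w\<close>, and therefore the Lipschitz constant
  of \<open>w\<close> in time.\<close>

definition CH :: real where "CH = 2 * Mq * B + Cf"

lemma CH_nonneg: "0 \<le> CH"
  using Mq_nonneg B_nonneg Cf_nonneg by (simp add: CH_def)

lemma H_w_le: "t \<in> {0..T} \<Longrightarrow> i \<in> states \<Longrightarrow> \<bar>H t i (w t)\<bar> \<le> CH"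
  unfolding CH_def by (rule hamiltonian_abs_le) (use w_bound mem_nbrsD in auto)

lemma w_lipschitz:
  assumes "i \<in> states" "t \<in> {0..T}" "t' \<in> {0..T}"
  shows "\<bar>w t i - w t' i\<bar> \<le> CH * \<bar>t - t'\<bar>"
  using field_differentiable_bound[of "{0..T}" "\<lambda>t. w t i" "\<lambda>t. - H t i (w t)" CH t t']
    w_deriv H_w_le assms by simp

lemma w_difference_quotient:
  assumes t: "t \<in> {0..<T}" and i: "i \<in> states" and d: "\<And>n. d n \<in> {0<..T - t}" "d \<longlonglongrightarrow> 0"
  shows "(\<lambda>n. (w (t + d n) i - w t i) / d n) \<longlonglongrightarrow> - H t i (w t)"
proof -
  have "((\<lambda>y. (w y i - w t i) / (y - t)) \<longlongrightarrow> - H t i (w t)) (at t within {0..T})"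
    using w_deriv[of t i] t i by (simp add: has_field_derivative_iff)
  moreover have "filterlim (\<lambda>n. t + d n) (at t within {0..T}) sequentially"
    unfolding filterlim_at
  proof
    show "\<forall>\<^sub>F n in sequentially. t + d n \<in> {0..T} \<and> t + d n \<noteq> t"
    proof (rule always_eventually, rule allI)
      fix n show "t + d n \<in> {0..T} \<and> t + d n \<noteq> t" using d(1)[of n] t by auto
    qed
    show "(\<lambda>n. t + d n) \<longlonglongrightarrow> t" using tendsto_add[OF tendsto_const d(2), of t] by simp
  qed
  ultimately have "(\<lambda>n. (w (t + d n) i - w t i) / (t + d n - t)) \<longlonglongrightarrow> - H t i (w t)"
    by (rule filterlim_compose)
  then show ?thesis by simp
qed

end

text \<open>The bound is uniform in \<open>l\<close>, so a series over all starting states can be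
  dominated with one constant.\<close>

lemma card_nbrs: "card (insert l (nbrs K l)) \<le> 2 * K + 2"
proof -
  have "card (insert l (nbrs K l)) \<le> card {l - K..l + K}"
    by (rule card_mono) (auto simp: nbrs_def)
  then show ?thesis by simp
qed

section \<open>The right derivative of the mean along a control\<close>

context controlled_process
begin

text \<open>The time derivative of \<open>w\<close> plus the generator of the chosen action. Since
  \<open>H\<close> is an infimum, \<open>- drift\<close> is at most the running cost, and it equals
  the cost up to the suboptimality of the action.\<close>

definition drift :: "real \<Rightarrow> 'w \<Rightarrow> real" where
  "drift t \<omega> = - H t (\<Lambda> t \<omega>) (w t) + generator q (\<mu> t \<omega>) (w t) (\<Lambda> t \<omega>)"

definition mean :: "real \<Rightarrow> real" where
  "mean t = expectation (\<lambda>\<omega>. w t (\<Lambda> t \<omega>))"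

lemma time_mem: "t \<in> {s..T} \<Longrightarrow> t \<in> {0..T}"
  using s_mem by auto

text \<open>For a fixed state the drift is built from continuous functions of time and rates of the
  action. The random state is then inserted as one of countably many cases.\<close>

lemma drift_joint: "(\<lambda>(t, \<omega>). drift t \<omega>) \<in> borel_measurable (restrict_space borel {s..T} \<Otimes>\<^sub>M M)"
proof -
  let ?P = "restrict_space borel {s..T} \<Otimes>\<^sub>M M"
  have sp: "space ?P = {s..T} \<times> space M" by (simp add: space_pair_measure space_restrict_space)
  have time: "h \<circ> fst \<in> borel_measurable ?P" if "continuous_on {0..T} h" for h :: "real \<Rightarrow> real"
  proof -
    have "h \<in> borel_measurable (restrict_space borel {s..T})"
      by (rule borel_measurable_continuous_on_restrict[OF continuous_on_subset[OF that]])
        (use s_mem in auto)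
    then show ?thesis unfolding o_def by (rule measurable_compose[OF measurable_fst])
  qed
  have l_meas: "(\<lambda>p. - H (fst p) l (w (fst p)) + generator q (\<mu> (fst p) (snd p)) (w (fst p)) l) \<in> borel_measurable ?P"
    if l: "l \<in> states" for l
  proof -
    have "(\<lambda>p. - H (fst p) l (w (fst p)) + (\<Sum>j\<in>nbrs K l. q l j (\<mu> (fst p) (snd p)) * (w (fst p) j - w (fst p) l)))
        \<in> borel_measurable ?P"
    proof (rule borel_measurable_add[OF borel_measurable_uminus borel_measurable_sum],
        rule_tac [2] borel_measurable_times, rule_tac [3] borel_measurable_diff)
      show "(\<lambda>p. H (fst p) l (w (fst p))) \<in> borel_measurable ?P"
        using time[OF H_w_continuous[OF l]] by (simp add: o_def)
      show "(\<lambda>p. w (fst p) l) \<in> borel_measurable ?P" for j :: nat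
        using time[OF w_continuous[OF l]] by (simp add: o_def)
      fix j assume j: "j \<in> nbrs K l"
      show "(\<lambda>p. w (fst p) j) \<in> borel_measurable ?P"
        using time[OF w_continuous[OF mem_nbrsD(1)[OF j]]] by (simp add: o_def)
      show "(\<lambda>p. q l j (\<mu> (fst p) (snd p))) \<in> borel_measurable ?P"
        using measurable_compose[OF \<mu>_joint q_meas[OF l mem_nbrsD(1)[OF j]]] by (simp add: split_beta)
    qed
    moreover have "- H (fst p) l (w (fst p)) + generator q (\<mu> (fst p) (snd p)) (w (fst p)) l
        = - H (fst p) l (w (fst p)) + (\<Sum>j\<in>nbrs K l. q l j (\<mu> (fst p) (snd p)) * (w (fst p) j - w (fst p) l))"
      if "p \<in> space ?P" for p
    proof -
      have "fst p \<in> {s..T} \<and> snd p \<in> space M" using that unfolding sp mem_Times_iff .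
      then have "\<mu> (fst p) (snd p) \<in> prob_measures U" using \<mu>_mem by blast
      then show ?thesis by (simp only: generator_eq_sum[OF l])
    qed
    ultimately show ?thesis
      using measurable_cong[of ?P "\<lambda>p. - H (fst p) l (w (fst p)) + generator q (\<mu> (fst p) (snd p)) (w (fst p)) l"
        "\<lambda>p. - H (fst p) l (w (fst p)) + (\<Sum>j\<in>nbrs K l. q l j (\<mu> (fst p) (snd p)) * (w (fst p) j - w (fst p) l))" borel]
      by blast
  qed
  have "(\<lambda>(t, \<omega>). \<Lambda> t \<omega>) \<in> ?P \<rightarrow>\<^sub>M count_space states"
    by (rule cadlag_jointly_measurable[OF \<Lambda>_meas \<Lambda>_cadlag]) (use s_mem in auto)
  then have X: "(\<lambda>p. \<Lambda> (fst p) (snd p)) \<in> ?P \<rightarrow>\<^sub>M count_space states" by (simp add: split_beta)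
  have "(\<lambda>p. - H (fst p) (\<Lambda> (fst p) (snd p)) (w (fst p))
      + generator q (\<mu> (fst p) (snd p)) (w (fst p)) (\<Lambda> (fst p) (snd p))) \<in> borel_measurable ?P"
    by (rule measurable_compose_countable'[where f = "\<lambda>l p. - H (fst p) l (w (fst p))
        + generator q (\<mu> (fst p) (snd p)) (w (fst p)) l", OF l_meas X countableI_type])
  then show ?thesis by (simp add: split_beta drift_def)
qed

lemma drift_measurable: "t \<in> {s..T} \<Longrightarrow> drift t \<in> borel_measurable M"
  using measurable_compose[OF measurable_Pair1' drift_joint, of t] by (simp add: space_restrict_space)

lemma state_fun_measurable: "t \<in> {s..T} \<Longrightarrow> (\<lambda>\<omega>. h (\<Lambda> t \<omega>) :: real) \<in> borel_measurable M"
  by (rule measurable_compose[OF \<Lambda>_measurable]) auto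

lemma drift_bound: "t \<in> {s..T} \<Longrightarrow> \<omega> \<in> space M \<Longrightarrow> \<bar>drift t \<omega>\<bar> \<le> CH + 2 * Mq * B"
proof -
  assume t: "t \<in> {s..T}" and \<omega>: "\<omega> \<in> space M"
  have "\<bar>generator q (\<mu> t \<omega>) (w t) (\<Lambda> t \<omega>)\<bar> \<le> 2 * Mq * B"
    by (rule generator_abs_le[OF \<Lambda>_states[OF t \<omega>] \<mu>_mem[OF t \<omega>]])
      (use w_bound[OF time_mem[OF t]] \<Lambda>_states[OF t \<omega>] mem_nbrsD in auto)
  then show ?thesis
    using H_w_le[OF time_mem[OF t] \<Lambda>_states[OF t \<omega>]] unfolding drift_def by linarith
qed

lemma state_fun_integrable:
  assumes t: "t \<in> {s..T}" and "\<And>l. l \<in> states \<Longrightarrow> \<bar>h l :: real\<bar> \<le> c"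
  shows "integrable M (\<lambda>\<omega>. h (\<Lambda> t \<omega>))"
  by (rule bounded_integrable[OF state_fun_measurable[OF t]]) (use assms(2) \<Lambda>_states[OF t] in blast)

lemma in_state_0: "t \<in> {s..T} \<Longrightarrow> l \<notin> states \<Longrightarrow> in_state t l = (\<lambda>_. 0)"
  using \<Lambda>_states[of t] by (auto simp: in_state_def indicator_def fun_eq_iff)

lemma in_state_integrable:
  assumes t: "t \<in> {s..T}" and h: "h \<in> borel_measurable M" "\<And>\<omega>. \<omega> \<in> space M \<Longrightarrow> \<bar>h \<omega> :: real\<bar> \<le> c"
  shows "integrable M (\<lambda>\<omega>. in_state t l \<omega> * h \<omega>)"
proof (rule bounded_integrable[of _ "1 * c"])
  show "(\<lambda>\<omega>. in_state t l \<omega> * h \<omega>) \<in> borel_measurable M"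
    by (rule borel_measurable_times[OF in_state_meas[OF t] h(1)])
  fix \<omega> assume "\<omega> \<in> space M"
  then show "\<bar>in_state t l \<omega> * h \<omega>\<bar> \<le> 1 * c"
    unfolding abs_mult using in_state_bounds[of t l \<omega>] h(2) by (intro mult_mono) auto
qed

definition mean_rate :: "real \<Rightarrow> nat \<Rightarrow> nat \<Rightarrow> real" where
  "mean_rate t l j = expectation (\<lambda>\<omega>. in_state t l \<omega> * q l j (\<mu> t \<omega>))"

text \<open>The contribution of the start \<open>l\<close> to the change of the mean caused by the
  move of the state alone: the time argument of \<open>w\<close> is already
  \<open>t + \<delta>\<close> in both terms.\<close>

definition atom_increment :: "real \<Rightarrow> real \<Rightarrow> nat \<Rightarrow> real" where
  "atom_increment t \<delta> l = expectation (\<lambda>\<omega>. in_state t l \<omega> * (w (t + \<delta>) (\<Lambda> (t + \<delta>) \<omega>) - w (t + \<delta>) l))"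

lemma rate_integrable:
  assumes "t \<in> {s..T}" "l \<in> states" "j \<in> states"
  shows "integrable M (\<lambda>\<omega>. in_state t l \<omega> * q l j (\<mu> t \<omega>))"
  by (rule in_state_integrable[OF assms(1) q_\<mu>_meas[OF assms], where c = Mq])
    (use rate_abs_le[OF assms(2,3)] \<mu>_mem[OF assms(1)] in auto)

lemma in_state_expectation_nonneg: "0 \<le> expectation (in_state t l)"
  by (rule integral_nonneg_AE) (simp add: in_state_bounds)

lemma in_state_int: "t \<in> {s..T} \<Longrightarrow> integrable M (in_state t l)"
  using in_state_integrable[of t "\<lambda>_. 1" 1 l] by simp

lemma mean_rate_le:
  assumes "t \<in> {s..T}" "l \<in> states" "j \<in> states"
  shows "\<bar>mean_rate t l j\<bar> \<le> Mq * expectation (in_state t l)"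
proof -
  have "\<bar>mean_rate t l j\<bar> \<le> expectation (\<lambda>\<omega>. \<bar>in_state t l \<omega> * q l j (\<mu> t \<omega>)\<bar>)"
    unfolding mean_rate_def by (rule integral_abs_bound)
  also have "\<dots> \<le> expectation (\<lambda>\<omega>. in_state t l \<omega> * Mq)"
  proof (rule integral_mono)
    fix \<omega> assume "\<omega> \<in> space M"
    then show "\<bar>in_state t l \<omega> * q l j (\<mu> t \<omega>)\<bar> \<le> in_state t l \<omega> * Mq"
      unfolding abs_mult using rate_abs_le[OF assms(2,3) \<mu>_mem[OF assms(1)]] in_state_bounds[of t l \<omega>]
      by (intro mult_mono) auto
  qed (use rate_integrable[OF assms] in_state_int[OF assms(1)] in auto)
  also have "\<dots> = Mq * expectation (in_state t l)" by simp
  finally show ?thesis .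
qed

lemma joint_state_expectation:
  assumes t: "t \<in> {s..T}" and l: "l \<in> states" and j: "j \<in> states"
  shows "expectation (\<lambda>\<omega>. in_state t l \<omega> * in_state (t + \<delta>) j \<omega>)
    = of_bool (j = l) * expectation (in_state t l) + \<delta> * mean_rate t l j + remainder t \<delta> l j"
proof -
  have "expectation (\<lambda>\<omega>. in_state t l \<omega> * (of_bool (j = l) + q l j (\<mu> t \<omega>) * \<delta>))
      = expectation (\<lambda>\<omega>. in_state t l \<omega> * of_bool (j = l) + (in_state t l \<omega> * q l j (\<mu> t \<omega>)) * \<delta>)"
    by (simp add: algebra_simps)
  also have "\<dots> = expectation (in_state t l) * of_bool (j = l) + mean_rate t l j * \<delta>"
    unfolding mean_rate_def using rate_integrable[OF t l j] in_state_int[OF t]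
    by (subst Bochner_Integration.integral_add) auto
  finally show ?thesis by (simp add: remainder_def algebra_simps)
qed

lemma sum_mean_rate:
  assumes t: "t \<in> {s..T}" and l: "l \<in> states"
  shows "(\<Sum>j\<in>insert l (nbrs K l). mean_rate t l j) = 0"
proof -
  have st: "j \<in> states" if "j \<in> insert l (nbrs K l)" for j using that l mem_nbrsD by auto
  have "(\<Sum>j\<in>insert l (nbrs K l). mean_rate t l j)
      = expectation (\<lambda>\<omega>. \<Sum>j\<in>insert l (nbrs K l). in_state t l \<omega> * q l j (\<mu> t \<omega>))"
    unfolding mean_rate_def
    by (rule Bochner_Integration.integral_sum[symmetric]) (rule rate_integrable[OF t l st])
  also have "\<dots> = expectation (\<lambda>\<omega>. 0)"
  proof (rule Bochner_Integration.integral_cong[OF refl])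
    fix \<omega> assume \<omega>: "\<omega> \<in> space M"
    have "(\<Sum>j\<in>insert l (nbrs K l). q l j (\<mu> t \<omega>)) = 0"
      using sum_rates[OF l \<mu>_mem[OF t \<omega>]] by (subst sum.insert) (auto dest: mem_nbrsD)
    then show "(\<Sum>j\<in>insert l (nbrs K l). in_state t l \<omega> * q l j (\<mu> t \<omega>)) = 0"
      by (simp only: sum_distrib_left[symmetric] mult_zero_right)
  qed
  finally show ?thesis by simp
qed

text \<open>The expansions of the transition probabilities are not uniform in the target state. Since
  the rates in the band sum to zero, the mass that leaves the band is controlled by the
  finitely many remainders inside it.\<close>

lemma atom_increment_expansion:
  assumes t: "t \<in> {s..<T}" and \<delta>: "\<delta> \<in> {0<..T - t}" and l: "l \<in> states"
  defines "v \<equiv> w (t + \<delta>)"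
  shows "\<bar>atom_increment t \<delta> l - (\<delta> * (\<Sum>j\<in>nbrs K l. mean_rate t l j * (v j - v l))
      + (\<Sum>j\<in>nbrs K l. remainder t \<delta> l j * (v j - v l)))\<bar>
    \<le> 2 * B * (\<Sum>j\<in>insert l (nbrs K l). \<bar>remainder t \<delta> l j\<bar>)"
proof -
  let ?N = "nbrs K l" and ?I = "insert l (nbrs K l)"
  have t1: "t \<in> {s..T}" "t + \<delta> \<in> {s..T}" using t \<delta> by auto
  have st: "j \<in> states" if "j \<in> ?I" for j using that l mem_nbrsD by auto
  have v: "\<bar>v j - v l\<bar> \<le> 2 * B" if "j \<in> states" for j
    using w_bound[OF time_mem[OF t1(2)], of j] w_bound[OF time_mem[OF t1(2)], of l] that l by (simp add: v_def)
  define out where "out \<omega> = (of_bool (\<Lambda> (t + \<delta>) \<omega> \<notin> ?I) :: real)" for \<omega>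
  have out_meas: "out \<in> borel_measurable M"
    unfolding out_def by (rule state_fun_measurable[OF t1(2)])
  have v_meas: "(\<lambda>\<omega>. v (\<Lambda> (t + \<delta>) \<omega>) - v l) \<in> borel_measurable M"
    by (rule state_fun_measurable[OF t1(2)])
  define \<rho> where "\<rho> = expectation (\<lambda>\<omega>. in_state t l \<omega> * (out \<omega> * (v (\<Lambda> (t + \<delta>) \<omega>) - v l)))"
  have joint_int: "integrable M (\<lambda>\<omega>. in_state t l \<omega> * in_state (t + \<delta>) j \<omega>)" for j
    by (rule in_state_integrable[OF t1(1) in_state_meas[OF t1(2)], where c = 1])
      (use in_state_bounds in \<open>simp add: abs_of_nonneg\<close>)
  have out_int: "integrable M (\<lambda>\<omega>. in_state t l \<omega> * out \<omega>)"
    by (rule in_state_integrable[OF t1(1) out_meas, where c = 1]) (simp add: out_def)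
  have \<rho>_bound: "\<bar>out \<omega> * (v (\<Lambda> (t + \<delta>) \<omega>) - v l)\<bar> \<le> out \<omega> * (2 * B)" if "\<omega> \<in> space M" for \<omega>
    using v[OF \<Lambda>_states[OF t1(2) that]] by (simp add: out_def)
  have \<rho>_int: "integrable M (\<lambda>\<omega>. in_state t l \<omega> * (out \<omega> * (v (\<Lambda> (t + \<delta>) \<omega>) - v l)))"
  proof (rule in_state_integrable[OF t1(1) borel_measurable_times[OF out_meas v_meas], where c = "2 * B"])
    fix \<omega> assume "\<omega> \<in> space M"
    from \<rho>_bound[OF this] show "\<bar>out \<omega> * (v (\<Lambda> (t + \<delta>) \<omega>) - v l)\<bar> \<le> 2 * B"
      using B_nonneg by (auto simp: out_def of_bool_def split: if_splits)
  qed
  have in_eq: "in_state (t + \<delta>) j \<omega> = of_bool (\<Lambda> (t + \<delta>) \<omega> = j)" if "\<omega> \<in> space M" for j \<omega>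
    using that by (simp add: in_state_def)
  \<comment> \<open>The target \<open>l\<close> contributes zero, so the sum runs over the
    neighbours while \<open>out\<close> marks the complement of neighbours and
    \<open>l\<close>.\<close>
  have "in_state t l \<omega> * (v (\<Lambda> (t + \<delta>) \<omega>) - v l)
      = (\<Sum>j\<in>?N. (in_state t l \<omega> * in_state (t + \<delta>) j \<omega>) * (v j - v l))
        + in_state t l \<omega> * (out \<omega> * (v (\<Lambda> (t + \<delta>) \<omega>) - v l))" if \<omega>: "\<omega> \<in> space M" for \<omega>
  proof -
    have "(\<Sum>j\<in>?N. (in_state t l \<omega> * in_state (t + \<delta>) j \<omega>) * (v j - v l))
        = (\<Sum>j\<in>?N. if \<Lambda> (t + \<delta>) \<omega> = j then in_state t l \<omega> * (v j - v l) else 0)"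
      by (rule sum.cong) (auto simp: in_eq[OF \<omega>])
    also have "\<dots> = (if \<Lambda> (t + \<delta>) \<omega> \<in> ?N then in_state t l \<omega> * (v (\<Lambda> (t + \<delta>) \<omega>) - v l) else 0)"
      by simp
    finally show ?thesis by (auto simp: out_def)
  qed
  then have "atom_increment t \<delta> l = expectation (\<lambda>\<omega>.
      (\<Sum>j\<in>?N. (in_state t l \<omega> * in_state (t + \<delta>) j \<omega>) * (v j - v l))
        + in_state t l \<omega> * (out \<omega> * (v (\<Lambda> (t + \<delta>) \<omega>) - v l)))"
    unfolding atom_increment_def v_def[symmetric] by (intro Bochner_Integration.integral_cong) auto
  also have "\<dots> = (\<Sum>j\<in>?N. expectation (\<lambda>\<omega>. in_state t l \<omega> * in_state (t + \<delta>) j \<omega>) * (v j - v l)) + \<rho>"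
    unfolding \<rho>_def using joint_int \<rho>_int by (subst Bochner_Integration.integral_add) auto
  also have "(\<Sum>j\<in>?N. expectation (\<lambda>\<omega>. in_state t l \<omega> * in_state (t + \<delta>) j \<omega>) * (v j - v l))
      = (\<Sum>j\<in>?N. (\<delta> * mean_rate t l j + remainder t \<delta> l j) * (v j - v l))"
  proof (rule sum.cong[OF refl])
    fix j assume j: "j \<in> ?N"
    show "expectation (\<lambda>\<omega>. in_state t l \<omega> * in_state (t + \<delta>) j \<omega>) * (v j - v l)
        = (\<delta> * mean_rate t l j + remainder t \<delta> l j) * (v j - v l)"
      using joint_state_expectation[OF t1(1) l mem_nbrsD(1)[OF j], of \<delta>] mem_nbrsD(2)[OF j] by simp
  qed
  also have "\<dots> = \<delta> * (\<Sum>j\<in>?N. mean_rate t l j * (v j - v l)) + (\<Sum>j\<in>?N. remainder t \<delta> l j * (v j - v l))"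
    by (simp add: sum_distrib_left sum.distrib[symmetric] distrib_right mult.assoc)
  finally have eq: "atom_increment t \<delta> l = \<delta> * (\<Sum>j\<in>?N. mean_rate t l j * (v j - v l))
      + (\<Sum>j\<in>?N. remainder t \<delta> l j * (v j - v l)) + \<rho>" .
  have "\<bar>\<rho>\<bar> \<le> expectation (\<lambda>\<omega>. \<bar>in_state t l \<omega> * (out \<omega> * (v (\<Lambda> (t + \<delta>) \<omega>) - v l))\<bar>)"
    unfolding \<rho>_def by (rule integral_abs_bound)
  also have "\<dots> \<le> expectation (\<lambda>\<omega>. (in_state t l \<omega> * out \<omega>) * (2 * B))"
  proof (rule integral_mono)
    fix \<omega> assume "\<omega> \<in> space M"
    from mult_left_mono[OF \<rho>_bound[OF this] in_state_bounds(1)[of t l \<omega>]]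
    show "\<bar>in_state t l \<omega> * (out \<omega> * (v (\<Lambda> (t + \<delta>) \<omega>) - v l))\<bar> \<le> (in_state t l \<omega> * out \<omega>) * (2 * B)"
      using in_state_bounds(1)[of t l \<omega>] by (simp add: abs_mult mult.assoc)
  qed (use \<rho>_int out_int in auto)
  also have "\<dots> = expectation (\<lambda>\<omega>. in_state t l \<omega> * out \<omega>) * (2 * B)" by simp
  \<comment> \<open>The escaping mass is the full mass minus the mass inside the band; the zeroth
    and first order terms cancel and minus the sum of the remainders is left.\<close>
  also have "expectation (\<lambda>\<omega>. in_state t l \<omega> * out \<omega>)
      = expectation (\<lambda>\<omega>. in_state t l \<omega> - (\<Sum>j\<in>?I. in_state t l \<omega> * in_state (t + \<delta>) j \<omega>))"
  proof (rule Bochner_Integration.integral_cong[OF refl])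
    fix \<omega> assume \<omega>: "\<omega> \<in> space M"
    have "(\<Sum>j\<in>?I. in_state t l \<omega> * in_state (t + \<delta>) j \<omega>)
        = (\<Sum>j\<in>?I. if \<Lambda> (t + \<delta>) \<omega> = j then in_state t l \<omega> else 0)"
      by (rule sum.cong) (auto simp: in_eq[OF \<omega>])
    also have "\<dots> = (if \<Lambda> (t + \<delta>) \<omega> \<in> ?I then in_state t l \<omega> else 0)"
      by (rule sum.delta') simp
    finally show "in_state t l \<omega> * out \<omega> = in_state t l \<omega> - (\<Sum>j\<in>?I. in_state t l \<omega> * in_state (t + \<delta>) j \<omega>)"
      by (simp only: out_def) auto
  qed
  also have "\<dots> = expectation (in_state t l) - (\<Sum>j\<in>?I. expectation (\<lambda>\<omega>. in_state t l \<omega> * in_state (t + \<delta>) j \<omega>))"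
    by (subst Bochner_Integration.integral_diff[OF in_state_int[OF t1(1)] Bochner_Integration.integrable_sum[OF joint_int]],
      subst Bochner_Integration.integral_sum[OF joint_int]) (rule refl)
  also have "(\<Sum>j\<in>?I. expectation (\<lambda>\<omega>. in_state t l \<omega> * in_state (t + \<delta>) j \<omega>))
      = (\<Sum>j\<in>?I. (if j = l then expectation (in_state t l) else 0) + \<delta> * mean_rate t l j + remainder t \<delta> l j)"
    by (rule sum.cong[OF refl], subst joint_state_expectation[OF t1(1) l st]) auto
  also have "\<dots> = expectation (in_state t l) + \<delta> * (\<Sum>j\<in>?I. mean_rate t l j) + (\<Sum>j\<in>?I. remainder t \<delta> l j)"
    by (simp only: sum.distrib sum_distrib_left[symmetric]) (simp add: sum.delta')
  also have "\<dots> = expectation (in_state t l) + (\<Sum>j\<in>?I. remainder t \<delta> l j)"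
    by (simp only: sum_mean_rate[OF t1(1) l])
  finally have "\<bar>\<rho>\<bar> \<le> - (\<Sum>j\<in>?I. remainder t \<delta> l j) * (2 * B)" by simp
  also have "\<dots> \<le> (\<Sum>j\<in>?I. \<bar>remainder t \<delta> l j\<bar>) * (2 * B)"
    using sum_abs[of "remainder t \<delta> l" ?I] B_nonneg by (intro mult_right_mono) linarith+
  finally show ?thesis unfolding eq by (simp add: mult.commute)
qed

lemma atom_increment_limit:
  assumes t: "t \<in> {s..<T}" and l: "l \<in> states" and d: "\<And>n. d n \<in> {0<..T - t}" "d \<longlonglongrightarrow> 0"
    and rem: "\<And>j. j \<in> states \<Longrightarrow> (\<lambda>n. remainder t (d n) l j / d n) \<longlonglongrightarrow> 0"
  shows "(\<lambda>n. atom_increment t (d n) l / d n)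
    \<longlonglongrightarrow> expectation (\<lambda>\<omega>. in_state t l \<omega> * generator q (\<mu> t \<omega>) (w t) l)"
proof -
  let ?N = "nbrs K l" and ?I = "insert l (nbrs K l)"
  have t1: "t \<in> {s..T}" using t by auto
  have st: "j \<in> states" if "j \<in> ?I" for j using that l mem_nbrsD by auto
  have w_lim: "(\<lambda>n. w (t + d n) j) \<longlonglongrightarrow> w t j" if "j \<in> states" for j
  proof (rule continuous_on_tendsto_compose[OF w_continuous[OF that]])
    show "(\<lambda>n. t + d n) \<longlonglongrightarrow> t" using tendsto_add[OF tendsto_const d(2), of t] by simp
    show "t \<in> {0..T}" by (rule time_mem[OF t1])
    show "\<forall>\<^sub>F n in sequentially. t + d n \<in> {0..T}"
    proof (rule always_eventually, rule allI)
      fix n show "t + d n \<in> {0..T}" using d(1)[of n] time_mem[OF t1] by auto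
    qed
  qed
  let ?main = "\<lambda>n. (\<Sum>j\<in>?N. mean_rate t l j * (w (t + d n) j - w (t + d n) l))
      + (\<Sum>j\<in>?N. remainder t (d n) l j / d n * (w (t + d n) j - w (t + d n) l))"
  let ?err = "\<lambda>n. 2 * B * (\<Sum>j\<in>?I. \<bar>remainder t (d n) l j / d n\<bar>)"
  have "?main \<longlonglongrightarrow> (\<Sum>j\<in>?N. mean_rate t l j * (w t j - w t l)) + (\<Sum>j\<in>?N. 0 * (w t j - w t l))"
    by (intro tendsto_add tendsto_sum tendsto_mult tendsto_diff tendsto_const w_lim rem) (use st in auto)
  then have main: "?main \<longlonglongrightarrow> (\<Sum>j\<in>?N. mean_rate t l j * (w t j - w t l))" by simp
  have "?err \<longlonglongrightarrow> 2 * B * (\<Sum>j\<in>?I. \<bar>0\<bar>)"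
    by (intro tendsto_mult tendsto_sum tendsto_const tendsto_rabs rem st)
  then have err: "?err \<longlonglongrightarrow> 0" by simp
  have "(\<lambda>n. atom_increment t (d n) l / d n - ?main n) \<longlonglongrightarrow> 0"
  proof (rule Lim_null_comparison[OF _ err], rule always_eventually, rule allI)
    fix n
    have dn: "d n > 0" using d(1)[of n] by simp
    have "atom_increment t (d n) l / d n - ?main n
        = (atom_increment t (d n) l - (d n * (\<Sum>j\<in>?N. mean_rate t l j * (w (t + d n) j - w (t + d n) l))
      + (\<Sum>j\<in>?N. remainder t (d n) l j * (w (t + d n) j - w (t + d n) l)))) / d n"
      using dn by (simp add: diff_divide_distrib add_divide_distrib sum_divide_distrib)
    then have "\<bar>atom_increment t (d n) l / d n - ?main n\<bar>
        = \<bar>atom_increment t (d n) l - (d n * (\<Sum>j\<in>?N. mean_rate t l j * (w (t + d n) j - w (t + d n) l))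
      + (\<Sum>j\<in>?N. remainder t (d n) l j * (w (t + d n) j - w (t + d n) l)))\<bar> / d n"
      using dn by (simp only: abs_divide abs_of_pos)
    also have "\<dots> \<le> (2 * B * (\<Sum>j\<in>?I. \<bar>remainder t (d n) l j\<bar>)) / d n"
      by (rule divide_right_mono[OF atom_increment_expansion[OF t d(1)[of n] l]]) (use dn in simp)
    also have "\<dots> = ?err n"
      using dn by (simp only: sum_divide_distrib[symmetric] abs_divide abs_of_pos times_divide_eq_right)
    finally show "norm (atom_increment t (d n) l / d n - ?main n) \<le> ?err n" by simp
  qed
  from tendsto_add[OF this main]
  have lim: "(\<lambda>n. atom_increment t (d n) l / d n) \<longlonglongrightarrow> (\<Sum>j\<in>?N. mean_rate t l j * (w t j - w t l))"
    by simp
  have "(\<Sum>j\<in>?N. mean_rate t l j * (w t j - w t l))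
      = expectation (\<lambda>\<omega>. \<Sum>j\<in>?N. in_state t l \<omega> * q l j (\<mu> t \<omega>) * (w t j - w t l))"
    unfolding mean_rate_def using rate_integrable[OF t1 l st]
    by (subst Bochner_Integration.integral_sum) auto
  also have "\<dots> = expectation (\<lambda>\<omega>. in_state t l \<omega> * generator q (\<mu> t \<omega>) (w t) l)"
  proof (rule Bochner_Integration.integral_cong[OF refl])
    fix \<omega> assume \<omega>: "\<omega> \<in> space M"
    show "(\<Sum>j\<in>?N. in_state t l \<omega> * q l j (\<mu> t \<omega>) * (w t j - w t l))
        = in_state t l \<omega> * generator q (\<mu> t \<omega>) (w t) l"
      by (simp only: generator_eq_sum[OF l \<mu>_mem[OF t1 \<omega>]] sum_distrib_left mult.assoc)
  qed
  finally show ?thesis using lim by simp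
qed

text \<open>The factor \<open>expectation (in_state t l)\<close> sums to 1 over \<open>l\<close>,
  which yields the dominating series. In the constant, \<open>2 * B\<close> bounds differences of
  \<open>w\<close>, \<open>2 * real K + 2\<close> the number of targets, and \<open>C\<close> occurs
  twice: for the remainders inside the band and for the mass that leaves it.\<close>

lemma atom_increment_bound:
  assumes C: "0 \<le> C" "\<And>j. j \<in> states \<Longrightarrow> \<bar>remainder t \<delta> l j\<bar> \<le> C * \<delta> * expectation (in_state t l)"
    and t: "t \<in> {s..<T}" and \<delta>: "\<delta> \<in> {0<..T - t}" and l: "l \<in> states"
  shows "\<bar>atom_increment t \<delta> l\<bar> \<le> 2 * B * (2 * real K + 2) * (Mq + 2 * C) * \<delta> * expectation (in_state t l)"
proof -
  let ?N = "nbrs K l" and ?I = "insert l (nbrs K l)" and ?P = "expectation (in_state t l)"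
  let ?c = "2 * real K + 2"
  have t1: "t \<in> {s..T}" "t + \<delta> \<in> {s..T}" using t \<delta> by auto
  have \<delta>0: "0 < \<delta>" using \<delta> by simp
  have P0: "0 \<le> ?P" by (rule in_state_expectation_nonneg)
  have st: "j \<in> states" if "j \<in> ?I" for j using that l mem_nbrsD by auto
  have cI: "real (card ?I) \<le> ?c" using card_nbrs[of l K] by linarith
  have cN: "real (card ?N) \<le> ?c" using cI card_mono[of ?I ?N] by (simp add: subset_insertI)
  define v where "v = w (t + \<delta>)"
  have v: "\<bar>v j - v l\<bar> \<le> 2 * B" if "j \<in> states" for j
    using w_bound[OF time_mem[OF t1(2)], of j] w_bound[OF time_mem[OF t1(2)], of l] that l by (simp add: v_def)
  have s1: "\<bar>\<Sum>j\<in>?N. mean_rate t l j * (v j - v l)\<bar> \<le> ?c * ((Mq * ?P) * (2 * B))"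
  proof -
    have "\<bar>\<Sum>j\<in>?N. mean_rate t l j * (v j - v l)\<bar> \<le> (\<Sum>j\<in>?N. \<bar>mean_rate t l j * (v j - v l)\<bar>)"
      by (rule sum_abs)
    also have "\<dots> \<le> (\<Sum>j\<in>?N. (Mq * ?P) * (2 * B))"
      unfolding abs_mult
      by (rule sum_mono, rule mult_mono) (use mean_rate_le[OF t1(1) l] v st Mq_nonneg P0 in auto)
    also have "\<dots> = real (card ?N) * ((Mq * ?P) * (2 * B))" by simp
    also have "\<dots> \<le> ?c * ((Mq * ?P) * (2 * B))"
      by (rule mult_right_mono[OF cN]) (use Mq_nonneg P0 B_nonneg in simp)
    finally show ?thesis .
  qed
  have s2: "\<bar>\<Sum>j\<in>?N. remainder t \<delta> l j * (v j - v l)\<bar> \<le> ?c * ((C * \<delta> * ?P) * (2 * B))"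
  proof -
    have "\<bar>\<Sum>j\<in>?N. remainder t \<delta> l j * (v j - v l)\<bar> \<le> (\<Sum>j\<in>?N. \<bar>remainder t \<delta> l j * (v j - v l)\<bar>)"
      by (rule sum_abs)
    also have "\<dots> \<le> (\<Sum>j\<in>?N. (C * \<delta> * ?P) * (2 * B))"
      unfolding abs_mult
      by (rule sum_mono, rule mult_mono) (use C v st P0 \<delta>0 in auto)
    also have "\<dots> = real (card ?N) * ((C * \<delta> * ?P) * (2 * B))" by simp
    also have "\<dots> \<le> ?c * ((C * \<delta> * ?P) * (2 * B))"
      by (rule mult_right_mono[OF cN]) (use C P0 B_nonneg \<delta>0 in simp)
    finally show ?thesis .
  qed
  have s3: "2 * B * (\<Sum>j\<in>?I. \<bar>remainder t \<delta> l j\<bar>) \<le> 2 * B * (?c * (C * \<delta> * ?P))"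
  proof (rule mult_left_mono)
    have "(\<Sum>j\<in>?I. \<bar>remainder t \<delta> l j\<bar>) \<le> (\<Sum>j\<in>?I. C * \<delta> * ?P)"
      by (rule sum_mono) (use C st in auto)
    also have "\<dots> = real (card ?I) * (C * \<delta> * ?P)" by (simp only: sum_constant)
    also have "\<dots> \<le> ?c * (C * \<delta> * ?P)"
      by (rule mult_right_mono[OF cI]) (use C P0 \<delta>0 in simp)
    finally show "(\<Sum>j\<in>?I. \<bar>remainder t \<delta> l j\<bar>) \<le> ?c * (C * \<delta> * ?P)" .
  qed (use B_nonneg in simp)
  have s1': "\<bar>\<delta> * (\<Sum>j\<in>?N. mean_rate t l j * (v j - v l))\<bar> \<le> \<delta> * (?c * ((Mq * ?P) * (2 * B)))"
    unfolding abs_mult using s1 \<delta>0 by simp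
  have "\<bar>atom_increment t \<delta> l\<bar> \<le> \<delta> * (?c * ((Mq * ?P) * (2 * B))) + ?c * ((C * \<delta> * ?P) * (2 * B))
      + 2 * B * (?c * (C * \<delta> * ?P))"
    using atom_increment_expansion[OF t \<delta> l, folded v_def] s1' s2 s3 by linarith
  also have "\<dots> = 2 * B * ?c * (Mq + 2 * C) * \<delta> * ?P" by (simp add: algebra_simps)
  finally show ?thesis .
qed

lemma generator_process_measurable:
  assumes "t \<in> {s..T}"
  shows "(\<lambda>\<omega>. generator q (\<mu> t \<omega>) (w t) (\<Lambda> t \<omega>)) \<in> borel_measurable M"
proof -
  have "(\<lambda>\<omega>. drift t \<omega> + H t (\<Lambda> t \<omega>) (w t)) \<in> borel_measurable M"
    by (intro borel_measurable_add drift_measurable state_fun_measurable assms)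
  then show ?thesis by (simp add: drift_def)
qed

lemma generator_process_bound:
  assumes t: "t \<in> {s..T}" and \<omega>: "\<omega> \<in> space M"
  shows "\<bar>generator q (\<mu> t \<omega>) (w t) (\<Lambda> t \<omega>)\<bar> \<le> 2 * Mq * B"
  by (rule generator_abs_le[OF \<Lambda>_states[OF t \<omega>] \<mu>_mem[OF t \<omega>]])
    (use w_bound[OF time_mem[OF t]] \<Lambda>_states[OF t \<omega>] mem_nbrsD in auto)

text \<open>First the state moves with the time argument of \<open>w\<close> frozen at
  \<open>t + \<delta>\<close>, then time moves with the state frozen at its value at
  \<open>t\<close>. The first part is split over the starting states.\<close>

lemma mean_increment:
  assumes t: "t \<in> {s..<T}" and \<delta>: "\<delta> \<in> {0<..T - t}"
  shows "mean (t + \<delta>) - mean t = (\<Sum>l. atom_increment t \<delta> l)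
      + expectation (\<lambda>\<omega>. w (t + \<delta>) (\<Lambda> t \<omega>) - w t (\<Lambda> t \<omega>))"
    and "summable (atom_increment t \<delta>)"
proof -
  have t1: "t \<in> {s..T}" "t + \<delta> \<in> {s..T}" using t \<delta> by auto
  have i1: "integrable M (\<lambda>\<omega>. w (t + \<delta>) (\<Lambda> (t + \<delta>) \<omega>))"
    by (rule state_fun_integrable[OF t1(2) w_bound[OF time_mem[OF t1(2)]]])
  have i2: "integrable M (\<lambda>\<omega>. w (t + \<delta>) (\<Lambda> t \<omega>))"
    by (rule state_fun_integrable[OF t1(1) w_bound[OF time_mem[OF t1(2)]]])
  have i3: "integrable M (\<lambda>\<omega>. w t (\<Lambda> t \<omega>))"
    by (rule state_fun_integrable[OF t1(1) w_bound[OF time_mem[OF t1(1)]]])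
  let ?Z = "\<lambda>\<omega>. w (t + \<delta>) (\<Lambda> (t + \<delta>) \<omega>) - w (t + \<delta>) (\<Lambda> t \<omega>)"
  have "(\<lambda>l. expectation (\<lambda>\<omega>. indicator {\<omega> \<in> space M. \<Lambda> t \<omega> = l} \<omega> * ?Z \<omega>)) sums expectation ?Z"
    by (rule expectation_partition_sums[OF _ \<Lambda>_measurable[OF t1(1)]]) (use i1 i2 in simp)
  moreover have "expectation (\<lambda>\<omega>. indicator {\<omega> \<in> space M. \<Lambda> t \<omega> = l} \<omega> * ?Z \<omega>) = atom_increment t \<delta> l" for l
    unfolding atom_increment_def in_state_def
    by (rule Bochner_Integration.integral_cong) (auto simp: indicator_def)
  ultimately have sums: "atom_increment t \<delta> sums expectation ?Z" by simp
  then show "summable (atom_increment t \<delta>)" by (rule sums_summable)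
  show "mean (t + \<delta>) - mean t = (\<Sum>l. atom_increment t \<delta> l)
      + expectation (\<lambda>\<omega>. w (t + \<delta>) (\<Lambda> t \<omega>) - w t (\<Lambda> t \<omega>))"
    using i1 i2 i3 unfolding sums_unique[OF sums, symmetric] mean_def by simp
qed

lemma in_state_expectation_sums: "t \<in> {s..T} \<Longrightarrow> (\<lambda>l. expectation (in_state t l)) sums 1"
  using expectation_partition_sums[OF integrable_const[of 1] \<Lambda>_measurable, of t]
  by (simp add: in_state_def[abs_def] prob_space)

lemma atom_increment_0: "t \<in> {s..T} \<Longrightarrow> l \<notin> states \<Longrightarrow> atom_increment t \<delta> l = 0"
  by (simp add: atom_increment_def in_state_0)

lemma w_increment_le:
  assumes t: "t \<in> {s..<T}" and \<delta>: "\<delta> \<in> {0<..T - t}" and \<omega>: "\<omega> \<in> space M"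
  shows "\<bar>w (t + \<delta>) (\<Lambda> t \<omega>) - w t (\<Lambda> t \<omega>)\<bar> \<le> CH * \<delta>"
proof -
  have t1: "t \<in> {s..T}" "t + \<delta> \<in> {s..T}" using t \<delta> by auto
  show ?thesis
    using w_lipschitz[OF \<Lambda>_states[OF t1(1) \<omega>] time_mem[OF t1(2)] time_mem[OF t1(1)]] \<delta> by simp
qed

lemma mean_increment_bound:
  obtains L where "0 \<le> L"
    "\<And>t \<delta>. t \<in> {s..<T} \<Longrightarrow> \<delta> \<in> {0<..T - t} \<Longrightarrow> \<bar>mean (t + \<delta>) - mean t\<bar> \<le> L * \<delta>"
proof -
  obtain C where C: "0 \<le> C" "\<And>t \<delta> l j. t \<in> {s..<T} \<Longrightarrow> \<delta> \<in> {0<..T - t} \<Longrightarrow> l \<in> states \<Longrightarrow> j \<in> states \<Longrightarrow>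
        \<bar>remainder t \<delta> l j\<bar> \<le> C * \<delta> * expectation (in_state t l)"
    by (rule remainder_expansion) blast
  define C3 where "C3 = 2 * B * (2 * real K + 2) * (Mq + 2 * C)"
  have C3: "0 \<le> C3" using B_nonneg Mq_nonneg C(1) by (simp add: C3_def)
  show ?thesis
  proof (rule that[of "C3 + CH"])
    show "0 \<le> C3 + CH" using C3 CH_nonneg by simp
    fix t \<delta> assume t: "t \<in> {s..<T}" and \<delta>: "\<delta> \<in> {0<..T - t}"
    have t1: "t \<in> {s..T}" "t + \<delta> \<in> {s..T}" using t \<delta> by auto
    have le: "\<bar>atom_increment t \<delta> l\<bar> \<le> C3 * \<delta> * expectation (in_state t l)" for l
    proof (cases "l \<in> states")
      case True
      show ?thesis unfolding C3_def
        by (rule atom_increment_bound[OF C(1) C(2)[OF t \<delta> True] t \<delta> True])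
    next
      case False
      then show ?thesis using C3 \<delta> in_state_expectation_nonneg by (simp add: atom_increment_0[OF t1(1)])
    qed
    have sm: "(\<lambda>l. C3 * \<delta> * expectation (in_state t l)) sums (C3 * \<delta> * 1)"
      by (rule sums_mult[OF in_state_expectation_sums[OF t1(1)]])
    have sa: "summable (\<lambda>l. \<bar>atom_increment t \<delta> l\<bar>)"
      by (rule summable_comparison_test[OF _ sums_summable[OF sm]]) (use le in simp)
    have "\<bar>\<Sum>l. atom_increment t \<delta> l\<bar> \<le> (\<Sum>l. \<bar>atom_increment t \<delta> l\<bar>)"
      by (rule summable_rabs[OF sa])
    also have "\<dots> \<le> C3 * \<delta>"
      using suminf_le[OF le sa sums_summable[OF sm]] sums_unique[OF sm] by simp
    finally have 1: "\<bar>\<Sum>l. atom_increment t \<delta> l\<bar> \<le> C3 * \<delta>" .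
    have i2: "integrable M (\<lambda>\<omega>. w (t + \<delta>) (\<Lambda> t \<omega>))"
      by (rule state_fun_integrable[OF t1(1) w_bound[OF time_mem[OF t1(2)]]])
    have i3: "integrable M (\<lambda>\<omega>. w t (\<Lambda> t \<omega>))"
      by (rule state_fun_integrable[OF t1(1) w_bound[OF time_mem[OF t1(1)]]])
    have "\<bar>expectation (\<lambda>\<omega>. w (t + \<delta>) (\<Lambda> t \<omega>) - w t (\<Lambda> t \<omega>))\<bar>
        \<le> expectation (\<lambda>\<omega>. \<bar>w (t + \<delta>) (\<Lambda> t \<omega>) - w t (\<Lambda> t \<omega>)\<bar>)"
      by (rule integral_abs_bound)
    also have "\<dots> \<le> expectation (\<lambda>\<omega>. CH * \<delta>)"
    proof (rule integral_mono)
      show "integrable M (\<lambda>\<omega>. \<bar>w (t + \<delta>) (\<Lambda> t \<omega>) - w t (\<Lambda> t \<omega>)\<bar>)"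
        using i2 i3 by simp
    qed (use w_increment_le[OF t \<delta>] in auto)
    also have "\<dots> = CH * \<delta>" by (simp add: prob_space)
    finally show "\<bar>mean (t + \<delta>) - mean t\<bar> \<le> (C3 + CH) * \<delta>"
      using 1 mean_increment(1)[OF t \<delta>] by (simp add: distrib_right)
  qed
qed

text \<open>The o(\<delta>) terms are not uniform in the starting state, so Tannery's theorem
  exchanges the limit with the sum over starts. The time part converges by dominated convergence
  with the Lipschitz constant of \<open>w\<close>.\<close>

lemma mean_right_derivative:
  assumes t: "t \<in> {s..<T}" and d: "\<And>n. d n \<in> {0<..T - t}" "d \<longlonglongrightarrow> 0"
  shows "(\<lambda>n. (mean (t + d n) - mean t) / d n) \<longlonglongrightarrow> expectation (drift t)"
proof -
  obtain C where C: "0 \<le> C" "\<And>t \<delta> l j. t \<in> {s..<T} \<Longrightarrow> \<delta> \<in> {0<..T - t} \<Longrightarrow> l \<in> states \<Longrightarrow> j \<in> states \<Longrightarrow>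
        \<bar>remainder t \<delta> l j\<bar> \<le> C * \<delta> * expectation (in_state t l)"
      "\<And>t d l j. t \<in> {s..<T} \<Longrightarrow> (\<And>n. d n \<in> {0<..T - t}) \<Longrightarrow> d \<longlonglongrightarrow> 0 \<Longrightarrow> l \<in> states \<Longrightarrow> j \<in> states \<Longrightarrow>
        (\<lambda>n. remainder t (d n) l j / d n) \<longlonglongrightarrow> 0"
    by (rule remainder_expansion) blast
  have t1: "t \<in> {s..T}" using t by auto
  define C3 where "C3 = 2 * B * (2 * real K + 2) * (Mq + 2 * C)"
  have C3: "0 \<le> C3" using B_nonneg Mq_nonneg C(1) by (simp add: C3_def)
  let ?G = "\<lambda>l. expectation (\<lambda>\<omega>. in_state t l \<omega> * generator q (\<mu> t \<omega>) (w t) l)"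
  have dpos: "d n > 0" for n using d(1)[of n] by simp
  have le: "norm (atom_increment t (d n) l / d n) \<le> C3 * expectation (in_state t l)" for l n
  proof (cases "l \<in> states")
    case True
    have "\<bar>atom_increment t (d n) l\<bar> \<le> C3 * d n * expectation (in_state t l)"
      unfolding C3_def by (rule atom_increment_bound[OF C(1) C(2)[OF t d(1) True] t d(1) True])
    then show ?thesis using dpos[of n] by (simp add: pos_divide_le_eq mult.commute mult.left_commute)
  next
    case False
    then show ?thesis using C3 in_state_expectation_nonneg by (simp add: atom_increment_0[OF t1])
  qed
  have lim: "(\<lambda>n. atom_increment t (d n) l / d n) \<longlonglongrightarrow> ?G l" for l
  proof (cases "l \<in> states")
    case True
    show ?thesis by (rule atom_increment_limit[OF t True d C(3)[OF t d True]])
  qed (simp add: atom_increment_0[OF t1] in_state_0[OF t1])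
  have sm: "summable (\<lambda>l. C3 * expectation (in_state t l))"
    by (rule summable_mult[OF sums_summable[OF in_state_expectation_sums[OF t1]]])
  have "(\<lambda>n. \<Sum>l. atom_increment t (d n) l / d n) \<longlonglongrightarrow> (\<Sum>l. ?G l)"
    using tannerys_theorem[where a = "\<lambda>l n. atom_increment t (d n) l / d n" and b = ?G
        and M = "\<lambda>l. C3 * expectation (in_state t l)" and F = sequentially, OF lim _ sm] le
    by (simp add: always_eventually)
  moreover have "(\<Sum>l. atom_increment t (d n) l / d n) = (\<Sum>l. atom_increment t (d n) l) / d n" for n
    by (rule suminf_divide[OF mean_increment(2)[OF t d(1)]])
  ultimately have jump: "(\<lambda>n. (\<Sum>l. atom_increment t (d n) l) / d n) \<longlonglongrightarrow> (\<Sum>l. ?G l)" by simp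
  let ?gen = "\<lambda>\<omega>. generator q (\<mu> t \<omega>) (w t) (\<Lambda> t \<omega>)"
  have gen_int: "integrable M ?gen"
    by (rule bounded_integrable[OF generator_process_measurable[OF t1] generator_process_bound[OF t1]])
  have "(\<lambda>l. expectation (\<lambda>\<omega>. indicator {\<omega> \<in> space M. \<Lambda> t \<omega> = l} \<omega> * ?gen \<omega>)) sums expectation ?gen"
    by (rule expectation_partition_sums[OF gen_int \<Lambda>_measurable[OF t1]])
  moreover have "expectation (\<lambda>\<omega>. indicator {\<omega> \<in> space M. \<Lambda> t \<omega> = l} \<omega> * ?gen \<omega>) = ?G l" for l
    unfolding in_state_def by (rule Bochner_Integration.integral_cong) (auto simp: indicator_def)
  ultimately have G: "(\<Sum>l. ?G l) = expectation ?gen" using sums_unique by force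
  have time: "(\<lambda>n. expectation (\<lambda>\<omega>. (w (t + d n) (\<Lambda> t \<omega>) - w t (\<Lambda> t \<omega>)) / d n))
      \<longlonglongrightarrow> expectation (\<lambda>\<omega>. - H t (\<Lambda> t \<omega>) (w t))"
  proof (rule integral_dominated_convergence[where w = "\<lambda>_. CH"])
    show "(\<lambda>\<omega>. - H t (\<Lambda> t \<omega>) (w t)) \<in> borel_measurable M"
      by (rule state_fun_measurable[OF t1, of "\<lambda>l. - H t l (w t)"])
    show "(\<lambda>\<omega>. (w (t + d n) (\<Lambda> t \<omega>) - w t (\<Lambda> t \<omega>)) / d n) \<in> borel_measurable M" for n
      by (intro borel_measurable_divide borel_measurable_diff state_fun_measurable[OF t1] borel_measurable_const)
    show "AE \<omega> in M. (\<lambda>n. (w (t + d n) (\<Lambda> t \<omega>) - w t (\<Lambda> t \<omega>)) / d n) \<longlonglongrightarrow> - H t (\<Lambda> t \<omega>) (w t)"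
      by (rule AE_I2, rule w_difference_quotient[OF _ \<Lambda>_states[OF t1] d]) (use t s_mem in auto)
    show "AE \<omega> in M. norm ((w (t + d n) (\<Lambda> t \<omega>) - w t (\<Lambda> t \<omega>)) / d n) \<le> CH" for n
    proof (rule AE_I2)
      fix \<omega> assume "\<omega> \<in> space M"
      from w_increment_le[OF t d(1)[of n] this]
      show "norm ((w (t + d n) (\<Lambda> t \<omega>) - w t (\<Lambda> t \<omega>)) / d n) \<le> CH"
        using dpos[of n] by (simp add: pos_divide_le_eq)
    qed
  qed auto
  have "expectation (drift t) = expectation ?gen + expectation (\<lambda>\<omega>. - H t (\<Lambda> t \<omega>) (w t))"
  proof -
    have "integrable M (\<lambda>\<omega>. - H t (\<Lambda> t \<omega>) (w t))"
      by (rule state_fun_integrable[OF t1, where c = CH]) (use H_w_le[OF time_mem[OF t1]] in auto)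
    from Bochner_Integration.integral_add[OF gen_int this] show ?thesis
      unfolding drift_def[abs_def] by (simp add: add.commute)
  qed
  moreover have "(mean (t + d n) - mean t) / d n = (\<Sum>l. atom_increment t (d n) l) / d n
      + expectation (\<lambda>\<omega>. (w (t + d n) (\<Lambda> t \<omega>) - w t (\<Lambda> t \<omega>)) / d n)" for n
    unfolding mean_increment(1)[OF t d(1)[of n]] by (simp add: add_divide_distrib)
  ultimately show ?thesis using tendsto_add[OF jump time] G by simp
qed

lemma has_integral_mean_drift: "((\<lambda>t. expectation (drift t)) has_integral mean T - mean s) {s..T}"
proof -
  obtain L where L: "0 \<le> L"
    "\<And>t \<delta>. t \<in> {s..<T} \<Longrightarrow> \<delta> \<in> {0<..T - t} \<Longrightarrow> \<bar>mean (t + \<delta>) - mean t\<bar> \<le> L * \<delta>"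
    by (rule mean_increment_bound) blast
  have lt: "\<bar>mean t' - mean t\<bar> \<le> L * (t' - t)" if "t \<in> {s..T}" "t' \<in> {s..T}" "t < t'" for t t'
    using L(2)[of t "t' - t"] that by auto
  show ?thesis
  proof (rule has_integral_right_derivative)
    show "s < T" using s_mem by simp
    fix t t' assume tt: "t \<in> {s..T}" "t' \<in> {s..T}"
    show "\<bar>mean t - mean t'\<bar> \<le> L * \<bar>t - t'\<bar>"
      using lt[OF tt] lt[OF tt(2,1)] by (cases t t' rule: linorder_cases) (auto simp: abs_minus_commute)
  next
    fix t assume t: "t \<in> {s..<T}"
    \<comment> \<open>Steps cut off at \<open>T\<close> are admissible for every \<open>n\<close>,
      and they eventually coincide with \<open>1 / real (Suc n)\<close>.\<close>
    define d where "d n = min T (t + 1 / real (Suc n)) - t" for n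
    have d_mem: "d n \<in> {0<..T - t}" for n using t by (auto simp: d_def min_def)
    have n0: "(\<lambda>n. 1 / real (Suc n)) \<longlonglongrightarrow> 0" by (intro LIMSEQ_Suc lim_1_over_n)
    have ev: "\<forall>\<^sub>F n in sequentially. d n = 1 / real (Suc n)"
    proof -
      have "\<forall>\<^sub>F n in sequentially. 1 / real (Suc n) < T - t"
        using order_tendstoD(2)[OF n0, of "T - t"] t by simp
      then show ?thesis by eventually_elim (auto simp: d_def)
    qed
    have "d \<longlonglongrightarrow> 0"
      by (rule Lim_transform_eventually[OF n0]) (use ev in eventually_elim, simp)
    from mean_right_derivative[OF t d_mem this]
    have "(\<lambda>n. (mean (t + d n) - mean t) / d n) \<longlonglongrightarrow> expectation (drift t)" .
    then show "(\<lambda>n. (mean (min T (t + 1 / real (Suc n))) - mean t) * real (Suc n)) \<longlonglongrightarrow> expectation (drift t)"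
    proof (rule Lim_transform_eventually)
      show "\<forall>\<^sub>F n in sequentially. (mean (t + d n) - mean t) / d n
          = (mean (min T (t + 1 / real (Suc n))) - mean t) * real (Suc n)"
        using ev
      proof eventually_elim
        case (elim n)
        have "t + d n = min T (t + 1 / real (Suc n))" by (simp add: d_def)
        then show ?case unfolding elim by simp
      qed
    qed
  qed
qed



section \<open>Dynkin's formula and the two bounds of the cost\<close>

abbreviation "time_measure \<equiv> restrict_space lborel {s..T}"

lemma emeasure_time: "emeasure time_measure (space time_measure) = ennreal (T - s)"
  using s_mem by (simp add: space_restrict_space emeasure_restrict_space)

lemma finite_time_measure: "finite_measure time_measure"
  by (rule finite_measureI, subst emeasure_time) simp

lemma pair_time: "pair_sigma_finite time_measure M"
  unfolding pair_sigma_finite_def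
  using finite_time_measure by (auto intro: finite_measure.axioms(1) sigma_finite_measure_axioms)

lemma drift_integrable_pair: "integrable (time_measure \<Otimes>\<^sub>M M) (\<lambda>(t, \<omega>). drift t \<omega>)"
proof (rule finite_measure.integrable_const_bound[of _ _ "CH + 2 * Mq * B"])
  show "finite_measure (time_measure \<Otimes>\<^sub>M M)"
    by (rule finite_measure_pair_measure[OF finite_measure_axioms finite_time_measure])
  show "AE x in time_measure \<Otimes>\<^sub>M M. norm (case x of (t, \<omega>) \<Rightarrow> drift t \<omega>) \<le> CH + 2 * Mq * B"
    by (rule AE_I2) (use drift_bound in \<open>auto simp: space_pair_measure space_restrict_space\<close>)
  have "sets (time_measure \<Otimes>\<^sub>M M) = sets (restrict_space borel {s..T} \<Otimes>\<^sub>M M)"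
    by (intro sets_pair_measure_cong sets_restrict_space_cong) simp_all
  from measurable_cong_sets[OF this refl] show "(\<lambda>(t, \<omega>). drift t \<omega>) \<in> borel_measurable (time_measure \<Otimes>\<^sub>M M)"
    using drift_joint by blast
qed

lemma drift_integrable_time:
  assumes "\<omega> \<in> space M"
  shows "integrable time_measure (\<lambda>t. drift t \<omega>)"
proof (rule finite_measure.integrable_const_bound[OF finite_time_measure, of _ "CH + 2 * Mq * B"])
  show "AE t in time_measure. norm (drift t \<omega>) \<le> CH + 2 * Mq * B"
    by (rule AE_I2) (use drift_bound[OF _ assms] in \<open>auto simp: space_restrict_space\<close>)
  show "(\<lambda>t. drift t \<omega>) \<in> borel_measurable time_measure"
    using measurable_compose[OF measurable_Pair2'[OF assms] borel_measurable_integrable[OF drift_integrable_pair]]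
    by simp
qed

definition total_drift :: "'w \<Rightarrow> real" where
  "total_drift \<omega> = (\<integral>t. drift t \<omega> \<partial>time_measure)"

lemma total_drift_integrable: "integrable M total_drift"
  unfolding total_drift_def[abs_def]
  by (rule pair_sigma_finite.integrable_snd[OF pair_time drift_integrable_pair])

lemma mean_s: "mean s = w s i"
proof -
  have "mean s = expectation (\<lambda>\<omega>. w s i)"
    unfolding mean_def
    by (rule integral_cong_AE) (use \<Lambda>_s state_fun_measurable[of s "w s"] s_mem in auto)
  then show ?thesis by (simp add: prob_space)
qed

lemma mean_T: "mean T = expectation (\<lambda>\<omega>. g (\<Lambda> T \<omega>))"
  unfolding mean_def
  by (rule Bochner_Integration.integral_cong) (use w_T \<Lambda>_states[of T] s_mem in auto)

lemma g_integrable: "integrable M (\<lambda>\<omega>. g (\<Lambda> T \<omega>))"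
  by (rule state_fun_integrable[OF _ g_le]) (use s_mem in auto)

text \<open>Fubini moves the expectation inside the time integral; the Lebesgue integral obtained
  agrees with the gauge integral that recovers the mean from its right derivative.\<close>

lemma dynkin: "expectation total_drift = expectation (\<lambda>\<omega>. g (\<Lambda> T \<omega>)) - w s i"
proof -
  have "expectation total_drift = (\<integral>t. expectation (drift t) \<partial>time_measure)"
    unfolding total_drift_def
    by (rule pair_sigma_finite.Fubini_integral[OF pair_time drift_integrable_pair])
  also have "\<dots> = integral {s..T} (\<lambda>t. expectation (drift t))"
  proof -
    have "integrable time_measure (\<lambda>t. expectation (drift t))"
      by (rule pair_sigma_finite.integrable_fst[OF pair_time drift_integrable_pair])
    then have "set_integrable lborel {s..T} (\<lambda>t. expectation (drift t))"
      unfolding set_integrable_def by (simp add: integrable_restrict_space)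
    from set_borel_integral_eq_integral(2)[OF this] show ?thesis
      unfolding set_lebesgue_integral_def by (simp add: integral_restrict_space)
  qed
  also have "\<dots> = mean T - mean s"
    by (rule integral_unique[OF has_integral_mean_drift])
  finally show ?thesis by (simp add: mean_s mean_T)
qed

lemma running_cost_eq:
  "(\<integral>\<^sup>+t\<in>{s..T}. h t \<partial>lborel) = (\<integral>\<^sup>+t. h t \<partial>time_measure)"
  by (simp add: nn_integral_restrict_space)

text \<open>Dynkin's formula combined with \<open>- drift \<le> f\<close>. Since
  \<open>- drift\<close> may be negative, the passage to \<open>ennreal\<close> is made by
  inequalities that survive truncation, and the cost is reached through monotonicity of
  \<open>nn_integral\<close>.\<close>

lemma cost_lower: "ennreal (w s i) \<le> cost M T f g s (\<Lambda>, \<mu>)"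
proof -
  have "ennreal (w s i) = ennreal (expectation (\<lambda>\<omega>. - total_drift \<omega> + g (\<Lambda> T \<omega>)))"
    using total_drift_integrable g_integrable dynkin by simp
  also have "\<dots> \<le> (\<integral>\<^sup>+\<omega>. ennreal (- total_drift \<omega> + g (\<Lambda> T \<omega>)) \<partial>M)"
    by (rule ennreal_integral_le_nn_integral) (use total_drift_integrable g_integrable in auto)
  also have "\<dots> \<le> cost M T f g s (\<Lambda>, \<mu>)"
    unfolding cost_def prod.case running_cost_eq
  proof (rule nn_integral_mono)
    fix \<omega> assume \<omega>: "\<omega> \<in> space M"
    have "ennreal (- total_drift \<omega>) = ennreal (\<integral>t. - drift t \<omega> \<partial>time_measure)"
      by (simp add: total_drift_def)
    also have "\<dots> \<le> (\<integral>\<^sup>+t. ennreal (- drift t \<omega>) \<partial>time_measure)"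
      by (rule ennreal_integral_le_nn_integral) (use drift_integrable_time[OF \<omega>] in simp)
    also have "\<dots> \<le> (\<integral>\<^sup>+t. ennreal (f t (\<Lambda> t \<omega>) (\<mu> t \<omega>)) \<partial>time_measure)"
    proof (intro nn_integral_mono ennreal_leI)
      fix t assume "t \<in> space time_measure"
      then have t: "t \<in> {s..T}" by (simp add: space_restrict_space)
      show "- drift t \<omega> \<le> f t (\<Lambda> t \<omega>) (\<mu> t \<omega>)"
        using hamiltonian_lower[OF \<Lambda>_states[OF t \<omega>] time_mem[OF t] \<mu>_mem[OF t \<omega>], of "w t"]
        unfolding drift_def by linarith
    qed
    finally have "ennreal (- total_drift \<omega>) + ennreal (g (\<Lambda> T \<omega>))
        \<le> (\<integral>\<^sup>+t. ennreal (f t (\<Lambda> t \<omega>) (\<mu> t \<omega>)) \<partial>time_measure) + ennreal (g (\<Lambda> T \<omega>))"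
      by (rule add_right_mono)
    with ennreal_add_le show "ennreal (- total_drift \<omega> + g (\<Lambda> T \<omega>))
        \<le> (\<integral>\<^sup>+t. ennreal (f t (\<Lambda> t \<omega>) (\<mu> t \<omega>)) \<partial>time_measure) + ennreal (g (\<Lambda> T \<omega>))"
      by (rule order_trans)
  qed
  finally show ?thesis .
qed

text \<open>With \<epsilon>-optimal actions the cost lies between 0 and
  \<open>- drift + \<epsilon>\<close>, so no truncation occurs and the nonnegative integrals turn
  into real ones. The sign is recorded as a second claim because \<open>ennreal\<close> alone would
  hide a negative bound.\<close>

lemma cost_upper:
  assumes fnn: "\<And>t i \<mu>. t \<in> {0..T} \<Longrightarrow> i \<in> states \<Longrightarrow> \<mu> \<in> prob_measures U \<Longrightarrow> 0 \<le> f t i \<mu>"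
    and gnn: "\<And>i. i \<in> states \<Longrightarrow> 0 \<le> g i"
    and opt: "\<And>t \<omega>. t \<in> {s..T} \<Longrightarrow> \<omega> \<in> space M \<Longrightarrow>
      generator q (\<mu> t \<omega>) (w t) (\<Lambda> t \<omega>) + f t (\<Lambda> t \<omega>) (\<mu> t \<omega>) \<le> H t (\<Lambda> t \<omega>) (w t) + \<epsilon>"
  shows "cost M T f g s (\<Lambda>, \<mu>) \<le> ennreal (w s i + \<epsilon> * (T - s))" "0 \<le> w s i + \<epsilon> * (T - s)"
proof -
  let ?X = "\<lambda>\<omega>. (- total_drift \<omega> + \<epsilon> * (T - s)) + g (\<Lambda> T \<omega>)"
  have T_mem: "T \<in> {s..T}" using s_mem by simp
  have le: "f t (\<Lambda> t \<omega>) (\<mu> t \<omega>) \<le> - drift t \<omega> + \<epsilon>" "0 \<le> f t (\<Lambda> t \<omega>) (\<mu> t \<omega>)"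
    if "t \<in> {s..T}" "\<omega> \<in> space M" for t \<omega>
    using opt[OF that] fnn[OF time_mem[OF that(1)] \<Lambda>_states[OF that] \<mu>_mem[OF that]]
    unfolding drift_def by linarith+
  have int: "integrable time_measure (\<lambda>t. - drift t \<omega> + \<epsilon>)" if "\<omega> \<in> space M" for \<omega>
    by (rule Bochner_Integration.integrable_add[OF Bochner_Integration.integrable_minus[OF
      drift_integrable_time[OF that]] finite_measure.integrable_const[OF finite_time_measure]])
  have m: "measure time_measure (space time_measure) = T - s"
    unfolding measure_def emeasure_time using s_mem by simp
  have eq: "(\<integral>t. - drift t \<omega> + \<epsilon> \<partial>time_measure) = - total_drift \<omega> + \<epsilon> * (T - s)"
    if "\<omega> \<in> space M" for \<omega>
    using Bochner_Integration.integral_add[OF Bochner_Integration.integrable_minus[OF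
      drift_integrable_time[OF that]] finite_measure.integrable_const[OF finite_time_measure], of \<epsilon>] m
    by (simp add: total_drift_def mult.commute)
  have nn1: "0 \<le> - total_drift \<omega> + \<epsilon> * (T - s)" if "\<omega> \<in> space M" for \<omega>
    unfolding eq[OF that, symmetric]
    by (rule integral_nonneg_AE, rule AE_I2)
      (use le[OF _ that] in \<open>fastforce simp: space_restrict_space\<close>)
  have nn2: "0 \<le> g (\<Lambda> T \<omega>)" if "\<omega> \<in> space M" for \<omega>
    by (rule gnn[OF \<Lambda>_states[OF T_mem that]])
  have X_int: "integrable M ?X" using total_drift_integrable g_integrable by simp
  have X_exp: "expectation ?X = w s i + \<epsilon> * (T - s)"
    using total_drift_integrable g_integrable dynkin by (simp add: prob_space)
  have "cost M T f g s (\<Lambda>, \<mu>) \<le> (\<integral>\<^sup>+\<omega>. ennreal (?X \<omega>) \<partial>M)"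
    unfolding cost_def prod.case running_cost_eq
  proof (rule nn_integral_mono)
    fix \<omega> assume \<omega>: "\<omega> \<in> space M"
    have "(\<integral>\<^sup>+t. ennreal (f t (\<Lambda> t \<omega>) (\<mu> t \<omega>)) \<partial>time_measure)
        \<le> (\<integral>\<^sup>+t. ennreal (- drift t \<omega> + \<epsilon>) \<partial>time_measure)"
      by (intro nn_integral_mono ennreal_leI le \<omega>) (simp add: space_restrict_space)
    also have "\<dots> = ennreal (\<integral>t. - drift t \<omega> + \<epsilon> \<partial>time_measure)"
    proof (rule nn_integral_eq_integral[OF int[OF \<omega>]], rule AE_I2)
      fix t assume "t \<in> space time_measure"
      then have "t \<in> {s..T}" by (simp add: space_restrict_space)
      from le[OF this \<omega>] show "0 \<le> - drift t \<omega> + \<epsilon>" by linarith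
    qed
    also have "\<dots> = ennreal (- total_drift \<omega> + \<epsilon> * (T - s))" by (simp only: eq[OF \<omega>])
    finally show "(\<integral>\<^sup>+t. ennreal (f t (\<Lambda> t \<omega>) (\<mu> t \<omega>)) \<partial>time_measure) + ennreal (g (\<Lambda> T \<omega>)) \<le> ennreal (?X \<omega>)"
      unfolding ennreal_plus[OF nn1[OF \<omega>] nn2[OF \<omega>]] by (rule add_right_mono)
  qed
  also have "\<dots> = ennreal (expectation ?X)"
    by (rule nn_integral_eq_integral[OF X_int], rule AE_I2) (use nn1 nn2 in force)
  finally show "cost M T f g s (\<Lambda>, \<mu>) \<le> ennreal (w s i + \<epsilon> * (T - s))" by (simp only: X_exp)
  show "0 \<le> w s i + \<epsilon> * (T - s)"
    unfolding X_exp[symmetric]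
    by (rule integral_nonneg_AE, rule AE_I2) (use nn1 nn2 in force)
qed

end

section \<open>Jump processes driven by a marked Poisson process\<close>

text \<open>The states visited by a chain that jumps at the times \<open>x 0 < x 1 < \<dots>\<close>, where the jump at
  time \<open>x n\<close> is decided by the mark \<open>z n\<close>.\<close>

primrec skeleton :: "(real \<Rightarrow> nat \<Rightarrow> real \<Rightarrow> nat) \<Rightarrow> nat \<Rightarrow> (nat \<Rightarrow> real) \<Rightarrow> (nat \<Rightarrow> real) \<Rightarrow> nat \<Rightarrow> nat" where
  "skeleton J i x z 0 = i"
| "skeleton J i x z (Suc n) = J (x n) (skeleton J i x z n) (z n)"

lemma skeleton_cong:
  "(\<And>k. k < n \<Longrightarrow> x k = x' k) \<Longrightarrow> (\<And>k. k < n \<Longrightarrow> z k = z' k) \<Longrightarrow>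
    skeleton J i x z n = skeleton J i x' z' n"
  by (induction n) auto

lemma skeleton_measurable:
  assumes J: "\<And>l. (\<lambda>p. J (fst p) l (snd p)) \<in> borel \<Otimes>\<^sub>M borel \<rightarrow>\<^sub>M count_space UNIV"
    and x: "\<And>k. k < n \<Longrightarrow> (\<lambda>\<omega>. x \<omega> k) \<in> borel_measurable N"
    and z: "\<And>k. k < n \<Longrightarrow> (\<lambda>\<omega>. z \<omega> k) \<in> borel_measurable N"
  shows "(\<lambda>\<omega>. skeleton J i (x \<omega>) (z \<omega>) n) \<in> N \<rightarrow>\<^sub>M count_space UNIV"
  using x z
proof (induction n)
  case (Suc n)
  have "(\<lambda>\<omega>. J (x \<omega> n) l (z \<omega> n)) \<in> N \<rightarrow>\<^sub>M count_space UNIV" for l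
    using measurable_compose[OF measurable_Pair[OF Suc.prems(1)[of n] Suc.prems(2)[of n]] J[of l]] by simp
  from measurable_compose_countable[OF this, of "\<lambda>\<omega>. skeleton J i (x \<omega>) (z \<omega>) n"] Suc
  show ?case by simp
qed simp

lemma Collect_diff:
  "(\<And>x. x \<in> S \<Longrightarrow> P x \<longleftrightarrow> Q x \<and> \<not> R x) \<Longrightarrow> {x \<in> S. P x} = {x \<in> S. Q x} - {x \<in> S. R x}"
  by blast

text \<open>The jump rule \<open>J\<close> is arbitrary and the law of the marks is left open; it
  enters through the probability \<kappa> of a set of marks in
  \<open>trans_prob_fine\<close>.\<close>

locale marked_poisson = prob_space M for M :: "'w measure" +
  fixes a :: real and \<sigma> \<xi> :: "nat \<Rightarrow> 'w \<Rightarrow> real" and J :: "real \<Rightarrow> nat \<Rightarrow> real \<Rightarrow> nat" and i :: nat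
  assumes a_pos: "0 < a"
    and indep: "indep_vars (\<lambda>_. borel) (\<lambda>k. case k of Inl n \<Rightarrow> \<sigma> n | Inr n \<Rightarrow> \<xi> n) UNIV"
    and expo: "\<And>n. distributed M lborel (\<sigma> n) (exponential_density a)"
    and J_meas: "\<And>l. (\<lambda>p. J (fst p) l (snd p)) \<in> borel \<Otimes>\<^sub>M borel \<rightarrow>\<^sub>M count_space UNIV"
begin

definition noise :: "nat + nat \<Rightarrow> 'w \<Rightarrow> real" where
  "noise k = (case k of Inl n \<Rightarrow> \<sigma> n | Inr n \<Rightarrow> \<xi> n)"

text \<open>Beginning of the period with exactly \<open>n\<close> arrivals; the first period begins
  at time 0.\<close>

definition start :: "nat \<Rightarrow> 'w \<Rightarrow> real" where
  "start n \<omega> = (\<Sum>k<n. \<sigma> k \<omega>)"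

definition visited :: "'w \<Rightarrow> nat \<Rightarrow> nat" where
  "visited \<omega> = skeleton J i (\<lambda>k. start (Suc k) \<omega>) (\<lambda>k. \<xi> k \<omega>)"

lemma indep_noise: "indep_vars (\<lambda>_. borel) noise UNIV"
  using indep unfolding noise_def[abs_def] .

lemma noise_measurable: "noise k \<in> borel_measurable M"
  using indep_noise by (auto simp: indep_vars_def)

lemma \<sigma>_measurable [measurable]: "\<sigma> n \<in> borel_measurable M"
  using noise_measurable[of "Inl n"] by (simp add: noise_def)

lemma \<xi>_measurable [measurable]: "\<xi> n \<in> borel_measurable M"
  using noise_measurable[of "Inr n"] by (simp add: noise_def)

lemma start_measurable [measurable]: "start n \<in> borel_measurable M"
  unfolding start_def[abs_def] by measurable

lemma visited_measurable [measurable]: "(\<lambda>\<omega>. visited \<omega> n) \<in> M \<rightarrow>\<^sub>M count_space UNIV"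
  unfolding visited_def by (rule skeleton_measurable[OF J_meas]) auto

definition past :: "nat \<Rightarrow> (nat + nat) set" where
  "past n = Inl ` {..<n} \<union> Inr ` {..<n}"

text \<open>Expresses the current period and state as a function of a tuple of noise coordinates, so
  that independence of disjoint coordinate families carries over to them.\<close>

definition decode :: "nat \<Rightarrow> (nat + nat \<Rightarrow> real) \<Rightarrow> real \<times> nat" where
  "decode n v = ((\<Sum>k<n. v (Inl k)), skeleton J i (\<lambda>k. \<Sum>j<Suc k. v (Inl j)) (\<lambda>k. v (Inr k)) n)"

lemma decode_measurable:
  assumes "past n \<subseteq> A"
  shows "decode n \<in> PiM A (\<lambda>_. borel) \<rightarrow>\<^sub>M borel \<Otimes>\<^sub>M count_space UNIV"
proof -
  have l: "(\<lambda>v. v (Inl k)) \<in> borel_measurable (PiM A (\<lambda>_. borel :: real measure))" if "k < n" for k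
    by (rule measurable_component_singleton) (use that assms in \<open>auto simp: past_def\<close>)
  have r: "(\<lambda>v. v (Inr k)) \<in> borel_measurable (PiM A (\<lambda>_. borel :: real measure))" if "k < n" for k
    by (rule measurable_component_singleton) (use that assms in \<open>auto simp: past_def\<close>)
  show ?thesis
    unfolding decode_def[abs_def]
  proof (intro measurable_Pair skeleton_measurable[OF J_meas])
    show "(\<lambda>v. \<Sum>k<n. v (Inl k)) \<in> borel_measurable (PiM A (\<lambda>_. borel :: real measure))"
      by (intro borel_measurable_sum l) auto
    show "(\<lambda>v. \<Sum>j<Suc k. v (Inl j)) \<in> borel_measurable (PiM A (\<lambda>_. borel :: real measure))" if "k < n" for k
      by (intro borel_measurable_sum l) (use that in auto)
    show "(\<lambda>v. v (Inr k)) \<in> borel_measurable (PiM A (\<lambda>_. borel :: real measure))" if "k < n" for k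
      by (rule r[OF that])
  qed
qed

lemma decode_noise:
  assumes "past n \<subseteq> A"
  shows "decode n (\<lambda>k\<in>A. noise k \<omega>) = (start n \<omega>, visited \<omega> n)"
proof -
  have A: "Inl k \<in> A" "Inr k \<in> A" if "k < n" for k
    using assms that by (auto simp: past_def)
  have "skeleton J i (\<lambda>k. \<Sum>j<Suc k. (\<lambda>k\<in>A. noise k \<omega>) (Inl j)) (\<lambda>k. (\<lambda>k\<in>A. noise k \<omega>) (Inr k)) n
      = visited \<omega> n"
    unfolding visited_def start_def using A
    by (intro skeleton_cong sum.cong) (auto simp: noise_def)
  moreover have "(\<Sum>k<n. (\<lambda>k\<in>A. noise k \<omega>) (Inl k)) = start n \<omega>"
    unfolding start_def by (rule sum.cong) (use A in \<open>auto simp: noise_def\<close>)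
  ultimately show ?thesis by (simp add: decode_def)
qed

lemma indep_tuple_noise:
  assumes "c \<notin> A"
  shows "indep_var (PiM A (\<lambda>_. borel)) (\<lambda>\<omega>. \<lambda>k\<in>A. noise k \<omega>) (PiM {c} (\<lambda>_. borel)) (\<lambda>\<omega>. \<lambda>k\<in>{c}. noise k \<omega>)"
  by (rule indep_var_restrict[OF indep_noise]) (use assms in auto)

lemma prob_\<sigma>_gt: "0 \<le> c \<Longrightarrow> prob {\<omega> \<in> space M. c < \<sigma> n \<omega>} = exp (- c * a)"
  using exponential_distributedD_gt[OF expo _ a_pos] by simp

lemma prob_\<sigma>_le: "0 \<le> c \<Longrightarrow> prob {\<omega> \<in> space M. \<sigma> n \<omega> \<le> c} = 1 - exp (- c * a)"
  using exponential_distributedD_le[OF expo _ a_pos] by simp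

lemma start_Suc: "start (Suc n) \<omega> = start n \<omega> + \<sigma> n \<omega>"
  by (simp add: start_def)

text \<open>Given the past, \<open>\<sigma> n\<close> is still exponential, so the product law and
  Fubini give the integral. Its integrand depends on \<open>r\<close> through one exponential
  factor, so passing from \<open>t\<close> to \<open>t + \<delta>\<close> multiplies it by a
  constant; this is the memoryless property of the next lemma.\<close>

lemma prob_waiting:
  assumes "t \<le> r"
  shows "emeasure M {\<omega> \<in> space M. start n \<omega> \<le> t \<and> visited \<omega> n = l \<and> r < start (Suc n) \<omega>}
    = (\<integral>\<^sup>+v. ennreal (exp (- (r - fst (decode n v)) * a)) * indicator {v. fst (decode n v) \<le> t \<and> snd (decode n v) = l} v
        \<partial>distr M (PiM (past n) (\<lambda>_. borel)) (\<lambda>\<omega>. \<lambda>k\<in>past n. noise k \<omega>))"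
proof -
  let ?c = "Inl n :: nat + nat"
  let ?S = "PiM (past n) (\<lambda>_. borel :: real measure)" and ?X = "\<lambda>\<omega>. \<lambda>k\<in>past n. noise k \<omega>"
  let ?R = "PiM {?c} (\<lambda>_. borel :: real measure)" and ?Y = "\<lambda>\<omega>. \<lambda>k\<in>{?c}. noise k \<omega>"
  have indep: "indep_var ?S ?X ?R ?Y"
    by (rule indep_tuple_noise) (auto simp: past_def)
  then have X[measurable]: "?X \<in> M \<rightarrow>\<^sub>M ?S" and Y[measurable]: "?Y \<in> M \<rightarrow>\<^sub>M ?R"
    and prod: "distr M ?S ?X \<Otimes>\<^sub>M distr M ?R ?Y = distr M (?S \<Otimes>\<^sub>M ?R) (\<lambda>\<omega>. (?X \<omega>, ?Y \<omega>))"
    by (simp_all add: indep_var_distribution_eq)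
  note decode_measurable[OF order_refl, of n, measurable]
  have comp[measurable]: "(\<lambda>v. v ?c) \<in> borel_measurable ?R" by (rule measurable_component_singleton) simp
  define C where "C = {x \<in> space (?S \<Otimes>\<^sub>M ?R). fst (decode n (fst x)) \<le> t \<and> snd (decode n (fst x)) = l
      \<and> r < fst (decode n (fst x)) + snd x ?c}"
  have C: "C \<in> sets (?S \<Otimes>\<^sub>M ?R)" unfolding C_def by measurable
  have C': "C \<in> sets (distr M ?S ?X \<Otimes>\<^sub>M distr M ?R ?Y)"
    using C by simp
  interpret D: prob_space "distr M ?R ?Y" by (rule prob_space_distr) (rule Y)
  have dec: "decode n (?X \<omega>) = (start n \<omega>, visited \<omega> n)" for \<omega>
    by (rule decode_noise) simp
  have "{\<omega> \<in> space M. start n \<omega> \<le> t \<and> visited \<omega> n = l \<and> r < start (Suc n) \<omega>}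
      = (\<lambda>\<omega>. (?X \<omega>, ?Y \<omega>)) -` C \<inter> space M"
    using measurable_space[OF X] measurable_space[OF Y]
    by (auto simp: C_def start_Suc space_pair_measure dec) (simp_all add: noise_def)
  then have "emeasure M {\<omega> \<in> space M. start n \<omega> \<le> t \<and> visited \<omega> n = l \<and> r < start (Suc n) \<omega>}
      = emeasure (distr M (?S \<Otimes>\<^sub>M ?R) (\<lambda>\<omega>. (?X \<omega>, ?Y \<omega>))) C"
    using C by (subst emeasure_distr) (auto intro: measurable_Pair X Y)
  also have "\<dots> = (\<integral>\<^sup>+v. emeasure (distr M ?R ?Y) (Pair v -` C) \<partial>distr M ?S ?X)"
    unfolding prod[symmetric] by (rule D.emeasure_pair_measure_alt[OF C'])
  also have "\<dots> = (\<integral>\<^sup>+v. ennreal (exp (- (r - fst (decode n v)) * a))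
      * indicator {v. fst (decode n v) \<le> t \<and> snd (decode n v) = l} v \<partial>distr M ?S ?X)"
  proof (rule nn_integral_cong)
    fix v :: "nat + nat \<Rightarrow> real" assume "v \<in> space (distr M ?S ?X)"
    then have v: "v \<in> space ?S" by simp
    let ?u = "fst (decode n v)"
    show "emeasure (distr M ?R ?Y) (Pair v -` C) = ennreal (exp (- (r - ?u) * a))
        * indicator {v. fst (decode n v) \<le> t \<and> snd (decode n v) = l} v"
    proof (cases "?u \<le> t \<and> snd (decode n v) = l")
      case True
      have "Pair v -` C = {y \<in> space ?R. r - ?u < y ?c}"
        using True v by (auto simp: C_def space_pair_measure)
      moreover have "{y \<in> space ?R. r - ?u < y ?c} \<in> sets ?R" by measurable
      ultimately have "emeasure (distr M ?R ?Y) (Pair v -` C) = emeasure M (?Y -` {y \<in> space ?R. r - ?u < y ?c} \<inter> space M)"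
        by (simp add: emeasure_distr[OF Y])
      also have "?Y -` {y \<in> space ?R. r - ?u < y ?c} \<inter> space M = {\<omega> \<in> space M. r - ?u < \<sigma> n \<omega>}"
        using measurable_space[OF Y] by (auto simp: noise_def)
      also have "emeasure M \<dots> = ennreal (exp (- (r - ?u) * a))"
        using prob_\<sigma>_gt[of "r - ?u" n] True assms by (simp add: emeasure_eq_measure)
      finally have "emeasure (distr M ?R ?Y) (Pair v -` C) = ennreal (exp (- (r - ?u) * a))" .
      moreover have "indicator {v. fst (decode n v) \<le> t \<and> snd (decode n v) = l} v = (1 :: ennreal)"
        using True by simp
      ultimately show ?thesis by (simp only: mult_1_right)
    next
      case False
      then have "Pair v -` C = {}" by (auto simp: C_def)
      then show ?thesis using False by simp
    qed
  qed
  finally show ?thesis .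
qed

lemma memoryless:
  assumes "0 \<le> \<delta>"
  shows "prob {\<omega> \<in> space M. start n \<omega> \<le> t \<and> visited \<omega> n = l \<and> t + \<delta> < start (Suc n) \<omega>}
    = exp (- \<delta> * a) * prob {\<omega> \<in> space M. start n \<omega> \<le> t \<and> visited \<omega> n = l \<and> t < start (Suc n) \<omega>}"
proof -
  let ?D = "distr M (PiM (past n) (\<lambda>_. borel)) (\<lambda>\<omega>. \<lambda>k\<in>past n. noise k \<omega>)"
  let ?h = "\<lambda>r v. ennreal (exp (- (r - fst (decode n v)) * a))
      * indicator {v. fst (decode n v) \<le> t \<and> snd (decode n v) = l} v"
  note decode_measurable[OF order_refl, of n, measurable]
  have h: "?h t \<in> borel_measurable ?D"
  proof -
    have "(\<lambda>v. ennreal (exp (- (t - fst (decode n v)) * a))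
        * (if fst (decode n v) \<le> t \<and> snd (decode n v) = l then 1 else 0)) \<in> borel_measurable (PiM (past n) (\<lambda>_. borel))"
      by measurable
    moreover have "?h t = (\<lambda>v. ennreal (exp (- (t - fst (decode n v)) * a))
        * (if fst (decode n v) \<le> t \<and> snd (decode n v) = l then 1 else 0))"
      by (simp add: fun_eq_iff)
    ultimately show ?thesis by simp
  qed
  have "ennreal (exp (- (t + \<delta> - u) * a)) = ennreal (exp (- \<delta> * a)) * ennreal (exp (- (t - u) * a))" for u
  proof -
    have "exp (- (t + \<delta> - u) * a) = exp (- \<delta> * a) * exp (- (t - u) * a)"
      by (subst exp_add[symmetric]) (simp add: algebra_simps)
    then show ?thesis by (simp only: ennreal_mult[OF exp_ge_zero exp_ge_zero])
  qed
  then have "?h (t + \<delta>) v = ennreal (exp (- \<delta> * a)) * ?h t v" for v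
    by (simp only: mult.assoc)
  then have "emeasure M {\<omega> \<in> space M. start n \<omega> \<le> t \<and> visited \<omega> n = l \<and> t + \<delta> < start (Suc n) \<omega>}
      = (\<integral>\<^sup>+v. ennreal (exp (- \<delta> * a)) * ?h t v \<partial>?D)"
    using assms by (subst prob_waiting) (simp_all only: le_add_same_cancel1)
  also have "\<dots> = ennreal (exp (- \<delta> * a)) * (\<integral>\<^sup>+v. ?h t v \<partial>?D)"
    by (rule nn_integral_cmult[OF h])
  also have "\<dots> = ennreal (exp (- \<delta> * a)) * emeasure M {\<omega> \<in> space M. start n \<omega> \<le> t \<and> visited \<omega> n = l \<and> t < start (Suc n) \<omega>}"
    by (subst prob_waiting[of t t]) (rule order_refl, rule refl)
  finally show ?thesis
    unfolding emeasure_eq_measure ennreal_mult[OF exp_ge_zero measure_nonneg, symmetric]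
    by (subst (asm) ennreal_inj) (auto intro: mult_nonneg_nonneg)
qed

abbreviation jump_in :: "nat \<Rightarrow> real \<Rightarrow> real \<Rightarrow> nat \<Rightarrow> 'w \<Rightarrow> bool" where
  "jump_in n t r l \<omega> \<equiv> start n \<omega> \<le> t \<and> visited \<omega> n = l \<and> t < start (Suc n) \<omega> \<and> start (Suc n) \<omega> \<le> r"

lemma prob_jump_in:
  assumes "0 \<le> \<delta>"
  shows "prob {\<omega> \<in> space M. jump_in n t (t + \<delta>) l \<omega>}
    = (1 - exp (- \<delta> * a)) * prob {\<omega> \<in> space M. start n \<omega> \<le> t \<and> visited \<omega> n = l \<and> t < start (Suc n) \<omega>}"
proof -
  let ?A = "{\<omega> \<in> space M. start n \<omega> \<le> t \<and> visited \<omega> n = l \<and> t < start (Suc n) \<omega>}"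
  let ?B = "{\<omega> \<in> space M. start n \<omega> \<le> t \<and> visited \<omega> n = l \<and> t + \<delta> < start (Suc n) \<omega>}"
  have sets: "?A \<in> sets M" "?B \<in> sets M" by measurable
  have sub: "?B \<subseteq> ?A"
  proof (rule subsetI)
    fix \<omega> assume "\<omega> \<in> ?B"
    then have "\<omega> \<in> space M" "start n \<omega> \<le> t" "visited \<omega> n = l" "t + \<delta> < start (Suc n) \<omega>" by blast+
    moreover have "t < start (Suc n) \<omega>" using calculation(4) assms by linarith
    ultimately show "\<omega> \<in> ?A" by blast
  qed
  have diff: "{\<omega> \<in> space M. jump_in n t (t + \<delta>) l \<omega>} = ?A - ?B"
    by (rule Collect_diff) (auto simp: not_less)
  have factor: "x - y = (1 - e) * x" if "y = e * x" for x y e :: real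
    unfolding that by (simp add: left_diff_distrib)
  have "prob {\<omega> \<in> space M. jump_in n t (t + \<delta>) l \<omega>} = prob (?A - ?B)"
    by (rule arg_cong[OF diff])
  also have "\<dots> = prob ?A - prob ?B"
    by (rule finite_measure_Diff[OF sets sub])
  also have "\<dots> = (1 - exp (- \<delta> * a)) * prob ?A"
    by (rule factor[OF memoryless[OF assms]])
  finally show ?thesis .
qed

text \<open>The event is decided by the past and the waiting time \<open>Inl n\<close>. The
  coordinate \<open>c\<close> is meant to be the mark of the next arrival or the waiting time after
  it.\<close>

lemma prob_jump_in_noise:
  assumes c: "c \<notin> insert (Inl n) (past n)" and A: "A \<in> sets borel"
  shows "prob {\<omega> \<in> space M. jump_in n t r l \<omega> \<and> noise c \<omega> \<in> A}
    = prob {\<omega> \<in> space M. jump_in n t r l \<omega>} * prob {\<omega> \<in> space M. noise c \<omega> \<in> A}"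
proof -
  let ?A = "insert (Inl n) (past n)"
  let ?S = "PiM ?A (\<lambda>_. borel :: real measure)" and ?X = "\<lambda>\<omega>. \<lambda>k\<in>?A. noise k \<omega>"
  let ?R = "PiM {c} (\<lambda>_. borel :: real measure)" and ?Y = "\<lambda>\<omega>. \<lambda>k\<in>{c}. noise k \<omega>"
  have indep: "indep_var ?S ?X ?R ?Y" by (rule indep_tuple_noise[OF c])
  have X: "?X \<in> M \<rightarrow>\<^sub>M ?S" by (rule indep_var_rv1[OF indep])
  have Y: "?Y \<in> M \<rightarrow>\<^sub>M ?R" by (rule indep_var_rv2[OF indep])
  note decode_measurable[of n ?A, OF subset_insertI, measurable]
  have comp[measurable]: "(\<lambda>v. v (Inl n)) \<in> borel_measurable ?S" by (rule measurable_component_singleton) simp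
  have comp'[measurable]: "(\<lambda>v. v c) \<in> borel_measurable ?R" by (rule measurable_component_singleton) simp
  define C where "C = {v \<in> space ?S. fst (decode n v) \<le> t \<and> snd (decode n v) = l
      \<and> t < fst (decode n v) + v (Inl n) \<and> fst (decode n v) + v (Inl n) \<le> r}"
  have C: "C \<in> sets ?S" unfolding C_def by measurable
  have dec: "decode n (?X \<omega>) = (start n \<omega>, visited \<omega> n)" for \<omega>
    by (rule decode_noise) auto
  have \<sigma>: "?X \<omega> (Inl n) = \<sigma> n \<omega>" for \<omega> by (simp add: noise_def)
  define X where "X = ?X"
  define Y where "Y = ?Y"
  define D where "D = {v \<in> space ?R. v c \<in> A}"
  have indep': "indep_var ?S X ?R Y" unfolding X_def Y_def by (rule indep)
  have "D = (\<lambda>v. v c) -` A \<inter> space ?R" by (auto simp: D_def)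
  then have D: "D \<in> sets ?R" using measurable_sets[OF comp' A] by simp
  have XC: "X \<omega> \<in> C \<longleftrightarrow> jump_in n t r l \<omega>" if "\<omega> \<in> space M" for \<omega>
  proof -
    have "?X \<omega> \<in> space ?S" by (rule measurable_space[OF X that])
    then show ?thesis
      unfolding X_def C_def mem_Collect_eq dec \<sigma> start_Suc fst_conv snd_conv by (simp only: simp_thms)
  qed
  have YD: "Y \<omega> \<in> D \<longleftrightarrow> noise c \<omega> \<in> A" if "\<omega> \<in> space M" for \<omega>
  proof -
    have "?Y \<omega> \<in> space ?R" by (rule measurable_space[OF Y that])
    moreover have "?Y \<omega> c = noise c \<omega>" by simp
    ultimately show ?thesis unfolding Y_def D_def mem_Collect_eq by (simp only: simp_thms)
  qed
  have e1: "(\<lambda>\<omega>. (X \<omega>, Y \<omega>)) -` (C \<times> D) \<inter> space M = {\<omega> \<in> space M. jump_in n t r l \<omega> \<and> noise c \<omega> \<in> A}"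
  proof (rule set_eqI)
    fix \<omega> show "\<omega> \<in> (\<lambda>\<omega>. (X \<omega>, Y \<omega>)) -` (C \<times> D) \<inter> space M
        \<longleftrightarrow> \<omega> \<in> {\<omega> \<in> space M. jump_in n t r l \<omega> \<and> noise c \<omega> \<in> A}"
      unfolding Int_iff vimage_eq mem_Sigma_iff mem_Collect_eq using XC[of \<omega>] YD[of \<omega>] by blast
  qed
  have e2: "X -` C \<inter> space M = {\<omega> \<in> space M. jump_in n t r l \<omega>}"
  proof (rule set_eqI)
    fix \<omega> show "\<omega> \<in> X -` C \<inter> space M \<longleftrightarrow> \<omega> \<in> {\<omega> \<in> space M. jump_in n t r l \<omega>}"
      unfolding Int_iff vimage_eq mem_Collect_eq using XC[of \<omega>] by blast
  qed
  have e3: "Y -` D \<inter> space M = {\<omega> \<in> space M. noise c \<omega> \<in> A}"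
  proof (rule set_eqI)
    fix \<omega> show "\<omega> \<in> Y -` D \<inter> space M \<longleftrightarrow> \<omega> \<in> {\<omega> \<in> space M. noise c \<omega> \<in> A}"
      unfolding Int_iff vimage_eq mem_Collect_eq using YD[of \<omega>] by blast
  qed
  show ?thesis
    using indep_varD[OF indep' C D] unfolding e1 e2 e3 .
qed

text \<open>Path regularity is required at every sample point, so the null set where arrivals fail
  to increase strictly to infinity is isolated; \<open>proc\<close> is constant on it.\<close>

definition good :: "'w set" where
  "good = {\<omega> \<in> space M. (\<forall>n. 0 < \<sigma> n \<omega>) \<and> (\<forall>m::nat. \<exists>n. real m < start n \<omega>)}"

text \<open>Counts arrivals up to and including \<open>t\<close>; the strict inequality is what
  makes the path right-continuous.\<close>

definition arrivals :: "real \<Rightarrow> 'w \<Rightarrow> nat" where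
  "arrivals t \<omega> = (LEAST n. t < start (Suc n) \<omega>)"

definition proc :: "real \<Rightarrow> 'w \<Rightarrow> nat" where
  "proc t \<omega> = (if \<omega> \<in> good then visited \<omega> (arrivals t \<omega>) else i)"

lemma good_sets [measurable]: "good \<in> sets M"
  unfolding good_def by measurable

lemma good_space: "good \<subseteq> space M"
  by (auto simp: good_def)

lemma AE_good: "AE \<omega> in M. \<omega> \<in> good"
proof -
  have pos: "AE \<omega> in M. \<forall>n. 0 < \<sigma> n \<omega>"
    unfolding AE_all_countable
  proof
    fix n
    have "prob {\<omega> \<in> space M. 0 < \<sigma> n \<omega>} = 1" using prob_\<sigma>_gt[of 0 n] by simp
    then show "AE \<omega> in M. 0 < \<sigma> n \<omega>" by (subst (asm) prob_Collect_eq_1) auto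
  qed
  have "AE \<omega> in M. \<forall>m::nat. \<exists>n. real m < start n \<omega>"
    unfolding AE_all_countable
  proof
    fix m :: nat
    \<comment> \<open>One waiting time above \<open>m\<close> already pushes the partial sums above
      \<open>m\<close>. By independence, that none of the first \<open>Suc n\<close> does so has
      probability \<open>e ^ Suc n\<close>, which tends to 0.\<close>
    define N where "N = {\<omega> \<in> space M. \<forall>n. \<sigma> n \<omega> \<le> real m}"
    define e where "e = 1 - exp (- real m * a)"
    have e: "0 \<le> e" "e < 1" using a_pos by (auto simp: e_def)
    have "prob N \<le> e ^ Suc n" for n
    proof -
      let ?S = "(Inl :: nat \<Rightarrow> nat + nat) ` {..n}"
      have eq: "noise (Inl k) -` {..real m} \<inter> space M = {\<omega> \<in> space M. \<sigma> k \<omega> \<le> real m}" for k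
        by (auto simp: noise_def)
      have "prob N \<le> prob (\<Inter>c\<in>?S. noise c -` {..real m} \<inter> space M)"
        by (rule finite_measure_mono) (auto simp: N_def noise_def intro!: sets.countable_INT' measurable_sets[OF noise_measurable])
      also have "\<dots> = (\<Prod>c\<in>?S. prob (noise c -` {..real m} \<inter> space M))"
        by (rule indep_varsD[OF indep_noise]) auto
      also have "\<dots> = (\<Prod>k\<le>n. prob (noise (Inl k) -` {..real m} \<inter> space M))"
        by (subst prod.reindex) (auto simp: inj_on_def)
      also have "\<dots> = e ^ Suc n"
        unfolding eq e_def by (subst prob_\<sigma>_le) (auto simp: prod_constant)
      finally show ?thesis .
    qed
    moreover have "(\<lambda>n. e ^ Suc n) \<longlonglongrightarrow> 0"
      by (intro LIMSEQ_Suc LIMSEQ_realpow_zero e)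
    ultimately have "prob N \<le> 0" by (intro LIMSEQ_le_const) auto
    then have N0: "prob N = 0" using measure_nonneg[of M N] by linarith
    have "N \<in> sets M" unfolding N_def by measurable
    with N0 have "AE \<omega> in M. \<omega> \<notin> N" by (simp add: prob_eq_0)
    then show "AE \<omega> in M. \<exists>n. real m < start n \<omega>"
      using pos AE_space
    proof eventually_elim
      case (elim \<omega>)
      then obtain k where k: "real m < \<sigma> k \<omega>" by (auto simp: N_def not_le)
      have "0 \<le> start k \<omega>" unfolding start_def by (rule sum_nonneg) (use elim in \<open>simp add: less_imp_le\<close>)
      then have "real m < start (Suc k) \<omega>" using k by (simp add: start_Suc)
      then show ?case by blast
    qed
  qed
  with pos AE_space show ?thesis by eventually_elim (simp add: good_def)
qed

lemma start_less_Suc: "\<omega> \<in> good \<Longrightarrow> start n \<omega> < start (Suc n) \<omega>"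
  by (simp add: good_def start_Suc)

lemma start_mono: "\<omega> \<in> good \<Longrightarrow> m \<le> n \<Longrightarrow> start m \<omega> \<le> start n \<omega>"
  by (rule lift_Suc_mono_le[of "\<lambda>n. start n \<omega>"]) (auto dest: start_less_Suc intro: less_imp_le)

lemma start_0 [simp]: "start 0 \<omega> = 0"
  by (simp add: start_def)

lemma start_unbounded:
  assumes "\<omega> \<in> good" shows "\<exists>n. t < start (Suc n) \<omega>"
proof -
  obtain m :: nat where "t < real m" using reals_Archimedean2 by blast
  moreover obtain n where "real m < start n \<omega>" using assms by (auto simp: good_def)
  ultimately show ?thesis using start_less_Suc[OF assms, of n] by (intro exI[of _ n]) linarith
qed

lemma arrivals_eqI:
  assumes "\<omega> \<in> good" "start n \<omega> \<le> t" "t < start (Suc n) \<omega>"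
  shows "arrivals t \<omega> = n"
  unfolding arrivals_def
proof (rule Least_equality)
  fix m assume m: "t < start (Suc m) \<omega>"
  show "n \<le> m"
  proof (rule ccontr)
    assume "\<not> n \<le> m"
    then have "start (Suc m) \<omega> \<le> start n \<omega>" by (intro start_mono assms) simp
    then show False using m assms by linarith
  qed
qed (rule assms)

lemma start_arrivals:
  assumes "\<omega> \<in> good" "0 \<le> t"
  shows "start (arrivals t \<omega>) \<omega> \<le> t" "t < start (Suc (arrivals t \<omega>)) \<omega>"
proof -
  show "t < start (Suc (arrivals t \<omega>)) \<omega>"
    unfolding arrivals_def by (rule LeastI_ex[OF start_unbounded[OF assms(1)]])
  show "start (arrivals t \<omega>) \<omega> \<le> t"
  proof (cases "arrivals t \<omega>")
    case 0 then show ?thesis using assms by simp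
  next
    case (Suc m)
    then have "m < arrivals t \<omega>" by simp
    then have "\<not> t < start (Suc m) \<omega>" unfolding arrivals_def by (rule not_less_Least)
    then show ?thesis by (simp add: Suc)
  qed
qed

lemma arrivals_measurable [measurable]: "arrivals t \<in> M \<rightarrow>\<^sub>M count_space UNIV"
  unfolding arrivals_def[abs_def] by measurable

lemma visited_arrivals_measurable [measurable]: "(\<lambda>\<omega>. visited \<omega> (arrivals t \<omega>)) \<in> M \<rightarrow>\<^sub>M count_space UNIV"
  by (rule measurable_compose_countable[OF visited_measurable arrivals_measurable])

lemma proc_measurable [measurable]: "proc t \<in> M \<rightarrow>\<^sub>M count_space UNIV"
  unfolding proc_def[abs_def] by measurable

text \<open>Partition by the number of arrivals up to \<open>t\<close>. Since \<Phi> may depend on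
  the index, the next mark and the next waiting time can be read at the random index
  \<open>arrivals t\<close>.\<close>

lemma sums_arrivals:
  assumes t: "0 \<le> t" and \<Phi>: "\<And>n. {\<omega> \<in> space M. \<Phi> n \<omega>} \<in> sets M"
  shows "(\<lambda>n. prob {\<omega> \<in> space M. start n \<omega> \<le> t \<and> visited \<omega> n = l \<and> t < start (Suc n) \<omega> \<and> \<Phi> n \<omega>})
    sums prob {\<omega> \<in> good. visited \<omega> (arrivals t \<omega>) = l \<and> \<Phi> (arrivals t \<omega>) \<omega>}"
proof -
  define A where "A n = {\<omega> \<in> space M. start n \<omega> \<le> t \<and> visited \<omega> n = l \<and> t < start (Suc n) \<omega> \<and> \<Phi> n \<omega>}" for n
  define R where "R = {\<omega> \<in> good. visited \<omega> (arrivals t \<omega>) = l \<and> \<Phi> (arrivals t \<omega>) \<omega>}"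
  have A_sets: "A n \<in> sets M" for n
  proof -
    have "A n = {\<omega> \<in> space M. start n \<omega> \<le> t \<and> visited \<omega> n = l \<and> t < start (Suc n) \<omega>} \<inter> {\<omega> \<in> space M. \<Phi> n \<omega>}"
      unfolding A_def by blast
    also have "\<dots> \<in> sets M" by (rule sets.Int[OF _ \<Phi>]) measurable
    finally show ?thesis .
  qed
  have eq: "arrivals t \<omega> = n" if "\<omega> \<in> good" "\<omega> \<in> A n" for n \<omega>
    by (rule arrivals_eqI[OF that(1)]) (use that(2) in \<open>simp_all only: A_def mem_Collect_eq\<close>)
  have "(\<lambda>n. prob (good \<inter> A n)) sums prob (\<Union>n. good \<inter> A n)"
  proof (rule finite_measure_UNION)
    show "range (\<lambda>n. good \<inter> A n) \<subseteq> sets M" using A_sets good_sets by (intro image_subsetI sets.Int)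
    show "disjoint_family (\<lambda>n. good \<inter> A n)"
      unfolding disjoint_family_on_def using eq by (metis IntD1 IntD2 disjoint_iff)
  qed
  moreover have "prob (good \<inter> A n) = prob (A n)" for n
  proof (rule finite_measure_eq_AE)
    show "AE \<omega> in M. \<omega> \<in> good \<inter> A n \<longleftrightarrow> \<omega> \<in> A n" using AE_good by eventually_elim simp
  qed (intro sets.Int good_sets A_sets)+
  moreover have "(\<Union>n. good \<inter> A n) = R"
  proof (intro set_eqI iffI)
    fix \<omega> assume "\<omega> \<in> (\<Union>n. good \<inter> A n)"
    then obtain n where n: "\<omega> \<in> good" "\<omega> \<in> A n" by blast
    then have "visited \<omega> n = l" "\<Phi> n \<omega>" by (simp_all only: A_def mem_Collect_eq)
    then show "\<omega> \<in> R" unfolding R_def mem_Collect_eq eq[OF n] using n(1) by blast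
  next
    fix \<omega> assume "\<omega> \<in> R"
    then have \<omega>: "\<omega> \<in> good" "visited \<omega> (arrivals t \<omega>) = l" "\<Phi> (arrivals t \<omega>) \<omega>"
      by (simp_all only: R_def mem_Collect_eq)
    have "\<omega> \<in> A (arrivals t \<omega>)"
      unfolding A_def mem_Collect_eq using start_arrivals[OF \<omega>(1) t] \<omega> good_space by blast
    then show "\<omega> \<in> (\<Union>n. good \<inter> A n)" using \<omega>(1) by blast
  qed
  ultimately have "(\<lambda>n. prob (A n)) sums prob R" by simp
  then show ?thesis by (simp only: A_def R_def)
qed

section \<open>Transition probabilities over short times\<close>

abbreviation no_jump :: "real \<Rightarrow> real" where
  "no_jump \<delta> \<equiv> exp (- \<delta> * a)"

abbreviation state_prob :: "real \<Rightarrow> nat \<Rightarrow> real" where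
  "state_prob t l \<equiv> prob {\<omega> \<in> good. visited \<omega> (arrivals t \<omega>) = l}"

lemma sums_state_prob:
  assumes "0 \<le> t"
  shows "(\<lambda>n. prob {\<omega> \<in> space M. start n \<omega> \<le> t \<and> visited \<omega> n = l \<and> t < start (Suc n) \<omega>}) sums state_prob t l"
  using sums_arrivals[OF assms, of "\<lambda>_ _. True" l] by simp

lemma prob_jump:
  assumes t: "0 \<le> t" and \<delta>: "0 \<le> \<delta>"
  shows "prob {\<omega> \<in> good. visited \<omega> (arrivals t \<omega>) = l \<and> start (Suc (arrivals t \<omega>)) \<omega> \<le> t + \<delta>}
    = (1 - no_jump \<delta>) * state_prob t l"
proof -
  have "(\<lambda>n. prob {\<omega> \<in> space M. jump_in n t (t + \<delta>) l \<omega>}) sums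
      prob {\<omega> \<in> good. visited \<omega> (arrivals t \<omega>) = l \<and> start (Suc (arrivals t \<omega>)) \<omega> \<le> t + \<delta>}"
    by (rule sums_arrivals[OF t]) measurable
  moreover have "(\<lambda>n. prob {\<omega> \<in> space M. jump_in n t (t + \<delta>) l \<omega>}) sums ((1 - no_jump \<delta>) * state_prob t l)"
    unfolding prob_jump_in[OF \<delta>] by (rule sums_mult[OF sums_state_prob[OF t]])
  ultimately show ?thesis by (rule sums_unique2)
qed

text \<open>The noise is read at a random index, but \<kappa> is the same for every index, so the
  product form survives the summation over the number of arrivals.\<close>

lemma prob_jump_noise:
  assumes t: "0 \<le> t" and \<delta>: "0 \<le> \<delta>" and A: "A \<in> sets borel"
    and c: "\<And>n. c n \<notin> insert (Inl n) (past n)" and \<kappa>: "\<And>n. prob {\<omega> \<in> space M. noise (c n) \<omega> \<in> A} = \<kappa>"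
  shows "prob {\<omega> \<in> good. visited \<omega> (arrivals t \<omega>) = l \<and>
      start (Suc (arrivals t \<omega>)) \<omega> \<le> t + \<delta> \<and> noise (c (arrivals t \<omega>)) \<omega> \<in> A}
    = \<kappa> * (1 - no_jump \<delta>) * state_prob t l"
proof -
  have N: "{\<omega> \<in> space M. noise (c n) \<omega> \<in> A} \<in> sets M" for n
    using measurable_sets[OF noise_measurable A, of "c n"] by (simp add: vimage_def Int_def conj_commute)
  have "(\<lambda>n. prob {\<omega> \<in> space M. start n \<omega> \<le> t \<and> visited \<omega> n = l \<and> t < start (Suc n) \<omega> \<and>
      (start (Suc n) \<omega> \<le> t + \<delta> \<and> noise (c n) \<omega> \<in> A)}) sums
      prob {\<omega> \<in> good. visited \<omega> (arrivals t \<omega>) = l \<and>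
      start (Suc (arrivals t \<omega>)) \<omega> \<le> t + \<delta> \<and> noise (c (arrivals t \<omega>)) \<omega> \<in> A}"
  proof (rule sums_arrivals[OF t])
    fix n
    note N[of n, unfolded pred_def[symmetric], measurable]
    show "{\<omega> \<in> space M. start (Suc n) \<omega> \<le> t + \<delta> \<and> noise (c n) \<omega> \<in> A} \<in> sets M" by measurable
  qed
  moreover have "prob {\<omega> \<in> space M. start n \<omega> \<le> t \<and> visited \<omega> n = l \<and> t < start (Suc n) \<omega> \<and>
      (start (Suc n) \<omega> \<le> t + \<delta> \<and> noise (c n) \<omega> \<in> A)}
      = \<kappa> * (1 - no_jump \<delta>) * prob {\<omega> \<in> space M. start n \<omega> \<le> t \<and> visited \<omega> n = l \<and> t < start (Suc n) \<omega>}" for n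
  proof -
    have "prob {\<omega> \<in> space M. jump_in n t (t + \<delta>) l \<omega> \<and> noise (c n) \<omega> \<in> A}
        = \<kappa> * (1 - no_jump \<delta>) * prob {\<omega> \<in> space M. start n \<omega> \<le> t \<and> visited \<omega> n = l \<and> t < start (Suc n) \<omega>}"
      by (simp only: prob_jump_in_noise[OF c A] \<kappa> prob_jump_in[OF \<delta>] mult_ac)
    then show ?thesis by (simp only: conj_assoc)
  qed
  ultimately have "(\<lambda>n. \<kappa> * (1 - no_jump \<delta>) * prob {\<omega> \<in> space M. start n \<omega> \<le> t \<and> visited \<omega> n = l \<and> t < start (Suc n) \<omega>}) sums
      prob {\<omega> \<in> good. visited \<omega> (arrivals t \<omega>) = l \<and>
      start (Suc (arrivals t \<omega>)) \<omega> \<le> t + \<delta> \<and> noise (c (arrivals t \<omega>)) \<omega> \<in> A}"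
    by (simp only:)
  moreover have "(\<lambda>n. \<kappa> * (1 - no_jump \<delta>) * prob {\<omega> \<in> space M. start n \<omega> \<le> t \<and> visited \<omega> n = l \<and> t < start (Suc n) \<omega>})
      sums (\<kappa> * (1 - no_jump \<delta>) * state_prob t l)"
    by (rule sums_mult[OF sums_state_prob[OF t]])
  ultimately show ?thesis by (rule sums_unique2)
qed

lemma arrivals_shift:
  assumes "\<omega> \<in> good" "0 \<le> t" "0 \<le> \<delta>" "\<not> start (Suc (arrivals t \<omega>)) \<omega> \<le> t + \<delta>"
  shows "arrivals (t + \<delta>) \<omega> = arrivals t \<omega>"
  using start_arrivals[OF assms(1,2)] assms by (intro arrivals_eqI) auto

lemma arrivals_one_jump:
  assumes "\<omega> \<in> good" "0 \<le> t" "0 \<le> \<delta>" "start (Suc (arrivals t \<omega>)) \<omega> \<le> t + \<delta>"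
    "\<not> \<sigma> (Suc (arrivals t \<omega>)) \<omega> \<le> \<delta>"
  shows "arrivals (t + \<delta>) \<omega> = Suc (arrivals t \<omega>)"
proof (rule arrivals_eqI[OF assms(1,4)])
  show "t + \<delta> < start (Suc (Suc (arrivals t \<omega>))) \<omega>"
    using start_arrivals(2)[OF assms(1,2)] assms(5) start_Suc[of "Suc (arrivals t \<omega>)" \<omega>] by linarith
qed

abbreviation trans_prob :: "real \<Rightarrow> real \<Rightarrow> nat \<Rightarrow> nat \<Rightarrow> real" where
  "trans_prob t r l j \<equiv> prob {\<omega> \<in> good. visited \<omega> (arrivals t \<omega>) = l \<and> visited \<omega> (arrivals r \<omega>) = j}"

lemma good_Collect [measurable (raw)]:
  assumes "{\<omega> \<in> space M. P \<omega>} \<in> sets M"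
  shows "{\<omega> \<in> good. P \<omega>} \<in> sets M"
proof -
  have "{\<omega> \<in> good. P \<omega>} = good \<inter> {\<omega> \<in> space M. P \<omega>}" using good_space by blast
  then show ?thesis using sets.Int[OF good_sets assms] by simp
qed

lemma next_start_measurable [measurable]: "(\<lambda>\<omega>. start (Suc (arrivals t \<omega>)) \<omega>) \<in> borel_measurable M"
  by (rule measurable_compose_countable[of "\<lambda>n. start (Suc n)", OF start_measurable arrivals_measurable])

lemma next_noise_measurable:
  "(\<lambda>\<omega>. noise (c (arrivals t \<omega>)) \<omega>) \<in> borel_measurable M"
  by (rule measurable_compose_countable[of "\<lambda>n. noise (c n)", OF noise_measurable arrivals_measurable])

lemma prob_diff_le:
  assumes "A \<in> sets M" "B \<in> sets M" "C \<in> sets M" "A \<subseteq> B \<union> C" "B \<subseteq> A \<union> C"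
  shows "\<bar>prob A - prob B\<bar> \<le> prob C"
proof -
  have "prob A \<le> prob (B \<union> C)" "prob B \<le> prob (A \<union> C)"
    by (rule finite_measure_mono; use assms in auto)+
  moreover have "prob (B \<union> C) \<le> prob B + prob C" "prob (A \<union> C) \<le> prob A + prob C"
    by (rule measure_Un_le; use assms in auto)+
  ultimately show ?thesis by linarith
qed

text \<open>Without an arrival after \<open>t\<close> up to \<open>t + \<delta>\<close> the state
  stays, so the error is at most the probability of an arrival. This holds for any jump rule and
  gives the uniform O(\<delta>) bound.\<close>

lemma trans_prob_crude:
  assumes t: "0 \<le> t" and \<delta>: "0 \<le> \<delta>"
  shows "\<bar>trans_prob t (t + \<delta>) l j - of_bool (j = l) * state_prob t l\<bar> \<le> (1 - no_jump \<delta>) * state_prob t l"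
proof -
  let ?E = "{\<omega> \<in> good. visited \<omega> (arrivals t \<omega>) = l \<and> visited \<omega> (arrivals (t + \<delta>) \<omega>) = j}"
  let ?L = "{\<omega> \<in> good. visited \<omega> (arrivals t \<omega>) = l \<and> j = l}"
  let ?Z = "{\<omega> \<in> good. visited \<omega> (arrivals t \<omega>) = l \<and> start (Suc (arrivals t \<omega>)) \<omega> \<le> t + \<delta>}"
  have sets: "?E \<in> sets M" "?L \<in> sets M" "?Z \<in> sets M"
    by (rule good_Collect, measurable)+
  have "?E \<subseteq> ?L \<union> ?Z"
  proof
    fix \<omega> assume \<omega>: "\<omega> \<in> ?E"
    then show "\<omega> \<in> ?L \<union> ?Z" using arrivals_shift[OF _ t \<delta>, of \<omega>] by auto
  qed
  moreover have "?L \<subseteq> ?E \<union> ?Z"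
  proof
    fix \<omega> assume \<omega>: "\<omega> \<in> ?L"
    then show "\<omega> \<in> ?E \<union> ?Z" using arrivals_shift[OF _ t \<delta>, of \<omega>] by auto
  qed
  ultimately have "\<bar>prob ?E - prob ?L\<bar> \<le> prob ?Z" by (rule prob_diff_le[OF sets])
  moreover have "prob ?L = of_bool (j = l) * state_prob t l" by (cases "j = l") simp_all
  ultimately show ?thesis by (simp only: prob_jump[OF t \<delta>])
qed

text \<open>Either there is no arrival, or there is exactly one and its mark decides the target by
  the rule frozen on the interval. Two arrivals have probability of second order in
  \<delta>.\<close>

lemma trans_prob_fine:
  assumes t: "0 \<le> t" and \<delta>: "0 \<le> \<delta>"
    and J_const: "\<And>u x. u \<in> {t<..t + \<delta>} \<Longrightarrow> J u l x = Jl x"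
    and A: "{x. Jl x = j} \<in> sets borel" and \<kappa>: "\<And>n. prob {\<omega> \<in> space M. \<xi> n \<omega> \<in> {x. Jl x = j}} = \<kappa>"
  shows "\<bar>trans_prob t (t + \<delta>) l j
      - (of_bool (j = l) * no_jump \<delta> + \<kappa> * (1 - no_jump \<delta>)) * state_prob t l\<bar>
    \<le> (1 - no_jump \<delta>)\<^sup>2 * state_prob t l"
proof -
  define v where "v \<omega> = visited \<omega> (arrivals t \<omega>)" for \<omega>
  define v' where "v' \<omega> = visited \<omega> (arrivals (t + \<delta>) \<omega>)" for \<omega>
  define nx where "nx \<omega> = start (Suc (arrivals t \<omega>)) \<omega>" for \<omega>
  define mark where "mark \<omega> = \<xi> (arrivals t \<omega>) \<omega>" for \<omega>
  define wait where "wait \<omega> = \<sigma> (Suc (arrivals t \<omega>)) \<omega>" for \<omega>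
  note [measurable] = A
  have [measurable]: "v \<in> M \<rightarrow>\<^sub>M count_space UNIV" "v' \<in> M \<rightarrow>\<^sub>M count_space UNIV" "nx \<in> borel_measurable M"
    "mark \<in> borel_measurable M" "wait \<in> borel_measurable M"
    using next_noise_measurable[of Inr t] next_noise_measurable[of "\<lambda>n. Inl (Suc n)" t]
      visited_arrivals_measurable next_start_measurable
    unfolding v_def[abs_def] v'_def[abs_def] nx_def[abs_def] mark_def[abs_def] wait_def[abs_def]
    by (simp_all add: noise_def)
  let ?E = "{\<omega> \<in> good. v \<omega> = l \<and> v' \<omega> = j}"
  let ?Stay = "{\<omega> \<in> good. v \<omega> = l \<and> v' \<omega> = j \<and> \<not> nx \<omega> \<le> t + \<delta>}"
  let ?Move = "{\<omega> \<in> good. v \<omega> = l \<and> v' \<omega> = j \<and> nx \<omega> \<le> t + \<delta>}"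
  let ?L = "{\<omega> \<in> good. v \<omega> = l}"
  let ?Z = "{\<omega> \<in> good. v \<omega> = l \<and> nx \<omega> \<le> t + \<delta>}"
  let ?A = "{\<omega> \<in> good. v \<omega> = l \<and> nx \<omega> \<le> t + \<delta> \<and> mark \<omega> \<in> {x. Jl x = j}}"
  \<comment> \<open>Larger than the event of two arrivals in the interval, but its probability
    factorises. Off this set the move is decided by one mark, so \<open>?Move\<close> and
    \<open>?A\<close> agree there.\<close>
  let ?C = "{\<omega> \<in> good. v \<omega> = l \<and> nx \<omega> \<le> t + \<delta> \<and> wait \<omega> \<in> {..\<delta>}}"
  have sets: "?E \<in> sets M" "?Stay \<in> sets M" "?Move \<in> sets M" "?L \<in> sets M" "?Z \<in> sets M" "?A \<in> sets M" "?C \<in> sets M"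
    by (rule good_Collect, measurable)+
  have Z: "prob ?Z = (1 - no_jump \<delta>) * prob ?L"
    unfolding v_def nx_def by (rule prob_jump[OF t \<delta>])
  have PA: "prob ?A = \<kappa> * (1 - no_jump \<delta>) * prob ?L"
    using prob_jump_noise[OF t \<delta> A, of Inr \<kappa> l] \<kappa>
    unfolding v_def nx_def mark_def by (simp add: noise_def past_def image_iff)
  have PC: "prob ?C = (1 - no_jump \<delta>) * (1 - no_jump \<delta>) * prob ?L"
    using prob_jump_noise[OF t \<delta>, of "{..\<delta>}" "\<lambda>n. Inl (Suc n)" "1 - no_jump \<delta>" l] prob_\<sigma>_le[OF \<delta>]
    unfolding v_def nx_def wait_def by (simp add: noise_def past_def image_iff)
  have "?E = ?Stay \<union> ?Move" by auto
  then have PE: "prob ?E = prob ?Stay + prob ?Move"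
    using finite_measure_Union[OF sets(2,3)] by auto
  have PE0: "prob ?Stay = of_bool (j = l) * no_jump \<delta> * prob ?L"
  proof (cases "j = l")
    case True
    have "?Stay = ?L - ?Z"
    proof (intro set_eqI iffI)
      fix \<omega> assume "\<omega> \<in> ?L - ?Z"
      then have "\<omega> \<in> good" "v \<omega> = l" "\<not> nx \<omega> \<le> t + \<delta>" by blast+
      then show "\<omega> \<in> ?Stay" using arrivals_shift[OF _ t \<delta>, of \<omega>] True by (simp add: v_def v'_def nx_def)
    qed blast
    then have "prob ?Stay = prob ?L - prob ?Z"
      using finite_measure_Diff[OF sets(4,5)] by auto
    then show ?thesis unfolding Z using True by (simp add: left_diff_distrib)
  next
    case False
    have "?Stay = {}"
    proof (rule equals0I)
      fix \<omega> assume "\<omega> \<in> ?Stay"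
      then have "\<omega> \<in> good" "v \<omega> = l" "v' \<omega> = j" "\<not> nx \<omega> \<le> t + \<delta>" by blast+
      then show False using arrivals_shift[OF _ t \<delta>, of \<omega>] False by (simp add: v_def v'_def nx_def)
    qed
    then have "prob ?Stay = 0" by (simp only: measure_empty)
    then show ?thesis using False by simp
  qed
  have jump: "v' \<omega> = Jl (mark \<omega>)" if "\<omega> \<in> good" "v \<omega> = l" "nx \<omega> \<le> t + \<delta>" "\<not> wait \<omega> \<le> \<delta>" for \<omega>
  proof -
    have "arrivals (t + \<delta>) \<omega> = Suc (arrivals t \<omega>)"
      using arrivals_one_jump[OF that(1) t \<delta>] that by (simp add: nx_def wait_def)
    then have "v' \<omega> = J (nx \<omega>) (v \<omega>) (mark \<omega>)"
      by (simp add: v'_def v_def nx_def mark_def visited_def)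
    then show ?thesis
      using J_const[of "nx \<omega>"] start_arrivals(2)[OF that(1) t] that by (simp add: nx_def)
  qed
  have "\<bar>prob ?Move - prob ?A\<bar> \<le> prob ?C"
  proof (rule prob_diff_le[OF sets(3,6,7)])
    show "?Move \<subseteq> ?A \<union> ?C" using jump by auto
    show "?A \<subseteq> ?Move \<union> ?C" using jump by auto
  qed
  then have "\<bar>prob ?E - (of_bool (j = l) * no_jump \<delta> + \<kappa> * (1 - no_jump \<delta>)) * prob ?L\<bar>
      \<le> (1 - no_jump \<delta>)\<^sup>2 * prob ?L"
    unfolding PE PE0 PA PC distrib_right power2_eq_square by linarith
  then show ?thesis unfolding v_def v'_def .
qed

lemma prob_proc:
  "prob {\<omega> \<in> space M. proc t \<omega> = l \<and> proc r \<omega> = j} = trans_prob t r l j"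
  "prob {\<omega> \<in> space M. proc t \<omega> = l} = state_prob t l"
proof -
  show "prob {\<omega> \<in> space M. proc t \<omega> = l \<and> proc r \<omega> = j} = trans_prob t r l j"
  proof (rule finite_measure_eq_AE)
    show "AE \<omega> in M. \<omega> \<in> {\<omega> \<in> space M. proc t \<omega> = l \<and> proc r \<omega> = j}
      \<longleftrightarrow> \<omega> \<in> {\<omega> \<in> good. visited \<omega> (arrivals t \<omega>) = l \<and> visited \<omega> (arrivals r \<omega>) = j}"
      using AE_good AE_space by eventually_elim (simp add: proc_def)
    show "{\<omega> \<in> good. visited \<omega> (arrivals t \<omega>) = l \<and> visited \<omega> (arrivals r \<omega>) = j} \<in> sets M"
      by (rule good_Collect) measurable
  qed measurable
  show "prob {\<omega> \<in> space M. proc t \<omega> = l} = state_prob t l"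
  proof (rule finite_measure_eq_AE)
    show "AE \<omega> in M. \<omega> \<in> {\<omega> \<in> space M. proc t \<omega> = l}
      \<longleftrightarrow> \<omega> \<in> {\<omega> \<in> good. visited \<omega> (arrivals t \<omega>) = l}"
      using AE_good AE_space by eventually_elim (simp add: proc_def)
    show "{\<omega> \<in> good. visited \<omega> (arrivals t \<omega>) = l} \<in> sets M"
      by (rule good_Collect) measurable
  qed measurable
qed

lemma proc_cadlag:
  assumes s: "0 \<le> s"
  shows "cadlag_on s T (\<lambda>t. proc t \<omega>)"
proof (cases "\<omega> \<in> good")
  case good: True
  show ?thesis
    unfolding cadlag_on_def
  proof (intro conjI ballI)
    fix t assume t: "t \<in> {s..<T}"
    then have t0: "0 \<le> t" using s by auto
    have "\<forall>\<^sub>F u in at_right t. u \<in> {t<..<start (Suc (arrivals t \<omega>)) \<omega>}"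
      by (rule eventually_at_right_real) (rule start_arrivals(2)[OF good t0])
    then have "\<forall>\<^sub>F u in at_right t. proc u \<omega> = proc t \<omega>"
    proof eventually_elim
      case (elim u)
      have "arrivals u \<omega> = arrivals t \<omega>"
        by (rule arrivals_eqI[OF good]) (use elim start_arrivals(1)[OF good t0] in auto)
      then show ?case by (simp add: proc_def)
    qed
    then show "((\<lambda>t. proc t \<omega>) \<longlongrightarrow> proc t \<omega>) (at_right t)" by (rule tendsto_eventually)
  next
    fix t assume t: "t \<in> {s<..T}"
    \<comment> \<open>The weak inequality selects the period just before \<open>t\<close>, so an
      arrival at \<open>t\<close> itself is not yet counted in the left limit.\<close>
    define n where "n = (LEAST n. t \<le> start (Suc n) \<omega>)"
    have n1: "t \<le> start (Suc n) \<omega>"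
      unfolding n_def by (rule LeastI_ex) (use start_unbounded[OF good, of t] less_imp_le in blast)
    have n2: "start n \<omega> < t"
    proof (cases n)
      case 0 then show ?thesis using t s by simp
    next
      case (Suc m)
      then have "m < n" by simp
      then have "\<not> t \<le> start (Suc m) \<omega>" unfolding n_def by (rule not_less_Least)
      then show ?thesis by (simp add: Suc)
    qed
    have "\<forall>\<^sub>F u in at_left t. u \<in> {start n \<omega><..<t}"
      by (rule eventually_at_left_real[OF n2])
    then have "\<forall>\<^sub>F u in at_left t. proc u \<omega> = visited \<omega> n"
    proof eventually_elim
      case (elim u)
      have "arrivals u \<omega> = n" by (rule arrivals_eqI[OF good]) (use elim n1 in auto)
      then show ?case using good by (simp add: proc_def)
    qed
    then have "((\<lambda>t. proc t \<omega>) \<longlongrightarrow> visited \<omega> n) (at_left t)" by (rule tendsto_eventually)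
    then show "\<exists>l. ((\<lambda>t. proc t \<omega>) \<longlongrightarrow> l) (at_left t)" by blast
  qed
next
  case False
  then have "proc t \<omega> = i" for t by (simp add: proc_def)
  then show ?thesis unfolding cadlag_on_def by (auto intro!: exI[of _ i])
qed

text \<open>At time \<open>t\<close> only the arrivals up to \<open>t\<close> and their marks are
  known. Replacing the later times and marks by constants does not change the state, since the
  skeleton reads the first \<open>arrivals t\<close> entries; the exceptional set belongs to the
  filtration by completeness.\<close>

lemma proc_adapted:
  assumes usual: "usual_conditions M F" and t: "0 \<le> t"
    and known: "\<And>n t x. 0 \<le> t \<Longrightarrow> {\<omega> \<in> space M. (\<Sum>k\<le>n. \<sigma> k \<omega>) \<le> t \<and> \<xi> n \<omega> \<le> x} \<in> sets (F t)"
  shows "proc t \<in> F t \<rightarrow>\<^sub>M count_space UNIV"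
proof -
  note conds = usual[unfolded usual_conditions_def, THEN conjunct2]
  note sub = conds[THEN conjunct1]
    and inc = conds[THEN conjunct2, THEN conjunct1]
    and complete = conds[THEN conjunct2, THEN conjunct2, THEN conjunct2]
  have spF: "space (F t) = space M"
    using sub t by (simp add: subalgebra_def)
  have mono: "sets (F r) \<subseteq> sets (F t)" if "0 \<le> r" "r \<le> t" for r
    using inc that by blast
  have null: "N \<in> sets (F t)" if "N \<subseteq> space M - good" for N
  proof -
    have "space M - good \<in> null_sets M"
    proof -
      have "prob good = 1" using prob_eq_1[OF good_sets] AE_good by blast
      then have "prob (space M - good) = 0" using prob_compl[OF good_sets] by simp
      moreover have "space M - good \<in> sets M" by (rule sets.compl_sets[OF good_sets])
      ultimately show ?thesis by (simp add: null_sets_def emeasure_eq_measure)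
    qed
    then have "N \<in> sets (F 0)" using complete that by blast
    then show ?thesis using mono[OF order_refl t] by blast
  qed
  have good_F: "good \<in> sets (F t)"
  proof -
    have "space M - good \<in> sets (F t)" by (rule null) simp
    then have "space (F t) - (space M - good) \<in> sets (F t)" by (rule sets.compl_sets)
    moreover have "space (F t) - (space M - good) = good" using good_space spF by auto
    ultimately show ?thesis by simp
  qed
  have S: "{\<omega> \<in> space M. start (Suc n) \<omega> \<le> r \<and> \<xi> n \<omega> \<le> x} \<in> sets (F t)" if "r \<le> t" for n r x
  proof (cases "0 \<le> r")
    case True
    then show ?thesis
      using known[OF True, of n x] mono[OF True that] by (auto simp: start_def lessThan_Suc_atMost)
  next
    case False
    show ?thesis
      \<comment> \<open>On \<open>good\<close> arrival times are not negative, so for negative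
        \<open>r\<close> the set lies in the exceptional null set.\<close>
      by (rule null) (use False start_mono[of _ 0 "Suc n"] in force)
  qed
  have S': "{\<omega> \<in> space M. start (Suc n) \<omega> \<le> r} \<in> sets (F t)" if "r \<le> t" for n r
  proof -
    \<comment> \<open>The filtration is given through pairs of arrival and mark; exhausting the
      marks gives the arrival alone.\<close>
    have "{\<omega> \<in> space M. start (Suc n) \<omega> \<le> r} = (\<Union>m::nat. {\<omega> \<in> space M. start (Suc n) \<omega> \<le> r \<and> \<xi> n \<omega> \<le> real m})"
      using real_arch_simple by auto
    also have "\<dots> \<in> sets (F t)" using S[OF that] by (intro sets.countable_UN) auto
    finally show ?thesis .
  qed
  \<comment> \<open>The value \<open>t + 1\<close> only signals that the arrival has not happened
    yet.\<close>
  define X where "X n \<omega> = (if start (Suc n) \<omega> \<le> t then start (Suc n) \<omega> else t + 1)" for n \<omega>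
  define Z where "Z n \<omega> = (if start (Suc n) \<omega> \<le> t then \<xi> n \<omega> else 0)" for n \<omega>
  have X: "X n \<in> borel_measurable (F t)" for n
  proof (rule borel_measurableI_le)
    fix y
    consider "y \<le> t" | "t < y" "y < t + 1" | "t + 1 \<le> y" by linarith
    then show "{\<omega> \<in> space (F t). X n \<omega> \<le> y} \<in> sets (F t)"
    proof cases
      case 1
      then have "{\<omega> \<in> space (F t). X n \<omega> \<le> y} = {\<omega> \<in> space M. start (Suc n) \<omega> \<le> y}"
        by (auto simp: X_def spF)
      then show ?thesis using S'[OF 1] by simp
    next
      case 2
      then have "{\<omega> \<in> space (F t). X n \<omega> \<le> y} = {\<omega> \<in> space M. start (Suc n) \<omega> \<le> t}"
        by (auto simp: X_def spF)
      then show ?thesis using S'[of t] by simp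
    next
      case 3
      then have "{\<omega> \<in> space (F t). X n \<omega> \<le> y} = space (F t)"
        by (auto simp: X_def spF)
      then show ?thesis by simp
    qed
  qed
  have Z: "Z n \<in> borel_measurable (F t)" for n
  proof (rule borel_measurableI_le)
    fix y
    let ?S = "{\<omega> \<in> space M. start (Suc n) \<omega> \<le> t}"
    have "{\<omega> \<in> space (F t). Z n \<omega> \<le> y} = {\<omega> \<in> space M. start (Suc n) \<omega> \<le> t \<and> \<xi> n \<omega> \<le> y}
        \<union> (if 0 \<le> y then space (F t) - ?S else {})"
      by (auto simp: Z_def spF)
    also have "\<dots> \<in> sets (F t)" using S[of t n y] S'[of t n] by (auto intro!: sets.Un sets.compl_sets)
    finally show "{\<omega> \<in> space (F t). Z n \<omega> \<le> y} \<in> sets (F t)" .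
  qed
  have N: "arrivals t \<in> F t \<rightarrow>\<^sub>M count_space UNIV"
    unfolding arrivals_def[abs_def]
  proof (rule measurable_Least)
    fix n
    have "{\<omega> \<in> space (F t). t < start (Suc n) \<omega>} = space (F t) - {\<omega> \<in> space M. start (Suc n) \<omega> \<le> t}"
      by (auto simp: spF)
    also have "\<dots> \<in> sets (F t)" using S'[of t n] by (intro sets.compl_sets) simp
    finally show "(\<lambda>\<omega>. t < start (Suc n) \<omega>) \<in> F t \<rightarrow>\<^sub>M count_space UNIV"
      by (simp add: pred_def)
  qed
  have eq: "proc t \<omega> = (if \<omega> \<in> good then skeleton J i (\<lambda>n. X n \<omega>) (\<lambda>n. Z n \<omega>) (arrivals t \<omega>) else i)" for \<omega>
  proof (cases "\<omega> \<in> good")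
    case True
    have le: "start (Suc k) \<omega> \<le> t" if "k < arrivals t \<omega>" for k
      using start_mono[OF True, of "Suc k" "arrivals t \<omega>"] start_arrivals(1)[OF True t] that by linarith
    have "visited \<omega> (arrivals t \<omega>) = skeleton J i (\<lambda>n. X n \<omega>) (\<lambda>n. Z n \<omega>) (arrivals t \<omega>)"
      unfolding visited_def by (rule skeleton_cong) (use le in \<open>simp_all add: X_def Z_def\<close>)
    then show ?thesis using True by (simp add: proc_def)
  qed (simp add: proc_def)
  have "(\<lambda>\<omega>. skeleton J i (\<lambda>n. X n \<omega>) (\<lambda>n. Z n \<omega>) (arrivals t \<omega>)) \<in> F t \<rightarrow>\<^sub>M count_space UNIV"
    by (rule measurable_compose_countable[OF skeleton_measurable[OF J_meas X Z] N])
  then have "(\<lambda>\<omega>. if \<omega> \<in> good then skeleton J i (\<lambda>n. X n \<omega>) (\<lambda>n. Z n \<omega>) (arrivals t \<omega>) else i) \<in> F t \<rightarrow>\<^sub>M count_space UNIV"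
    using good_F by (intro measurable_If_set measurable_const) (auto simp: spF good_space Int_absorb2)
  then show ?thesis unfolding eq[abs_def] .
qed

end

text \<open>Splitting \<open>(0, 1]\<close> into consecutive intervals of lengths \<open>r j\<close>, one for each state \<open>j\<close> other
  than \<open>l\<close>; the marks that are left over do not move the chain.\<close>

definition level :: "(nat \<Rightarrow> real) \<Rightarrow> nat \<Rightarrow> nat \<Rightarrow> real" where
  "level r l n = (\<Sum>j\<in>{1..<n} - {l}. r j)"

definition jump_to :: "(nat \<Rightarrow> real) \<Rightarrow> nat \<Rightarrow> real \<Rightarrow> nat" where
  "jump_to r l x = (if \<exists>j\<in>states - {l}. x \<in> {level r l j<..level r l (Suc j)}
     then THE j. j \<in> states - {l} \<and> x \<in> {level r l j<..level r l (Suc j)} else l)"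

locale jump_weights =
  fixes r :: "nat \<Rightarrow> real" and l K :: nat
  assumes l: "l \<in> states"
    and r_nonneg: "\<And>j. j \<in> states - {l} \<Longrightarrow> 0 \<le> r j"
    and r_band: "\<And>j. j \<in> states - {l} \<Longrightarrow> j \<notin> nbrs K l \<Longrightarrow> r j = 0"
    and r_total: "(\<Sum>j\<in>nbrs K l. r j) \<le> 1"
begin

definition total :: real where "total = (\<Sum>j\<in>nbrs K l. r j)"

lemma level_Suc: "j \<in> states - {l} \<Longrightarrow> level r l (Suc j) = level r l j + r j"
proof -
  assume j: "j \<in> states - {l}"
  then have "{1..<Suc j} - {l} = insert j ({1..<j} - {l})" by auto
  then show ?thesis by (simp add: level_def)
qed

text \<open>The slot of \<open>l\<close> has length zero, so the slots of the other states are
  adjacent and cover everything up to the total.\<close>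

lemma level_Suc_l: "level r l (Suc l) = level r l l"
proof -
  have "{1..<Suc l} - {l} = {1..<l} - {l}" by auto
  then show ?thesis by (simp add: level_def)
qed

lemma level_0: "level r l 0 = 0" "level r l (Suc 0) = 0"
  by (simp_all add: level_def)

lemma level_mono: "m \<le> n \<Longrightarrow> level r l m \<le> level r l n"
  unfolding level_def by (rule sum_mono2) (use r_nonneg in auto)

lemma level_nonneg: "0 \<le> level r l n"
  using level_mono[of 0 n] level_0 by simp

lemma level_le_total: "level r l n \<le> total"
proof -
  have "level r l n = (\<Sum>j\<in>({1..<n} - {l}) \<inter> nbrs K l. r j)"
    unfolding level_def by (rule sum.mono_neutral_right, simp, blast, intro ballI r_band) auto
  also have "\<dots> \<le> total"
    unfolding total_def by (rule sum_mono2) (use r_nonneg nbrs_states[of K l] in auto)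
  finally show ?thesis .
qed

lemma level_top: "level r l (l + K + 1) = total"
proof -
  have "total = (\<Sum>j\<in>{1..<l + K + 1} - {l}. r j)"
  proof (unfold total_def, rule sum.mono_neutral_left)
    show "nbrs K l \<subseteq> {1..<l + K + 1} - {l}" by (auto simp: nbrs_def)
    show "\<forall>j\<in>{1..<l + K + 1} - {l} - nbrs K l. r j = 0" by (intro ballI r_band) auto
  qed simp
  then show ?thesis by (simp add: level_def)
qed

lemma total_bounds: "0 \<le> total" "total \<le> 1"
  using level_nonneg level_top r_total by (metis, simp add: total_def)

lemma interval_unique:
  assumes "x \<in> {level r l j<..level r l (Suc j)}" "x \<in> {level r l j'<..level r l (Suc j')}"
  shows "j = j'"
proof (rule ccontr)
  assume "j \<noteq> j'"
  then consider "Suc j \<le> j'" | "Suc j' \<le> j" by linarith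
  then show False using assms level_mono[of "Suc j" j'] level_mono[of "Suc j'" j] by cases auto
qed

lemma jump_to_eqI:
  assumes "j \<in> states - {l}" "x \<in> {level r l j<..level r l (Suc j)}"
  shows "jump_to r l x = j"
proof -
  have "(THE j. j \<in> states - {l} \<and> x \<in> {level r l j<..level r l (Suc j)}) = j"
    by (rule the_equality) (use assms interval_unique in blast)+
  then show ?thesis unfolding jump_to_def using assms by (simp only: if_P bexI)
qed

lemma jump_to_other:
  assumes "\<And>j. j \<in> states - {l} \<Longrightarrow> x \<notin> {level r l j<..level r l (Suc j)}"
  shows "jump_to r l x = l"
  unfolding jump_to_def using assms by (meson)

lemma jump_to_states: "jump_to r l x \<in> states"
  using jump_to_eqI jump_to_other l by (metis DiffD1)

lemma jump_to_vimage: "j \<in> states - {l} \<Longrightarrow> {x. jump_to r l x = j} = {level r l j<..level r l (Suc j)}"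
  using jump_to_eqI jump_to_other by (intro set_eqI) (metis (mono_tags, lifting) DiffD2 mem_Collect_eq singletonI)

lemma jump_to_vimage_l: "{x. jump_to r l x = l} = - {0<..total}"
proof (intro set_eqI iffI)
  fix x assume x: "x \<in> {x. jump_to r l x = l}"
  show "x \<in> - {0<..total}"
  proof
    assume x': "x \<in> {0<..total}"
    \<comment> \<open>The least level not below \<open>x\<close> closes the interval containing
      \<open>x\<close>. Its index is at least 2 because the levels 0 and 1 vanish, so its
      predecessor is a state.\<close>
    define n where "n = (LEAST n. x \<le> level r l n)"
    have n: "x \<le> level r l n"
      unfolding n_def by (rule LeastI[of _ "l + K + 1"]) (use x' level_top in simp)
    have "n \<noteq> 0" using n x' level_0(1) by (intro notI) simp
    moreover have "n \<noteq> Suc 0" using n x' level_0(2) by (intro notI) simp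
    ultimately obtain j where j: "n = Suc j" "j \<in> states" by (cases n) auto
    have "\<not> x \<le> level r l j" using j(1) unfolding n_def by (intro not_less_Least) simp
    moreover have "j \<noteq> l" using calculation n level_Suc_l unfolding j(1) by metis
    ultimately have "jump_to r l x = j" using n j by (intro jump_to_eqI) auto
    then show False using x \<open>j \<noteq> l\<close> by simp
  qed
next
  fix x assume "x \<in> - {0<..total}"
  then have "x \<notin> {level r l j<..level r l (Suc j)}" for j
    using level_nonneg[of j] level_le_total[of "Suc j"] by auto
  then show "x \<in> {x. jump_to r l x = l}" using jump_to_other by blast
qed

lemma jump_to_vimage_sets: "{x. jump_to r l x = j} \<in> sets borel"
proof -
  consider "j \<in> states - {l}" | "j = l" | "j \<notin> states" by blast
  then show ?thesis
  proof cases
    case 3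
    then have "{x. jump_to r l x = j} = {}" using jump_to_states by blast
    then show ?thesis by simp
  qed (simp_all only: jump_to_vimage jump_to_vimage_l borel_comp greaterThanAtMost_borel)
qed

lemma jump_to_measurable: "jump_to r l \<in> borel \<rightarrow>\<^sub>M count_space UNIV"
proof (rule measurable_count_space_eq_countable[THEN iffD2])
  show "jump_to r l \<in> space borel \<rightarrow> UNIV \<and> (\<forall>j\<in>UNIV. jump_to r l -` {j} \<inter> space borel \<in> sets borel)"
    using jump_to_vimage_sets by (simp add: vimage_def)
qed simp

lemma measure_jump_to:
  assumes j: "j \<in> states"
  shows "measure (uniform_measure lborel {0..1}) {x. jump_to r l x = j} = (if j = l then 1 - total else r j)"
proof -
  have A: "{x. jump_to r l x = j} \<in> sets lborel" using jump_to_vimage_sets by simp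
  have "measure (uniform_measure lborel {0..1}) {x. jump_to r l x = j} = measure lborel ({0..1} \<inter> {x. jump_to r l x = j})"
    using A by (simp add: measure_def divide_ennreal_def)
  also have "\<dots> = (if j = l then 1 - total else r j)"
  proof (cases "j = l")
    case True
    have "{0..1} \<inter> {x. jump_to r l x = j} = {0..1} - {0<..total}"
      using jump_to_vimage_l True by auto
    moreover have "measure lborel ({0..1} - {0<..total}) = measure lborel {0..1::real} - measure lborel {0<..total}"
      by (rule measure_Diff) (use total_bounds in auto)
    ultimately show ?thesis using True total_bounds by simp
  next
    case False
    then have j': "j \<in> states - {l}" using j by simp
    have "{0..1} \<inter> {x. jump_to r l x = j} = {level r l j<..level r l (Suc j)}"
      unfolding jump_to_vimage[OF j'] using level_nonneg[of j] level_le_total[of "Suc j"] total_bounds by auto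
    then show ?thesis using False level_Suc[OF j'] r_nonneg[OF j'] by simp
  qed
  finally show ?thesis .
qed

end

section \<open>The chain obtained by thinning\<close>

lemma exp_bounds:
  assumes "0 \<le> (x :: real)"
  shows "1 - exp (- x) \<le> x" "x - x\<^sup>2 \<le> 1 - exp (- x)" "0 \<le> 1 - exp (- x)"
proof -
  show "1 - exp (- x) \<le> x" using exp_ge_add_one_self[of "- x"] by simp
  show "0 \<le> 1 - exp (- x)" using assms by simp
  have "exp (- x) \<le> 1 / (1 + x)"
    using exp_ge_add_one_self[of x] assms by (simp add: exp_minus field_simps)
  also have "\<dots> \<le> 1 - x + x\<^sup>2"
  proof -
    \<comment> \<open>The product is \<open>1 + x ^ 3\<close>.\<close>
    have "1 \<le> (1 - x + x\<^sup>2) * (1 + x)" using assms by (simp add: algebra_simps power2_eq_square)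
    then show ?thesis using assms by (simp add: pos_divide_le_eq)
  qed
  finally show "x - x\<^sup>2 \<le> 1 - exp (- x)" by simp
qed

text \<open>Uniformisation: \<open>Q k\<close> is the rate matrix on the time interval from
  \<open>k * d\<close> to \<open>(k + 1) * d\<close>. The arrival intensity \<open>a\<close>
  dominates every exit rate, so an arrival can move the chain from \<open>l\<close> to
  \<open>j\<close> with probability \<open>Q k l j / a\<close>.\<close>

locale controlled_chain = prob_space M for M :: "'w measure" +
  fixes a s d :: real and \<sigma> \<xi> :: "nat \<Rightarrow> 'w \<Rightarrow> real" and Q :: "int \<Rightarrow> nat \<Rightarrow> nat \<Rightarrow> real" and i K :: nat
  assumes a: "0 < a"
    and indep': "indep_vars (\<lambda>_. borel) (\<lambda>k. case k of Inl n \<Rightarrow> \<sigma> n | Inr n \<Rightarrow> \<xi> n) UNIV"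
    and expo': "\<And>n. distributed M lborel (\<sigma> n) (exponential_density a)"
    and unif: "\<And>n. distr M lborel (\<xi> n) = uniform_measure lborel {0..1}"
    and Q_nonneg: "\<And>k l j. l \<in> states \<Longrightarrow> j \<in> states - {l} \<Longrightarrow> 0 \<le> Q k l j"
    and Q_band: "\<And>k l j. l \<in> states \<Longrightarrow> j \<in> states - {l} \<Longrightarrow> j \<notin> nbrs K l \<Longrightarrow> Q k l j = 0"
    and Q_total: "\<And>k l. l \<in> states \<Longrightarrow> (\<Sum>j\<in>nbrs K l. Q k l j) = - Q k l l"
    and Q_le: "\<And>k l. l \<in> states \<Longrightarrow> - Q k l l \<le> a"
    and i: "i \<in> states" and s: "0 \<le> s" and d: "0 < d"
begin

text \<open>The Poisson process runs from time 0; arrivals up to \<open>s\<close> are ignored, so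
  that the chain still sits in its initial state at time \<open>s\<close>.\<close>

definition jump :: "real \<Rightarrow> nat \<Rightarrow> real \<Rightarrow> nat" where
  "jump t l x = (if t \<le> s \<or> l \<notin> states then l else jump_to (\<lambda>j. Q \<lfloor>t / d\<rfloor> l j / a) l x)"

lemma weights: "l \<in> states \<Longrightarrow> jump_weights (\<lambda>j. Q k l j / a) l K"
proof
  assume l: "l \<in> states"
  have "(\<Sum>j\<in>nbrs K l. Q k l j / a) = - Q k l l / a"
    by (simp only: sum_divide_distrib[symmetric] Q_total[OF l])
  also have "\<dots> \<le> a / a" by (rule divide_right_mono[OF Q_le[OF l]]) (use a in simp)
  finally show "(\<Sum>j\<in>nbrs K l. Q k l j / a) \<le> 1" using a by simp
qed (use Q_nonneg Q_band a in auto)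

lemma jump_measurable: "(\<lambda>p. jump (fst p) l (snd p)) \<in> borel \<Otimes>\<^sub>M borel \<rightarrow>\<^sub>M count_space UNIV"
proof (cases "l \<in> states")
  case True
  have k: "(\<lambda>p. \<lfloor>fst p / d\<rfloor>) \<in> borel \<Otimes>\<^sub>M borel \<rightarrow>\<^sub>M count_space UNIV" by measurable
  have "(\<lambda>p. jump_to (\<lambda>j. Q k l j / a) l (snd p)) \<in> borel \<Otimes>\<^sub>M borel \<rightarrow>\<^sub>M count_space UNIV" for k
    by (rule measurable_compose[OF measurable_snd jump_weights.jump_to_measurable[OF weights[OF True]]])
  from measurable_compose_countable[OF this k]
  have [measurable]: "(\<lambda>p. jump_to (\<lambda>j. Q \<lfloor>fst p / d\<rfloor> l j / a) l (snd p)) \<in> borel \<Otimes>\<^sub>M borel \<rightarrow>\<^sub>M count_space UNIV" .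
  have "(\<lambda>p. if fst p \<le> s then l else jump_to (\<lambda>j. Q \<lfloor>fst p / d\<rfloor> l j / a) l (snd p)) \<in> borel \<Otimes>\<^sub>M borel \<rightarrow>\<^sub>M count_space UNIV"
    by measurable
  then show ?thesis using True by (simp add: jump_def)
qed (simp add: jump_def)

lemma jump_before: "t \<le> s \<Longrightarrow> jump t l x = l"
  by (simp add: jump_def)

lemma jump_states: "l \<in> states \<Longrightarrow> jump t l x \<in> states"
  using jump_weights.jump_to_states[OF weights] by (simp add: jump_def)

sublocale marked_poisson M a \<sigma> \<xi> jump i
  by unfold_locales (rule a indep' expo' jump_measurable)+

lemma visited_states: "visited \<omega> n \<in> states"
  unfolding visited_def by (induction n) (use i jump_states in auto)

lemma proc_states: "proc t \<omega> \<in> states"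
  using visited_states i by (auto simp: proc_def)

lemma proc_initial: "proc s \<omega> = i"
proof (cases "\<omega> \<in> good")
  case True
  have "visited \<omega> n = i" if "n \<le> arrivals s \<omega>" for n
    using that
  proof (induction n)
    case (Suc n)
    have "start (Suc n) \<omega> \<le> s"
      using start_mono[OF True Suc.prems] start_arrivals(1)[OF True s] by linarith
    then have "visited \<omega> (Suc n) = visited \<omega> n" by (simp add: visited_def jump_before)
    then show ?case using Suc by simp
  qed (simp add: visited_def)
  then show ?thesis using True by (simp add: proc_def)
qed (simp add: proc_def)

lemma jump_prob:
  assumes l: "l \<in> states" and j: "j \<in> states"
  shows "prob {\<omega> \<in> space M. \<xi> n \<omega> \<in> {x. jump_to (\<lambda>j. Q k l j / a) l x = j}} = of_bool (j = l) + Q k l j / a"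
proof -
  interpret W: jump_weights "\<lambda>j. Q k l j / a" l K by (rule weights[OF l])
  let ?A = "{x. jump_to (\<lambda>j. Q k l j / a) l x = j}"
  have \<xi>: "\<xi> n \<in> M \<rightarrow>\<^sub>M lborel" by simp
  have A: "?A \<in> sets lborel" using W.jump_to_vimage_sets by simp
  have "prob {\<omega> \<in> space M. \<xi> n \<omega> \<in> ?A} = measure (distr M lborel (\<xi> n)) ?A"
    by (subst measure_distr[OF \<xi> A]) (auto intro!: arg_cong[where f = prob])
  also have "\<dots> = (if j = l then 1 - W.total else Q k l j / a)"
    unfolding unif by (rule W.measure_jump_to[OF j])
  also have "\<dots> = of_bool (j = l) + Q k l j / a"
    using Q_total[OF l, of k] by (simp add: W.total_def flip: sum_divide_distrib)
  finally show ?thesis .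
qed

text \<open>Until the end of the current grid interval the rate matrix is constant, as
  \<open>trans_prob_fine\<close> requires. The self-transition in \<kappa> completes the probability
  of no arrival to 1.\<close>

lemma trans_prob_small_time:
  assumes t: "s \<le> t" and \<delta>: "0 \<le> \<delta>" and l: "l \<in> states" and j: "j \<in> states"
    and const: "t + \<delta> < (of_int \<lfloor>t / d\<rfloor> + 1) * d"
  shows "\<bar>trans_prob t (t + \<delta>) l j - (of_bool (j = l) + Q \<lfloor>t / d\<rfloor> l j / a * (1 - exp (- \<delta> * a))) * state_prob t l\<bar>
    \<le> (1 - exp (- \<delta> * a))\<^sup>2 * state_prob t l"
proof -
  let ?k = "\<lfloor>t / d\<rfloor>"
  have "jump u l x = jump_to (\<lambda>j. Q ?k l j / a) l x" if u: "u \<in> {t<..t + \<delta>}" for u x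
  proof -
    have "\<lfloor>u / d\<rfloor> = ?k"
    proof (rule floor_unique)
      have "of_int ?k \<le> t / d" by simp
      also have "\<dots> \<le> u / d" using u d by (simp add: divide_right_mono)
      finally show "of_int ?k \<le> u / d" .
      have "u < (of_int ?k + 1) * d" using u const by simp
      then show "u / d < of_int ?k + 1" using d by (simp add: pos_divide_less_eq)
    qed
    then show ?thesis using u t l by (simp add: jump_def)
  qed
  from trans_prob_fine[OF _ \<delta> this jump_weights.jump_to_vimage_sets[OF weights[OF l]] jump_prob[OF l j]]
  have "\<bar>trans_prob t (t + \<delta>) l j
      - (of_bool (j = l) * no_jump \<delta> + (of_bool (j = l) + Q ?k l j / a) * (1 - no_jump \<delta>)) * state_prob t l\<bar>
    \<le> (1 - no_jump \<delta>)\<^sup>2 * state_prob t l"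
    using t s by simp
  moreover have "of_bool (j = l) * no_jump \<delta> + (of_bool (j = l) + Q ?k l j / a) * (1 - no_jump \<delta>)
      = of_bool (j = l) + Q ?k l j / a * (1 - exp (- \<delta> * a))"
    by (simp add: algebra_simps)
  ultimately show ?thesis by simp
qed

end

section \<open>Feedback controls\<close>

text \<open>Conditioning on a countably valued \<open>X\<close> is elementary: the identity on each
  level set sums to the identity on every set of \<open>A\<close>. The hypothesis on
  \<open>A\<close> is stated for sets because the information consists of state and action, and the
  action will be a function of the state.\<close>

lemma (in prob_space) real_cond_exp_state:
  fixes X :: "'a \<Rightarrow> nat"
  assumes sub: "subalgebra M A" and X: "X \<in> A \<rightarrow>\<^sub>M count_space UNIV"
    and gen: "\<And>S. S \<in> sets A \<Longrightarrow> \<exists>N. S = {\<omega> \<in> space M. X \<omega> \<in> N}"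
    and E: "E \<in> sets M"
    and r: "\<And>l. r l * prob {\<omega> \<in> space M. X \<omega> = l} = prob {\<omega> \<in> space M. X \<omega> = l \<and> \<omega> \<in> E}"
    and bound: "\<And>\<omega>. \<omega> \<in> space M \<Longrightarrow> \<bar>r (X \<omega>)\<bar> \<le> (c :: real)"
  shows "AE \<omega> in M. real_cond_exp M A (indicator E) \<omega> = r (X \<omega>)"
proof -
  interpret sa: finite_measure_subalgebra M A by unfold_locales (rule sub)
  have XM: "X \<in> M \<rightarrow>\<^sub>M count_space UNIV" by (rule measurable_from_subalg[OF sub X])
  have rA: "(\<lambda>\<omega>. r (X \<omega>)) \<in> borel_measurable A" by (rule measurable_compose[OF X]) simp
  have rM: "(\<lambda>\<omega>. r (X \<omega>)) \<in> borel_measurable M" by (rule measurable_from_subalg[OF sub rA])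
  have r_int: "integrable M (\<lambda>\<omega>. r (X \<omega>))"
    by (rule integrable_const_bound[of _ c]) (use bound rM in \<open>auto intro: AE_I2\<close>)
  have E_int: "integrable M (indicator E :: 'a \<Rightarrow> real)"
    by (rule integrable_real_indicator) (use E in \<open>auto simp: emeasure_eq_measure\<close>)
  have level: "{\<omega> \<in> space M. X \<omega> = l} \<in> sets M" for l
    using measurable_sets[OF XM, of "{l}"] by (simp add: vimage_def Int_def conj_commute)
  show ?thesis
  proof (rule sa.real_cond_exp_charact[OF _ E_int r_int rA])
    fix S assume S: "S \<in> sets A"
    then obtain N where N: "S = {\<omega> \<in> space M. X \<omega> \<in> N}" using gen by blast
    have SM: "S \<in> sets M" using S sub by (auto simp: subalgebra_def)
    let ?Z1 = "\<lambda>\<omega>. indicator S \<omega> * indicator E \<omega> :: real" and ?Z2 = "\<lambda>\<omega>. indicator S \<omega> * r (X \<omega>)"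
    have Z1: "integrable M ?Z1"
      using integrable_real_mult_indicator[OF SM E_int] by (simp add: mult.commute)
    have Z2: "integrable M ?Z2"
      using integrable_real_mult_indicator[OF SM r_int] by (simp add: mult.commute)
    have e1: "expectation (\<lambda>\<omega>. indicator {\<omega> \<in> space M. X \<omega> = l} \<omega> * ?Z1 \<omega>)
        = of_bool (l \<in> N) * prob {\<omega> \<in> space M. X \<omega> = l \<and> \<omega> \<in> E}" for l
    proof -
      have "expectation (\<lambda>\<omega>. indicator {\<omega> \<in> space M. X \<omega> = l} \<omega> * ?Z1 \<omega>)
          = expectation (\<lambda>\<omega>. of_bool (l \<in> N) * indicator {\<omega> \<in> space M. X \<omega> = l \<and> \<omega> \<in> E} \<omega>)"
        by (rule Bochner_Integration.integral_cong) (auto simp: N indicator_def)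
      moreover have "{\<omega> \<in> space M. X \<omega> = l \<and> \<omega> \<in> E} \<inter> space M = {\<omega> \<in> space M. X \<omega> = l \<and> \<omega> \<in> E}" by auto
      ultimately show ?thesis by simp
    qed
    have e2: "expectation (\<lambda>\<omega>. indicator {\<omega> \<in> space M. X \<omega> = l} \<omega> * ?Z2 \<omega>)
        = of_bool (l \<in> N) * (r l * prob {\<omega> \<in> space M. X \<omega> = l})" for l
    proof -
      have "expectation (\<lambda>\<omega>. indicator {\<omega> \<in> space M. X \<omega> = l} \<omega> * ?Z2 \<omega>)
          = expectation (\<lambda>\<omega>. (of_bool (l \<in> N) * r l) * indicator {\<omega> \<in> space M. X \<omega> = l} \<omega>)"
        by (rule Bochner_Integration.integral_cong) (auto simp: N indicator_def)
      moreover have "{\<omega> \<in> space M. X \<omega> = l} \<inter> space M = {\<omega> \<in> space M. X \<omega> = l}" by auto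
      ultimately show ?thesis by simp
    qed
    have "expectation ?Z1 = expectation ?Z2"
      using expectation_partition_sums[OF Z1 XM] expectation_partition_sums[OF Z2 XM]
      unfolding e1 e2 r by (rule sums_unique2)
    then show "(\<integral>\<omega>\<in>S. indicator E \<omega> \<partial>M) = (\<integral>\<omega>\<in>S. r (X \<omega>) \<partial>M)"
      by (simp add: set_lebesgue_integral_def)
  qed
qed

lemma abs_diff_scaled:
  assumes "0 < (P :: real)" shows "\<bar>p - c * P\<bar> / P = \<bar>p / P - c\<bar>"
proof -
  have "p / P - c = (p - c * P) / P" using assms by (simp add: diff_divide_distrib)
  then show ?thesis using assms by (simp add: abs_divide)
qed

lemma delay_controls_controlled_process:
  assumes sol: "classical_solution U q f g T Mq C0 Cf Cg K w B" and prob: "prob_space M"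
    and q_cont: "\<And>i j. i \<in> states \<Longrightarrow> j \<in> states \<Longrightarrow>
        continuous_map (weak_topology U) euclideanreal (q i j)"
    and sub: "\<And>t. 0 \<le> t \<Longrightarrow> subalgebra M (F t)"
    and s: "s \<in> {0..<T}" and i: "i \<in> states"
    and control: "(\<Lambda>, \<mu>) \<in> delay_controls M F T U q m r0 s i"
  shows "controlled_process U q f g T Mq C0 Cf Cg K w B M s i \<Lambda> \<mu>"
proof -
  note c = control[unfolded delay_controls_def mem_Collect_eq prod.case]
  have "\<Lambda> t \<in> M \<rightarrow>\<^sub>M count_space states" if "t \<in> {s..T}" for t
  proof (rule measurable_from_subalg[OF sub[of t]])
    show "0 \<le> t" using that s by auto
    show "\<Lambda> t \<in> F t \<rightarrow>\<^sub>M count_space states" using c that by blast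
  qed
  then have \<Lambda>: "\<And>t. t \<in> {s..T} \<Longrightarrow> \<Lambda> t \<in> M \<rightarrow>\<^sub>M count_space states" .
  have c': "\<And>\<omega>. \<omega> \<in> space M \<Longrightarrow> cadlag_on s T (\<lambda>t. \<Lambda> t \<omega>)" "AE \<omega> in M. \<Lambda> s \<omega> = i"
    "(\<lambda>(t, \<omega>). \<mu> t \<omega>) \<in> restrict_space borel {s..T} \<Otimes>\<^sub>M M \<rightarrow>\<^sub>M borel_prob U"
    "has_controlled_rates M T U q s \<Lambda> \<mu>"
    using c by blast+
  show ?thesis
    by (intro controlled_process.intro controlled_process_axioms.intro sol prob q_cont s i \<Lambda> c')
qed

locale feedback_chain =
  classical_solution U q f g T Mq C0 Cf Cg K w B +
  controlled_chain M a s d \<sigma> \<xi> "\<lambda>k l j. q l j (\<pi> k l)" i K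
  for U :: "'u::topological_space set" and q f g T Mq C0 Cf Cg K w B
    and M :: "'w measure" and a s d \<sigma> \<xi> i and \<pi> :: "int \<Rightarrow> nat \<Rightarrow> 'u measure" +
  fixes F :: "real \<Rightarrow> 'w measure"
  assumes usual: "usual_conditions M F"
    and known: "\<And>n t x. 0 \<le> t \<Longrightarrow> {\<omega> \<in> space M. (\<Sum>k\<le>n. \<sigma> k \<omega>) \<le> t \<and> \<xi> n \<omega> \<le> x} \<in> sets (F t)"
    and \<pi>_mem: "\<And>k l. \<pi> k l \<in> prob_measures U"
    and sT: "s < T"
begin

definition action :: "real \<Rightarrow> 'w \<Rightarrow> 'u measure" where
  "action t \<omega> = \<pi> \<lfloor>t / d\<rfloor> (proc t \<omega>)"

lemma to_states_measurable:
  assumes "h \<in> N \<rightarrow>\<^sub>M count_space UNIV" "\<And>x. x \<in> space N \<Longrightarrow> h x \<in> states"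
  shows "h \<in> N \<rightarrow>\<^sub>M count_space states"
proof (rule measurable_count_space_eq_countable[THEN iffD2])
  show "h \<in> space N \<rightarrow> states \<and> (\<forall>l\<in>states. h -` {l} \<inter> space N \<in> sets N)"
    using assms measurable_sets[OF assms(1)] by auto
qed simp

lemma proc_states_measurable: "proc t \<in> M \<rightarrow>\<^sub>M count_space states"
  by (rule to_states_measurable[OF proc_measurable]) (rule proc_states)

lemma time_feedback_measurable:
  assumes t: "\<tau> \<in> borel_measurable N" and l: "l \<in> N \<rightarrow>\<^sub>M count_space states"
  shows "(\<lambda>x. \<pi> \<lfloor>\<tau> x / d\<rfloor> (l x)) \<in> N \<rightarrow>\<^sub>M borel_prob U"
proof -
  have k: "(\<lambda>x. \<lfloor>\<tau> x / d\<rfloor>) \<in> N \<rightarrow>\<^sub>M count_space UNIV" using t by measurable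
  have "(\<lambda>x. \<pi> k l) \<in> N \<rightarrow>\<^sub>M borel_prob U" for k l
    by (rule measurable_const) (simp add: space_borel_prob \<pi>_mem)
  from measurable_compose_countable[where f = "\<lambda>k x. \<pi> k _", OF this k]
  have "(\<lambda>x. \<pi> \<lfloor>\<tau> x / d\<rfloor> l) \<in> N \<rightarrow>\<^sub>M borel_prob U" for l .
  from measurable_compose_countable'[where f = "\<lambda>l x. \<pi> \<lfloor>\<tau> x / d\<rfloor> l", OF this l] show ?thesis by simp
qed

lemma action_joint: "(\<lambda>(t, \<omega>). action t \<omega>) \<in> restrict_space borel {s..T} \<Otimes>\<^sub>M M \<rightarrow>\<^sub>M borel_prob U"
proof -
  let ?P = "restrict_space borel {s..T} \<Otimes>\<^sub>M M"
  have "(\<lambda>(t, \<omega>). proc t \<omega>) \<in> ?P \<rightarrow>\<^sub>M count_space states"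
    by (rule cadlag_jointly_measurable[OF proc_states_measurable proc_cadlag[OF s] sT])
  then have l: "(\<lambda>p. proc (fst p) (snd p)) \<in> ?P \<rightarrow>\<^sub>M count_space states" by (simp add: split_beta)
  have "(\<lambda>t. t) \<in> borel_measurable (restrict_space borel {s..T})" by (rule measurable_restrict_space1) simp
  from measurable_compose[OF measurable_fst this] have t: "fst \<in> borel_measurable ?P" .
  show ?thesis
    using time_feedback_measurable[OF t l] by (simp add: action_def split_beta)
qed

lemma action_measurable: "t \<in> {s..T} \<Longrightarrow> action t \<in> M \<rightarrow>\<^sub>M borel_prob U"
  unfolding action_def[abs_def] by (rule time_feedback_measurable[OF _ proc_states_measurable]) simp

text \<open>The expansion is demanded for every state and every action, also where the conditional
  probability is undetermined because the pair has probability zero. There the affine expression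
  itself is chosen, with remainder zero.\<close>

definition kernel :: "real \<Rightarrow> real \<Rightarrow> nat \<Rightarrow> nat \<Rightarrow> 'u measure \<Rightarrow> real" where
  "kernel t \<delta> l j \<nu> = (if \<nu> = \<pi> \<lfloor>t / d\<rfloor> l \<and> 0 < state_prob t l
     then trans_prob t (t + \<delta>) l j / state_prob t l else of_bool (j = l) + q l j \<nu> * \<delta>)"

lemma trans_prob_le: "trans_prob t r l j \<le> state_prob t l"
proof -
  have "{\<omega> \<in> space M. proc t \<omega> = l \<and> proc r \<omega> = j} \<subseteq> {\<omega> \<in> space M. proc t \<omega> = l}" by blast
  then show ?thesis unfolding prob_proc[symmetric] by (rule finite_measure_mono) measurable
qed

lemma kernel_cond_exp:
  assumes t: "t \<in> {s..<T}" and \<delta>: "\<delta> \<in> {0<..T - t}" and j: "j \<in> states"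
  shows "AE \<omega> in M. real_cond_exp M (current_info M U (proc t) (action t))
      (indicator {\<omega> \<in> space M. proc (t + \<delta>) \<omega> = j}) \<omega> = kernel t \<delta> (proc t \<omega>) j (action t \<omega>)"
proof -
  let ?A = "current_info M U (proc t) (action t)" and ?k = "\<lfloor>t / d\<rfloor>"
  let ?X = "\<lambda>\<omega>. (proc t \<omega>, action t \<omega>)" and ?N = "count_space states \<Otimes>\<^sub>M borel_prob U"
  have t': "t \<in> {s..T}" using t by auto
  have X: "?X \<in> M \<rightarrow>\<^sub>M ?N" by (intro measurable_Pair proc_states_measurable action_measurable t')
  have setsA: "sets ?A = {?X -` S \<inter> space M | S. S \<in> sets ?N}"
    unfolding current_info_def by (rule sets_vimage_algebra2) (use measurable_space[OF X] in blast)
  have sub: "subalgebra M ?A"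
    unfolding subalgebra_def
  proof
    show "space ?A = space M" by (simp add: current_info_def)
    show "sets ?A \<subseteq> sets M" unfolding setsA using measurable_sets[OF X] by blast
  qed
  have "?X \<in> ?A \<rightarrow>\<^sub>M ?N"
    unfolding current_info_def by (rule measurable_vimage_algebra1) (use measurable_space[OF X] in blast)
  from measurable_compose[OF this measurable_fst] have "proc t \<in> ?A \<rightarrow>\<^sub>M count_space states" by simp
  from measurable_compose[OF this, of "\<lambda>x. x" "count_space UNIV"]
  have XA: "proc t \<in> ?A \<rightarrow>\<^sub>M count_space UNIV" by simp
  have "AE \<omega> in M. real_cond_exp M ?A (indicator {\<omega> \<in> space M. proc (t + \<delta>) \<omega> = j}) \<omega>
      = (\<lambda>l. kernel t \<delta> l j (\<pi> ?k l)) (proc t \<omega>)"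
  proof (rule real_cond_exp_state[OF sub XA])
    fix S assume "S \<in> sets ?A"
    then obtain R where "S = ?X -` R \<inter> space M" unfolding setsA by blast
    \<comment> \<open>At a fixed time the action is a function of the state, so the pair carries no
      more information than the state.\<close>
    then have "S = {\<omega> \<in> space M. proc t \<omega> \<in> {l. (l, \<pi> ?k l) \<in> R}}" by (auto simp: action_def)
    then show "\<exists>N. S = {\<omega> \<in> space M. proc t \<omega> \<in> N}" by blast
  next
    show "{\<omega> \<in> space M. proc (t + \<delta>) \<omega> = j} \<in> sets M" by measurable
  next
    fix l
    have eq: "{\<omega> \<in> space M. proc t \<omega> = l \<and> \<omega> \<in> {\<omega> \<in> space M. proc (t + \<delta>) \<omega> = j}}
        = {\<omega> \<in> space M. proc t \<omega> = l \<and> proc (t + \<delta>) \<omega> = j}" by blast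
    show "kernel t \<delta> l j (\<pi> ?k l) * prob {\<omega> \<in> space M. proc t \<omega> = l}
        = prob {\<omega> \<in> space M. proc t \<omega> = l \<and> \<omega> \<in> {\<omega> \<in> space M. proc (t + \<delta>) \<omega> = j}}"
    proof (cases "0 < state_prob t l")
      case True
      then show ?thesis unfolding eq prob_proc kernel_def by simp
    next
      case False
      then have "state_prob t l = 0" using measure_nonneg[of M "{\<omega> \<in> good. visited \<omega> (arrivals t \<omega>) = l}"] by linarith
      moreover from this have "trans_prob t (t + \<delta>) l j = 0"
        using trans_prob_le[of t l "t + \<delta>" j]
          measure_nonneg[of M "{\<omega> \<in> good. visited \<omega> (arrivals t \<omega>) = l \<and> visited \<omega> (arrivals (t + \<delta>) \<omega>) = j}"] by linarith
      ultimately show ?thesis unfolding eq prob_proc by simp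
    qed
  next
    fix \<omega> assume "\<omega> \<in> space M"
    let ?l = "proc t \<omega>"
    have l: "?l \<in> states" by (rule proc_states)
    show "\<bar>kernel t \<delta> ?l j (\<pi> ?k ?l)\<bar> \<le> 1 + Mq * \<delta>"
    proof (cases "0 < state_prob t ?l")
      case True
      then have "trans_prob t (t + \<delta>) ?l j / state_prob t ?l \<le> 1"
        using trans_prob_le by (simp add: divide_le_eq_1)
      moreover have "0 \<le> trans_prob t (t + \<delta>) ?l j / state_prob t ?l" by simp
      moreover have "0 \<le> Mq * \<delta>" using Mq_nonneg \<delta> by simp
      moreover have "kernel t \<delta> ?l j (\<pi> ?k ?l) = trans_prob t (t + \<delta>) ?l j / state_prob t ?l"
        using True by (simp only: kernel_def simp_thms if_True)
      ultimately show ?thesis by linarith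
    next
      case False
      have "\<bar>q ?l j (\<pi> ?k ?l) * \<delta>\<bar> \<le> Mq * \<delta>"
        unfolding abs_mult using rate_abs_le[OF l j \<pi>_mem] \<delta> Mq_nonneg by (intro mult_mono) auto
      then show ?thesis unfolding kernel_def using False by (auto simp: of_bool_def)
    qed
  qed
  then show ?thesis by (simp add: action_def)
qed

text \<open>The summand \<open>a\<close> comes from the probability of an arrival, the summand
  \<open>Mq\<close> from the linear term that is subtracted.\<close>

lemma kernel_bound:
  assumes t: "t \<in> {s..<T}" and \<delta>: "\<delta> \<in> {0<..T - t}" and l: "l \<in> states" and j: "j \<in> states"
    and \<nu>: "\<nu> \<in> prob_measures U"
  shows "\<bar>kernel t \<delta> l j \<nu> - (of_bool (j = l) + q l j \<nu> * \<delta>)\<bar> \<le> (a + Mq) * \<delta>"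
proof (cases "\<nu> = \<pi> \<lfloor>t / d\<rfloor> l \<and> 0 < state_prob t l")
  case True
  let ?P = "state_prob t l" and ?p = "trans_prob t (t + \<delta>) l j"
  have \<delta>0: "0 \<le> \<delta>" and t0: "0 \<le> t" using \<delta> t s by auto
  have "\<bar>?p - of_bool (j = l) * ?P\<bar> \<le> (1 - exp (- \<delta> * a)) * ?P" by (rule trans_prob_crude[OF t0 \<delta>0])
  also have "\<dots> \<le> (\<delta> * a) * ?P"
    using exp_bounds(1)[of "\<delta> * a"] \<delta>0 a by (intro mult_right_mono) auto
  finally have "\<bar>?p - of_bool (j = l) * ?P\<bar> / ?P \<le> \<delta> * a" using True by (simp add: pos_divide_le_eq)
  moreover have "\<bar>?p - of_bool (j = l) * ?P\<bar> / ?P = \<bar>?p / ?P - of_bool (j = l)\<bar>"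
    using True by (intro abs_diff_scaled) simp
  moreover have "\<bar>q l j \<nu> * \<delta>\<bar> \<le> Mq * \<delta>"
    unfolding abs_mult using rate_abs_le[OF l j \<nu>] \<delta>0 Mq_nonneg by (intro mult_mono) auto
  ultimately have "\<bar>?p / ?P - (of_bool (j = l) + q l j \<nu> * \<delta>)\<bar> \<le> \<delta> * a + Mq * \<delta>" by linarith
  then show ?thesis unfolding kernel_def using True by (simp add: algebra_simps)
next
  case False
  then have "kernel t \<delta> l j \<nu> = of_bool (j = l) + q l j \<nu> * \<delta>" unfolding kernel_def by (rule if_not_P)
  then show ?thesis using a Mq_nonneg \<delta> by simp
qed

lemma kernel_smallo:
  assumes t: "t \<in> {s..<T}" and l: "l \<in> states" and j: "j \<in> states" and \<nu>: "\<nu> \<in> prob_measures U"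
  shows "(\<lambda>\<delta>. kernel t \<delta> l j \<nu> - (of_bool (j = l) + q l j \<nu> * \<delta>)) \<in> o[at_right 0](\<lambda>\<delta>. \<delta>)"
proof (cases "\<nu> = \<pi> \<lfloor>t / d\<rfloor> l \<and> 0 < state_prob t l")
  case True
  let ?P = "state_prob t l" and ?k = "\<lfloor>t / d\<rfloor>"
  have t0: "0 \<le> t" "s \<le> t" using t s by auto
  \<comment> \<open>The distance to the next grid point, positive at every time, also at grid
    points, because the intervals are closed on the left.\<close>
  define \<delta>0 where "\<delta>0 = (of_int ?k + 1) * d - t"
  have "t / d < of_int ?k + 1" by linarith
  from this[unfolded pos_divide_less_eq[OF d]] have \<delta>0: "0 < \<delta>0" unfolding \<delta>0_def by simp
  \<comment> \<open>The square of \<open>a\<close> bounds the chance of two arrivals;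
    \<open>Mq * a\<close> is the price of replacing the arrival probability \<open>?b\<close> by
    \<open>\<delta> * a\<close>.\<close>
  have est: "\<bar>kernel t \<delta> l j \<nu> - (of_bool (j = l) + q l j \<nu> * \<delta>)\<bar> \<le> (a\<^sup>2 + Mq * a) * \<delta>\<^sup>2"
    if \<delta>: "0 < \<delta>" "\<delta> < \<delta>0" for \<delta>
  proof -
    let ?p = "trans_prob t (t + \<delta>) l j" and ?b = "1 - exp (- \<delta> * a)"
    have x: "0 \<le> \<delta> * a" using \<delta> a by simp
    have "\<bar>?p - (of_bool (j = l) + q l j (\<pi> ?k l) / a * ?b) * ?P\<bar> \<le> ?b\<^sup>2 * ?P"
      by (rule trans_prob_small_time[OF t0(2) _ l j]) (use \<delta> in \<open>auto simp: \<delta>0_def\<close>)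
    then have "\<bar>?p - (of_bool (j = l) + q l j \<nu> / a * ?b) * ?P\<bar> / ?P \<le> ?b\<^sup>2"
      using True by (simp add: pos_divide_le_eq)
    moreover have "\<bar>?p - (of_bool (j = l) + q l j \<nu> / a * ?b) * ?P\<bar> / ?P
        = \<bar>?p / ?P - (of_bool (j = l) + q l j \<nu> / a * ?b)\<bar>"
      using True by (intro abs_diff_scaled) simp
    ultimately have 1: "\<bar>?p / ?P - (of_bool (j = l) + q l j \<nu> / a * ?b)\<bar> \<le> ?b\<^sup>2" by simp
    have 2: "?b\<^sup>2 \<le> (\<delta> * a)\<^sup>2"
      using exp_bounds(1,3)[OF x] by (intro power_mono) auto
    have "\<bar>?b - \<delta> * a\<bar> \<le> (\<delta> * a)\<^sup>2" using exp_bounds(1,2)[OF x] by simp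
    then have "\<bar>q l j \<nu> / a\<bar> * \<bar>?b - \<delta> * a\<bar> \<le> (Mq / a) * (\<delta> * a)\<^sup>2"
      using rate_abs_le[OF l j \<nu>] a Mq_nonneg by (intro mult_mono) (auto simp: abs_divide divide_right_mono)
    moreover have "q l j \<nu> / a * (?b - \<delta> * a) = q l j \<nu> / a * ?b - q l j \<nu> * \<delta>"
      using a by (simp add: right_diff_distrib)
    ultimately have 3: "\<bar>q l j \<nu> / a * ?b - q l j \<nu> * \<delta>\<bar> \<le> (Mq / a) * (\<delta> * a)\<^sup>2"
      by (metis abs_mult)
    have "\<bar>?p / ?P - (of_bool (j = l) + q l j \<nu> * \<delta>)\<bar> \<le> (\<delta> * a)\<^sup>2 + (Mq / a) * (\<delta> * a)\<^sup>2"
      using 1 2 3 by linarith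
    also have "\<dots> = (a\<^sup>2 + Mq * a) * \<delta>\<^sup>2"
      using a by (simp add: power2_eq_square field_simps)
    finally show ?thesis unfolding kernel_def using True by simp
  qed
  show ?thesis
  proof (rule smalloI_tendsto)
    show "((\<lambda>\<delta>. (kernel t \<delta> l j \<nu> - (of_bool (j = l) + q l j \<nu> * \<delta>)) / \<delta>) \<longlongrightarrow> 0) (at_right 0)"
    proof (rule Lim_null_comparison)
      have "\<forall>\<^sub>F \<delta> in at_right 0. \<delta> \<in> {0<..<\<delta>0}" by (rule eventually_at_right_real[OF \<delta>0])
      then show "\<forall>\<^sub>F \<delta> in at_right 0. norm ((kernel t \<delta> l j \<nu> - (of_bool (j = l) + q l j \<nu> * \<delta>)) / \<delta>)
          \<le> (a\<^sup>2 + Mq * a) * \<delta>"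
      proof eventually_elim
        case (elim \<delta>)
        then have "\<bar>kernel t \<delta> l j \<nu> - (of_bool (j = l) + q l j \<nu> * \<delta>)\<bar> \<le> ((a\<^sup>2 + Mq * a) * \<delta>) * \<delta>"
          using est[of \<delta>] by (simp add: power2_eq_square mult.assoc)
        then show ?case using elim by (simp add: abs_divide pos_divide_le_eq)
      qed
      have "((\<lambda>\<delta>. (a\<^sup>2 + Mq * a) * \<delta>) \<longlongrightarrow> (a\<^sup>2 + Mq * a) * 0) (at_right (0::real))"
        by (intro tendsto_mult tendsto_const tendsto_ident_at)
      then show "((\<lambda>\<delta>. (a\<^sup>2 + Mq * a) * \<delta>) \<longlongrightarrow> 0) (at_right (0::real))" by simp
    qed
    show "\<forall>\<^sub>F \<delta>::real in at_right 0. \<delta> \<noteq> 0" by (simp add: eventually_at_filter)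
  qed
next
  case False
  have "(\<lambda>\<delta>. kernel t \<delta> l j \<nu> - (of_bool (j = l) + q l j \<nu> * \<delta>)) = (\<lambda>\<delta>. 0)"
    unfolding kernel_def if_not_P[OF False] by simp
  then show ?thesis by simp
qed

lemma feedback_control: "(proc, action) \<in> delay_controls M F T U q m r0 s i"
  unfolding delay_controls_def mem_Collect_eq prod.case
proof (intro conjI ballI)
  fix t assume t: "t \<in> {s..T}"
  then have t0: "0 \<le> t" using s by auto
  show "proc t \<in> F t \<rightarrow>\<^sub>M count_space states"
    by (rule to_states_measurable[OF proc_adapted[OF usual t0 known] proc_states])
next
  fix \<omega>
  show "cadlag_on s T (\<lambda>t. proc t \<omega>)" by (rule proc_cadlag[OF s])
next
  show "AE \<omega> in M. proc s \<omega> = i" by (simp add: proc_initial)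
next
  show "(\<lambda>(t, \<omega>). action t \<omega>) \<in> restrict_space borel {s..T} \<Otimes>\<^sub>M M \<rightarrow>\<^sub>M borel_prob U" by (rule action_joint)
next
  show "has_controlled_rates M T U q s proc action"
    unfolding has_controlled_rates_def
    by (rule exI[of _ kernel], rule exI[of _ "a + Mq"])
      (intro ballI conjI kernel_cond_exp kernel_smallo kernel_bound)
next
  let ?N = "restrict_space borel {0..T} \<Otimes>\<^sub>M (\<Pi>\<^sub>M k\<in>{..m}. count_space states)"
  have "(\<lambda>t. t) \<in> borel_measurable (restrict_space borel {0..T})" by (rule measurable_restrict_space1) simp
  from measurable_compose[OF measurable_fst this] have t: "fst \<in> borel_measurable ?N" .
  \<comment> \<open>The feedback map reads coordinate 0, the path without delay, which is present
    for every \<open>m\<close>.\<close>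
  have "(\<lambda>x. x 0) \<in> (\<Pi>\<^sub>M k\<in>{..m}. count_space states) \<rightarrow>\<^sub>M count_space states"
    by (rule measurable_component_singleton) simp
  from measurable_compose[OF measurable_snd this]
  have l: "(\<lambda>p. snd p 0) \<in> ?N \<rightarrow>\<^sub>M count_space states" .
  show "\<exists>h \<in> ?N \<rightarrow>\<^sub>M borel_prob U. AE t in lborel. t \<in> {s..T} \<longrightarrow>
      (AE \<omega> in M. action t \<omega> = h (t, \<lambda>k\<in>{..m}. delay_path s r0 k (\<lambda>u. proc u \<omega>) t))"
    by (rule bexI[OF _ time_feedback_measurable[OF t l]]) (simp add: action_def delay_path_def max_absorb1)
qed

end

section \<open>The value function\<close>

context classical_solution
begin

lemma near_optimizer:
  assumes "0 < e"
  shows "\<exists>\<mu>\<in>prob_measures U. generator q \<mu> u l + f t l \<mu> \<le> H t l u + e"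
proof (rule ccontr)
  assume "\<not> ?thesis"
  then have "H t l u + e \<le> generator q \<mu> u l + f t l \<mu>" if "\<mu> \<in> prob_measures U" for \<mu>
    using that by (meson le_cases)
  then have "H t l u + e \<le> H t l u" by (rule hamiltonian_greatest)
  then show False using assms by simp
qed

text \<open>Moving the time from \<open>r\<close> to \<open>t\<close> changes the cost of a fixed
  action and the infimum by at most \<open>(2 * Mq * CH + C0) * \<bar>t - r\<bar>\<close> each,
  whence the factor 2.\<close>

lemma near_optimal_later:
  assumes t: "t \<in> {0..T}" and r: "r \<in> {0..T}" and l: "l \<in> states" and \<mu>: "\<mu> \<in> prob_measures U"
    and opt: "generator q \<mu> (w r) l + f r l \<mu> \<le> H r l (w r) + e"
  shows "generator q \<mu> (w t) l + f t l \<mu> \<le> H t l (w t) + e + 2 * (2 * Mq * CH + C0) * \<bar>t - r\<bar>"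
proof -
  have w: "\<bar>w t j - w r j\<bar> \<le> CH * \<bar>t - r\<bar>" if "j \<in> insert l (nbrs K l)" for j
    by (rule w_lipschitz[OF _ t r]) (use that l mem_nbrsD(1) in blast)
  have 1: "\<bar>generator q \<mu> (w t) l - generator q \<mu> (w r) l\<bar> \<le> 2 * Mq * (CH * \<bar>t - r\<bar>)"
    by (rule generator_diff_le[OF l \<mu> w])
  have 2: "\<bar>f t l \<mu> - f r l \<mu>\<bar> \<le> C0 * \<bar>t - r\<bar>" by (rule f_lip[OF r t l \<mu>])
  have 3: "\<bar>H t l (w t) - H r l (w r)\<bar> \<le> 2 * Mq * (CH * \<bar>t - r\<bar>) + C0 * \<bar>t - r\<bar>"
    by (rule hamiltonian_diff_le[OF l t r w])
  define x where "x = 2 * Mq * (CH * \<bar>t - r\<bar>)"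
  define y where "y = C0 * \<bar>t - r\<bar>"
  have "2 * (2 * Mq * CH + C0) * \<bar>t - r\<bar> = 2 * (x + y)"
    by (simp add: x_def y_def algebra_simps)
  moreover have "generator q \<mu> (w t) l + f t l \<mu> \<le> H t l (w t) + e + 2 * (x + y)"
  proof -
    have "generator q \<mu> (w t) l \<le> generator q \<mu> (w r) l + x" using abs_le_D1[OF 1] by (simp add: x_def)
    moreover have "f t l \<mu> \<le> f r l \<mu> + y" using abs_le_D1[OF 2] by (simp add: y_def)
    moreover have "H r l (w r) \<le> H t l (w t) + x + y" using abs_le_D2[OF 3] by (simp add: x_def y_def)
    ultimately show ?thesis using opt by simp
  qed
  ultimately show ?thesis by simp
qed

lemma near_optimal_control:
  assumes usual: "usual_conditions M F" and rich: "carries_marked_poisson M F"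
    and q_cont: "\<And>i j. i \<in> states \<Longrightarrow> j \<in> states \<Longrightarrow>
        continuous_map (weak_topology U) euclideanreal (q i j)"
    and f_nonneg: "\<And>t i \<mu>. t \<in> {0..T} \<Longrightarrow> i \<in> states \<Longrightarrow> \<mu> \<in> prob_measures U \<Longrightarrow> 0 \<le> f t i \<mu>"
    and g_nonneg: "\<And>i. i \<in> states \<Longrightarrow> 0 \<le> g i"
    and s: "s \<in> {0..<T}" and i: "i \<in> states" and \<epsilon>: "0 < \<epsilon>"
  shows "\<exists>\<alpha>\<in>delay_controls M F T U q m r0 s i.
    cost M T f g s \<alpha> \<le> ennreal (w s i + \<epsilon> * (T - s)) \<and> 0 \<le> w s i + \<epsilon> * (T - s)"
proof -
  define C where "C = 2 * Mq * CH + C0"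
  have C: "0 \<le> C" using Mq_nonneg CH_nonneg C0_nonneg by (simp add: C_def)
  \<comment> \<open>Makes the loss from freezing an action, at most \<open>2 * C * d\<close>, no
    larger than half of \<epsilon>; the other half pays for the choice of near-minimisers. The
    \<open>+ 1\<close> covers \<open>C = 0\<close>.\<close>
  define d where "d = \<epsilon> / (4 * C + 1)"
  have d: "0 < d" using C \<epsilon> by (simp add: d_def)
  have "(4 * C + 1) * d = \<epsilon>" using C by (simp add: d_def)
  then have Cd: "2 * C * d \<le> \<epsilon> / 2" using d by (simp add: algebra_simps)
  have "\<exists>\<mu>. \<mu> \<in> prob_measures U \<and> generator q \<mu> (w (of_int k * d)) l + f (of_int k * d) l \<mu>
      \<le> H (of_int k * d) l (w (of_int k * d)) + \<epsilon> / 2" for k :: int and l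
    using near_optimizer[of "\<epsilon> / 2"] \<epsilon> by (simp add: Bex_def)
  then obtain \<pi> :: "int \<Rightarrow> nat \<Rightarrow> 'a measure" where \<pi>: "\<And>k l. \<pi> k l \<in> prob_measures U"
    "\<And>k l. generator q (\<pi> k l) (w (of_int k * d)) l + f (of_int k * d) l (\<pi> k l)
      \<le> H (of_int k * d) l (w (of_int k * d)) + \<epsilon> / 2"
    by metis
  \<comment> \<open>An intensity that dominates all exit rates and is positive even if all rates
    vanish.\<close>
  have a: "0 < Mq + 1" using Mq_nonneg by simp
  obtain \<sigma> \<xi> :: "nat \<Rightarrow> 'b \<Rightarrow> real"
    where indep: "prob_space.indep_vars M (\<lambda>_. borel) (\<lambda>k. case k of Inl n \<Rightarrow> \<sigma> n | Inr n \<Rightarrow> \<xi> n) UNIV"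
      and expo: "\<forall>n. distributed M lborel (\<sigma> n) (exponential_density (Mq + 1))"
      and unif: "\<forall>n. distr M lborel (\<xi> n) = uniform_measure lborel {0..1}"
      and known: "\<forall>n. \<forall>t\<ge>0. \<forall>x. {\<omega> \<in> space M. (\<Sum>k\<le>n. \<sigma> k \<omega>) \<le> t \<and> \<xi> n \<omega> \<le> x} \<in> sets (F t)"
    using rich[unfolded carries_marked_poisson_def, rule_format, OF a] by blast
  have prob: "prob_space M" by (rule usual[unfolded usual_conditions_def, THEN conjunct1])
  have sub: "subalgebra M (F t)" if "0 \<le> t" for t
    using usual[unfolded usual_conditions_def, THEN conjunct2, THEN conjunct1] that by blast
  have chain: "controlled_chain M (Mq + 1) s d \<sigma> \<xi> (\<lambda>k l j. q l j (\<pi> k l)) i K"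
  proof (rule controlled_chain.intro[OF prob], unfold_locales)
    show "- q l l (\<pi> k l) \<le> Mq + 1" if "l \<in> states" for k l
      using rate_le[OF that \<pi>(1)[of k l]] by simp
    show "q l j (\<pi> k l) = 0" if "l \<in> states" "j \<in> states - {l}" "j \<notin> nbrs K l" for k l j
      by (rule rate_outside_nbrs[OF that \<pi>(1)])
    show "0 \<le> q l j (\<pi> k l)" if "l \<in> states" "j \<in> states - {l}" for k l j
      using that by (intro rate_nonneg \<pi>(1)) auto
    show "(\<Sum>j\<in>nbrs K l. q l j (\<pi> k l)) = - q l l (\<pi> k l)" if "l \<in> states" for k l
      by (rule sum_rates[OF that \<pi>(1)])
  qed (use indep expo unif a d i s in auto)
  interpret N: feedback_chain U q f g T Mq C0 Cf Cg K w B M "Mq + 1" s d \<sigma> \<xi> i \<pi> F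
    by (intro feedback_chain.intro feedback_chain_axioms.intro classical_solution_axioms chain usual \<pi>(1))
      (use known s in auto)
  have control: "(N.proc, N.action) \<in> delay_controls M F T U q m r0 s i" by (rule N.feedback_control)
  interpret P: controlled_process U q f g T Mq C0 Cf Cg K w B M s i N.proc N.action
    by (rule delay_controls_controlled_process[OF classical_solution_axioms prob q_cont sub s i control])
  have opt: "generator q (N.action t \<omega>) (w t) (N.proc t \<omega>) + f t (N.proc t \<omega>) (N.action t \<omega>)
      \<le> H t (N.proc t \<omega>) (w t) + \<epsilon>" if t: "t \<in> {s..T}" for t \<omega>
  proof -
    define k where "k = \<lfloor>t / d\<rfloor>"
    define r where "r = of_int k * d"
    have t0: "t \<in> {0..T}" using t s by auto
    have "of_int k \<le> t / d" "t / d < of_int k + 1" unfolding k_def by linarith+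
    then have "r \<le> t" "t < (of_int k + 1) * d"
      using d by (simp_all add: r_def pos_le_divide_eq pos_divide_less_eq)
    then have r: "r \<le> t" "t - r \<le> d" by (simp_all add: r_def distrib_right)
    \<comment> \<open>The grid is anchored at 0 and not at \<open>s\<close>, so \<open>r\<close> may
      precede \<open>s\<close> but stays in [0, T].\<close>
    have "0 \<le> k" unfolding k_def using t0 d by simp
    then have "r \<in> {0..T}" using r t0 d by (simp add: r_def)
    then have "generator q (\<pi> k (N.proc t \<omega>)) (w t) (N.proc t \<omega>) + f t (N.proc t \<omega>) (\<pi> k (N.proc t \<omega>))
        \<le> H t (N.proc t \<omega>) (w t) + \<epsilon> / 2 + 2 * C * \<bar>t - r\<bar>"
      unfolding C_def by (intro near_optimal_later t0 N.proc_states \<pi>(1) \<pi>(2)[of k, folded r_def])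
    moreover have "2 * C * \<bar>t - r\<bar> \<le> 2 * C * d" using r C by (intro mult_left_mono) auto
    ultimately show ?thesis using Cd unfolding N.action_def k_def[symmetric] by linarith
  qed
  show ?thesis
    using control P.cost_upper[OF f_nonneg g_nonneg opt] by blast
qed

lemma value_fun_eq:
  assumes usual: "usual_conditions M F" and rich: "carries_marked_poisson M F"
    and q_cont: "\<And>i j. i \<in> states \<Longrightarrow> j \<in> states \<Longrightarrow>
        continuous_map (weak_topology U) euclideanreal (q i j)"
    and f_nonneg: "\<And>t i \<mu>. t \<in> {0..T} \<Longrightarrow> i \<in> states \<Longrightarrow> \<mu> \<in> prob_measures U \<Longrightarrow> 0 \<le> f t i \<mu>"
    and g_nonneg: "\<And>i. i \<in> states \<Longrightarrow> 0 \<le> g i"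
    and t: "t \<in> {0..T}" and i: "i \<in> states"
  shows "value_fun M F T U q m r0 f g t i = ennreal (w t i)" "0 \<le> w t i"
proof -
  have "value_fun M F T U q m r0 f g t i = ennreal (w t i) \<and> 0 \<le> w t i"
  proof (cases "t < T")
    case False
    then have "t = T" using t by simp
    then show ?thesis using g_nonneg[OF i] by (simp add: value_fun_def w_T[OF i])
  next
    case True
    then have s: "t \<in> {0..<T}" using t by simp
    have prob: "prob_space M" by (rule usual[unfolded usual_conditions_def, THEN conjunct1])
    have sub: "subalgebra M (F t)" if "0 \<le> t" for t
      using usual[unfolded usual_conditions_def, THEN conjunct2, THEN conjunct1] that by blast
    let ?D = "delay_controls M F T U q m r0 t i"
    have near: "\<exists>\<alpha>\<in>?D. cost M T f g t \<alpha> \<le> ennreal (w t i + e) \<and> 0 \<le> w t i + e" if e: "0 < e" for e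
      using near_optimal_control[OF usual rich q_cont f_nonneg g_nonneg s i, of "e / (T - t)" m r0] e True
      by simp
    \<comment> \<open>The sign comes from the near-optimal bounds, whose real part is nonnegative
      for every tolerance; it is what allows \<open>ennreal\<close> to be inverted.\<close>
    have w0: "0 \<le> w t i"
    proof (rule field_le_epsilon)
      fix e :: real assume "0 < e" then show "0 \<le> w t i + e" using near by blast
    qed
    have "(INF \<alpha>\<in>?D. cost M T f g t \<alpha>) \<le> ennreal (w t i)"
    proof (rule ennreal_le_epsilon)
      fix e :: real assume e: "0 < e"
      then obtain \<alpha> where \<alpha>: "\<alpha> \<in> ?D" "cost M T f g t \<alpha> \<le> ennreal (w t i + e)" using near by blast
      then have "(INF \<alpha>\<in>?D. cost M T f g t \<alpha>) \<le> ennreal (w t i + e)" by (rule INF_lower2)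
      then show "(INF \<alpha>\<in>?D. cost M T f g t \<alpha>) \<le> ennreal (w t i) + ennreal e"
        using w0 e by (simp add: ennreal_plus[symmetric] del: ennreal_plus)
    qed
    moreover have "ennreal (w t i) \<le> (INF \<alpha>\<in>?D. cost M T f g t \<alpha>)"
    proof (rule INF_greatest)
      fix \<alpha> assume "\<alpha> \<in> ?D"
      moreover obtain \<Lambda> \<mu> where \<alpha>: "\<alpha> = (\<Lambda>, \<mu>)" by (cases \<alpha>)
      ultimately have control: "(\<Lambda>, \<mu>) \<in> ?D" by simp
      interpret P: controlled_process U q f g T Mq C0 Cf Cg K w B M t i \<Lambda> \<mu>
        by (rule delay_controls_controlled_process[OF classical_solution_axioms prob q_cont sub s i control])
      show "ennreal (w t i) \<le> cost M T f g t \<alpha>" unfolding \<alpha> by (rule P.cost_lower)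
    qed
    ultimately show ?thesis using w0 True by (simp add: value_fun_def)
  qed
  then show "value_fun M F T U q m r0 f g t i = ennreal (w t i)" "0 \<le> w t i" by blast+
qed

end

text \<open>The value function and \<open>w\<close> agree only on [0, T] and on states, so the
  property has to be transferred rather than rewritten.\<close>

lemma viscosity_solution_cong:
  assumes T: "0 < T" and eq: "\<And>t i. t \<in> {0..T} \<Longrightarrow> i \<in> states \<Longrightarrow> v t i = v' t i"
    and sol: "viscosity_solution T U q f g v'"
  shows "viscosity_solution T U q f g v"
proof -
  have eq0: "v t i = v' t i" if "t \<in> {0..<T}" "i \<in> states" for t i
    by (rule eq) (use that in auto)
  have sub: "viscosity_subsolution T U q f g v'" and super: "viscosity_supersolution T U q f g v'"
    using sol by (simp_all add: viscosity_solution_def)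
  have "continuous_on ({0..T} \<times> states) (\<lambda>(t, i). v' t i)"
    using sub unfolding viscosity_subsolution_def by blast
  then have cont: "continuous_on ({0..T} \<times> states) (\<lambda>(t, i). v t i)"
    by (rule continuous_on_eq) (use eq in auto)
  have terminal: "v T i = g i" if "i \<in> states" for i
    using sub that eq[of T i] T unfolding viscosity_subsolution_def by auto
  have "viscosity_subsolution T U q f g v"
    unfolding viscosity_subsolution_def
  proof (intro conjI allI impI ballI cont terminal)
    fix \<phi> \<phi>' t0 i0
    assume C1: "C1_test_function T \<phi> \<phi>'" and t0: "t0 \<in> {0..<T}" "i0 \<in> states"
      and max: "\<forall>t\<in>{0..<T}. \<forall>i\<in>states. v t i - \<phi> t i \<le> v t0 i0 - \<phi> t0 i0"
    have "\<forall>t\<in>{0..<T}. \<forall>i\<in>states. v' t i - \<phi> t i \<le> v' t0 i0 - \<phi> t0 i0"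
    proof (intro ballI)
      fix t i assume ti: "t \<in> {0..<T}" "i \<in> states"
      show "v' t i - \<phi> t i \<le> v' t0 i0 - \<phi> t0 i0"
        using max[rule_format, OF ti] eq0[OF ti] eq0[OF t0] by simp
    qed
    then show "- \<phi>' t0 i0 - hamiltonian U q f t0 i0 (\<phi> t0) \<le> 0"
      using sub C1 t0 unfolding viscosity_subsolution_def by blast
  qed
  moreover have "viscosity_supersolution T U q f g v"
    unfolding viscosity_supersolution_def
  proof (intro conjI allI impI ballI cont terminal)
    fix \<phi> \<phi>' t0 i0
    assume C1: "C1_test_function T \<phi> \<phi>'" and t0: "t0 \<in> {0..<T}" "i0 \<in> states"
      and min: "\<forall>t\<in>{0..<T}. \<forall>i\<in>states. v t0 i0 - \<phi> t0 i0 \<le> v t i - \<phi> t i"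
    have "\<forall>t\<in>{0..<T}. \<forall>i\<in>states. v' t0 i0 - \<phi> t0 i0 \<le> v' t i - \<phi> t i"
    proof (intro ballI)
      fix t i assume ti: "t \<in> {0..<T}" "i \<in> states"
      show "v' t0 i0 - \<phi> t0 i0 \<le> v' t i - \<phi> t i"
        using min[rule_format, OF ti] eq0[OF ti] eq0[OF t0] by simp
    qed
    then show "0 \<le> - \<phi>' t0 i0 - hamiltonian U q f t0 i0 (\<phi> t0)"
      using super C1 t0 unfolding viscosity_supersolution_def by blast
  qed
  ultimately show ?thesis unfolding viscosity_solution_def ..
qed

lemma compact_nat_finite:
  fixes S :: "nat set"
  assumes "compact S"
  shows "finite S"
proof -
  obtain D where D: "D \<subseteq> (\<lambda>x. {x}) ` S" "finite D" "S \<subseteq> \<Union>D"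
  proof (rule compactE[OF assms, of "(\<lambda>x. {x}) ` S"])
    show "open B" if "B \<in> (\<lambda>x. {x}) ` S" for B
      by (rule discrete_topology_class.open_discrete)
  qed auto
  have "finite (\<Union>D)" using D(1,2) by (intro finite_Union) auto
  then show ?thesis by (rule finite_subset[OF D(3)])
qed

lemma prob_measures_nonempty:
  assumes "U \<noteq> {}"
  shows "prob_measures U \<noteq> {}"
proof -
  obtain u where u: "u \<in> U" using assms by blast
  have "return (restrict_space borel U) u \<in> prob_measures U"
    unfolding prob_measures_def space_prob_algebra
    using u by (auto intro!: prob_space_return simp: space_restrict_space)
  then show ?thesis by blast
qed

text \<open>Finiteness of the value is asserted first because \<open>enn2real\<close> sends infinity
  to 0.\<close>

theorem corollary4p6:
  fixes M :: "'w measure" and F :: "real \<Rightarrow> 'w measure"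
    and U :: "(real ^ 'k) set"
    and q :: "nat \<Rightarrow> nat \<Rightarrow> (real ^ 'k) measure \<Rightarrow> real"
    and f :: "real \<Rightarrow> nat \<Rightarrow> (real ^ 'k) measure \<Rightarrow> real"
    and g \<Phi> :: "nat \<Rightarrow> real"
    and B0 :: "nat set"
    and T r0 c0 \<kappa>0 C0 :: real
    and m K :: nat
  defines "V \<equiv> value_fun M F T U q m r0 f g"
  assumes T: "0 < T"
    and usual: "usual_conditions M F"
    and rich: "carries_marked_poisson M F"
    and U: "compact U" "U \<noteq> {}"
    and rates: "conservative_rates U q"
    and r0: "0 < r0" "r0 < T"
    and f_nonneg: "\<And>t i \<mu>. t \<in> {0..T} \<Longrightarrow> i \<in> states \<Longrightarrow> \<mu> \<in> prob_measures U \<Longrightarrow> 0 \<le> f t i \<mu>"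
    and g_nonneg: "\<And>i. i \<in> states \<Longrightarrow> 0 \<le> g i"
    and f_lsc: "lower_semicontinuous_map
        (prod_topology (top_of_set {0..T})
          (prod_topology (discrete_topology states) (weak_topology U)))
        (\<lambda>(t, i, \<mu>). f t i \<mu>)"
    and g_lsc: "lower_semicontinuous_map (discrete_topology states) g"
    \<comment> \<open>condition (1)\<close>
    and q_cont: "\<And>i j. i \<in> states \<Longrightarrow> j \<in> states \<Longrightarrow>
        continuous_map (weak_topology U) euclideanreal (q i j)"
    and q_bounded: "bdd_above ((\<lambda>(i, \<mu>). - q i i \<mu>) ` (states \<times> prob_measures U))"
    \<comment> \<open>condition (2)\<close>
    and \<Phi>_ge_1: "\<And>i. i \<in> states \<Longrightarrow> 1 \<le> \<Phi> i"
    and \<Phi>_compact: "\<And>c. compact {i \<in> states. \<Phi> i \<le> c}"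
    and B0: "B0 \<subseteq> states" "compact B0"
    and growth_consts: "0 < c0" "0 \<le> \<kappa>0"
    and lyapunov: "\<And>i \<mu>. i \<in> states \<Longrightarrow> \<mu> \<in> prob_measures U \<Longrightarrow>
        generator q \<mu> \<Phi> i \<le> c0 * \<Phi> i + \<kappa>0 * indicator B0 i"
    \<comment> \<open>condition (3)\<close>
    and banded: "\<And>i j \<mu>. i \<in> states \<Longrightarrow> j \<in> states \<Longrightarrow> \<mu> \<in> prob_measures U \<Longrightarrow>
        \<bar>int j - int i\<bar> > int K \<Longrightarrow> q i j \<mu> = 0"
    \<comment> \<open>condition (4)\<close>
    and f_bounded: "bounded ((\<lambda>(t, i, \<mu>). f t i \<mu>) ` ({0..T} \<times> states \<times> prob_measures U))"
    and g_bounded: "bounded (g ` states)"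
    and f_lipschitz: "\<And>s t i \<mu>. s \<in> {0..T} \<Longrightarrow> t \<in> {0..T} \<Longrightarrow> i \<in> states \<Longrightarrow>
        \<mu> \<in> prob_measures U \<Longrightarrow> \<bar>f t i \<mu> - f s i \<mu>\<bar> \<le> C0 * \<bar>t - s\<bar>"
  shows "(\<forall>t\<in>{0..T}. \<forall>i\<in>states. V t i < \<top>) \<and>
    viscosity_solution T U q f g (\<lambda>t i. enn2real (V t i)) \<and>
    dominated_growth T \<Phi> (\<lambda>t i. enn2real (V t i)) \<and>
    (\<forall>v. viscosity_solution T U q f g v \<and> dominated_growth T \<Phi> v \<longrightarrow>
       (\<forall>t\<in>{0..T}. \<forall>i\<in>states. v t i = enn2real (V t i)))"
proof -
  obtain Mq where Mq: "\<And>i \<mu>. i \<in> states \<Longrightarrow> \<mu> \<in> prob_measures U \<Longrightarrow> - q i i \<mu> \<le> Mq"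
    using q_bounded unfolding bdd_above_def by force
  obtain Cf where Cf: "\<And>t i \<mu>. t \<in> {0..T} \<Longrightarrow> i \<in> states \<Longrightarrow> \<mu> \<in> prob_measures U \<Longrightarrow> \<bar>f t i \<mu>\<bar> \<le> Cf"
    using f_bounded unfolding bounded_iff by force
  obtain Cg where Cg: "\<And>i. i \<in> states \<Longrightarrow> \<bar>g i\<bar> \<le> Cg"
    using g_bounded unfolding bounded_iff by force
  have \<Phi>_finite: "finite {i \<in> states. \<Phi> i \<le> c}" for c
    by (rule compact_nat_finite[OF \<Phi>_compact])
  have lyap: "generator q \<mu> \<Phi> i \<le> (c0 + \<kappa>0) * \<Phi> i" if "i \<in> states" "\<mu> \<in> prob_measures U" for i \<mu>
  proof -
    \<comment> \<open>Since \<open>\<Phi> \<ge> 1\<close>, the indicator term is absorbed into a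
      larger exponential rate.\<close>
    have "\<kappa>0 * indicator B0 i \<le> \<kappa>0 * \<Phi> i"
      using \<Phi>_ge_1[OF that(1)] growth_consts(2) by (intro mult_left_mono) (auto simp: indicator_def)
    then show ?thesis using lyapunov[OF that] by (simp add: distrib_right)
  qed
  interpret D: hjb_data U q f g T Mq C0 Cf Cg K
    by unfold_locales (rule T prob_measures_nonempty[OF U(2)] rates banded Mq Cf Cg f_lipschitz; assumption)+
  obtain w B where "classical_solution U q f g T Mq C0 Cf Cg K w B"
    by (rule D.classical_solution_exists)
  then interpret S: classical_solution U q f g T Mq C0 Cf Cg K w B .
  have V_eq: "V t i = ennreal (w t i)" "0 \<le> w t i" if "t \<in> {0..T}" "i \<in> states" for t i
    unfolding V_def by (rule S.value_fun_eq[OF usual rich q_cont f_nonneg g_nonneg that]; assumption)+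
  have eq: "enn2real (V t i) = w t i" if "t \<in> {0..T}" "i \<in> states" for t i
    using V_eq[OF that] by simp
  have "V t i < \<top>" if "t \<in> {0..T}" "i \<in> states" for t i
    using V_eq(1)[OF that] by simp
  moreover have "viscosity_solution T U q f g (\<lambda>t i. enn2real (V t i))"
    by (rule viscosity_solution_cong[OF T eq S.viscosity_solution_w])
  moreover have "dominated_growth T \<Phi> (\<lambda>t i. enn2real (V t i))"
    unfolding dominated_growth_def
  proof (intro allI impI)
    fix \<epsilon> :: real assume "0 < \<epsilon>"
    then have "\<forall>\<^sub>F i in sequentially. \<forall>t\<in>{0..T}. \<bar>w t i\<bar> \<le> \<epsilon> * \<Phi> i"
      using S.dominated_growth_w[OF \<Phi>_finite] unfolding dominated_growth_def by blast
    \<comment> \<open>The index 0 is no state, and the value function equals \<open>w\<close> on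
      states only; it is excluded by passing to indices from 1 on.\<close>
    then show "\<forall>\<^sub>F i in sequentially. \<forall>t\<in>{0..T}. \<bar>enn2real (V t i)\<bar> \<le> \<epsilon> * \<Phi> i"
      using eventually_ge_at_top[of 1] by eventually_elim (simp add: eq)
  qed
  moreover have "v t i = enn2real (V t i)"
    if "viscosity_solution T U q f g v" "dominated_growth T \<Phi> v" "t \<in> {0..T}" "i \<in> states" for v t i
    using S.viscosity_solution_unique[OF that(1,2) \<Phi>_ge_1 \<Phi>_finite lyap _ that(3,4)] growth_consts eq[OF that(3,4)]
    by simp
  ultimately show ?thesis by blast
qed

end
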